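(* Let $K$ be an uncountable compact metric space and let $d\in\mathbb{N}^+$. Then for the prevalent $f\in C(K,\mathbb{R}^d)$, for all $s<\dim_H K$ there is a non-empty open set $U_{f,s}\subset\mathbb{R}^d$ such that for all $y\in U_{f,s}$ we have $$\dim_H f^{-1}(y)\geq s.$$ In particular, for the prevalent $f\in C(K,\mathbb{R}^d)$ we have $$\sup\{\dim_H f^{-1}(y): y\in\mathbb{R}^d\}=\dim_H K.$$
   Context: Prevalence: for an abelian Polish group $G$, a set $A\subset G$ is shy if there exist a Borel set $B\supset A$ in $G$ and a Borel probability measure $\nu$ on $G$ with $\nu(B+x)=0$ for all $x\in G$; complements of shy sets are prevalent. "For the prevalent $f\in G$ property $P$ holds" means that $\{f\in G: P(f)\}$ is prevalent. For compact metric $K$, $C(K,\mathbb{R}^d)$ is the Banach space of continuous maps $K\to\mathbb{R}^d$ with the maximum norm (an abelian Polish group under addition). $\dim_H$ is Hausdorff dimension, with $\dim_H\emptyset=-1$. *)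

theory Defs
  imports "HOL-Probability.Probability"
begin

text \<open>
  The contribution \<open>(diam U)\<^sup>s\<close> of a covering set. It is spelled out because \<open>0 powr 0 = 0\<close>: for
  \<open>s = 0\<close> every nonempty set contributes 1 and the empty set contributes 0.
\<close>

definition diam_pow :: "real \<Rightarrow> 'a::metric_space set \<Rightarrow> ennreal" where
  "diam_pow s U = (if U = {} then 0 else if s = 0 then 1 else ennreal (diameter U powr s))"

text \<open>
  Covers are indexed by \<^typ>\<open>nat\<close>; finite covers are included because covering sets may be empty.
  Boundedness is demanded explicitly because \<^const>\<open>diameter\<close> is only meaningful for bounded sets.
\<close>

definition delta_covers :: "real \<Rightarrow> 'a::metric_space set \<Rightarrow> (nat \<Rightarrow> 'a set) set" where
  "delta_covers \<delta> A =
     {U. A \<subseteq> (\<Union>i. U i) \<and> (\<forall>i. bounded (U i) \<and> diameter (U i) \<le> \<delta>)}"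

definition hausdorff_premeasure :: "real \<Rightarrow> real \<Rightarrow> 'a::metric_space set \<Rightarrow> ennreal" where
  "hausdorff_premeasure \<delta> s A = (INF U\<in>delta_covers \<delta> A. \<Sum>i. diam_pow s (U i))"

text \<open>The supremum over \<open>\<delta> > 0\<close> is the limit as \<open>\<delta>\<close> decreases to 0.\<close>

definition hausdorff_measure :: "real \<Rightarrow> 'a::metric_space set \<Rightarrow> ennreal" where
  "hausdorff_measure s A = (SUP \<delta>\<in>{0<..}. hausdorff_premeasure \<delta> s A)"

definition hausdorff_dim :: "'a::metric_space set \<Rightarrow> ereal" where
  "hausdorff_dim A =
     (if A = {} then -1 else Inf {ereal s | s. 0 \<le> s \<and> hausdorff_measure s A = 0})"

text \<open>
  These notions are intended for abelian Polish groups. Polishness is not a class constraint: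
  the type of bounded continuous functions from \<open>K\<close> to a Euclidean space, with the supremum norm, is
  separable when \<open>K\<close> is compact, but that hypothesis is invisible to the type class system.
\<close>

definition shy :: "'g::topological_ab_group_add set \<Rightarrow> bool" where
  "shy A \<longleftrightarrow>
     (\<exists>B \<nu>. A \<subseteq> B \<and> B \<in> sets borel \<and> prob_space \<nu> \<and> sets \<nu> = sets borel \<and>
            (\<forall>x. emeasure \<nu> ((\<lambda>b. b + x) ` B) = 0))"

definition prevalent :: "'g::topological_ab_group_add set \<Rightarrow> bool" where
  "prevalent A \<longleftrightarrow> shy (- A)"

end

theory Submission
  imports Defs
begin

text \<open>
  Fix \<open>s < dim K\<close>. A Frostman measure \<open>\<mu>\<close> of exponent slightly above \<open>s\<close> is only needed as a finitely
  additive set function, which is a cluster point of discrete measures. Cut \<open>K\<close>, up to a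
  \<open>\<mu>\<close>-small remainder, into a tree of separated cells whose diameters decrease extremely fast, and let
  the random perturbation \<open>g\<close> add on each cell of level \<open>n + 1\<close> a random digit of a finite
  \<open>1/2\<close>-net of the unit ball, scaled by \<open>(3/4)\<^sup>n\<close> and independent of those on the other cells of
  that level.

  Given \<open>f\<close>, the pigeonhole principle selects below every cell a subtree on which \<open>f\<close> varies by at most
  \<open>(3/4)\<^sup>n\<close> at level \<open>n\<close> and which keeps a fraction of the mass depending only on \<open>n\<close> and on a bound
  for \<open>f\<close>. Almost surely, from some level on, the digits on the selected children of every cell are
  equidistributed (Hoeffding and Borel-Cantelli), so each \<open>y\<close> in a fixed ball can be followed down a
  subtree on which \<open>f + g\<close> converges to \<open>y\<close>, again keeping a controlled fraction of mass. Since the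
  diameters shrink much faster than these fractions accumulate, the mass distribution principle bounds
  the \<open>s\<close>-dimensional content of the fibre over \<open>y\<close> from below. For \<open>s = 0\<close> any measure giving
  uniformly small mass to small balls suffices, which exists because \<open>K\<close> is uncountable.

  A lower bound for the content of the fibre over \<open>y\<close> is a closed condition on the map, so the good maps
  form a Borel set.
\<close>

section \<open>Finitely additive measures and Frostman's lemma\<close>

text \<open>The perturbation is fixed before \<open>f\<close> is known, so the tree and its scales
  can use neither a modulus of continuity nor a norm bound of \<open>f\<close>. This dictates the
  order of the choices. The scales \<open>b n\<close> determine finite nets of values, the nets
  determine the pigeonhole loss \<open>N n\<close>, the accumulated losses determine how small
  \<open>D n\<close> has to be, and the mass bound on each new level depends on the level before it,
  so that the failure probabilities become summable. A map bounded by an integer \<open>A\<close>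
  fits these choices only from level \<open>A\<close> on, and the digits behave well only from a
  random level on; hence the starting level \<open>n0\<close> that appears throughout.

  The ratio 3/4 is a balance: a digit from a \<open>1/2\<close>-net halves the distance to the
  target \<open>y\<close>, and the approximate value of \<open>f\<close> may drift by another
  quarter of the scale when passing to a child.\<close>

definition finitely_additive_prob :: "('a set \<Rightarrow> real) \<Rightarrow> bool" where
  "finitely_additive_prob \<mu> \<longleftrightarrow> (\<forall>A. 0 \<le> \<mu> A) \<and> \<mu> UNIV = 1 \<and>
     (\<forall>A B. A \<inter> B = {} \<longrightarrow> \<mu> (A \<union> B) = \<mu> A + \<mu> B)"

lemma fap_nonneg: "finitely_additive_prob \<mu> \<Longrightarrow> 0 \<le> \<mu> A"
  and fap_UNIV: "finitely_additive_prob \<mu> \<Longrightarrow> \<mu> UNIV = 1"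
  and fap_Un: "finitely_additive_prob \<mu> \<Longrightarrow> A \<inter> B = {} \<Longrightarrow> \<mu> (A \<union> B) = \<mu> A + \<mu> B"
  by (auto simp: finitely_additive_prob_def)

lemma fap_empty: "finitely_additive_prob \<mu> \<Longrightarrow> \<mu> {} = 0"
  using fap_Un[of \<mu> "{}" "{}"] by simp

lemma fap_mono:
  assumes "finitely_additive_prob \<mu>" "A \<subseteq> B"
  shows "\<mu> A \<le> \<mu> B"
proof -
  have "\<mu> (A \<union> (B - A)) = \<mu> A + \<mu> (B - A)"
    by (rule fap_Un[OF assms(1)]) auto
  moreover have "A \<union> (B - A) = B" using assms(2) by auto
  ultimately show ?thesis using fap_nonneg[OF assms(1), of "B - A"] by simp
qed

lemma fap_le_1: "finitely_additive_prob \<mu> \<Longrightarrow> \<mu> A \<le> 1"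
  using fap_mono[of \<mu> A UNIV] fap_UNIV[of \<mu>] by simp

lemma fap_Un_le:
  assumes "finitely_additive_prob \<mu>"
  shows "\<mu> (A \<union> B) \<le> \<mu> A + \<mu> B"
proof -
  have "\<mu> (A \<union> (B - A)) = \<mu> A + \<mu> (B - A)"
    by (rule fap_Un[OF assms(1)]) auto
  moreover have "\<mu> (B - A) \<le> \<mu> B" by (rule fap_mono[OF assms]) auto
  ultimately show ?thesis by simp
qed

lemma fap_UN_le:
  assumes "finitely_additive_prob \<mu>" "finite I"
  shows "\<mu> (\<Union>i\<in>I. A i) \<le> (\<Sum>i\<in>I. \<mu> (A i))"
  using assms(2)
proof induction
  case empty then show ?case by (simp add: fap_empty[OF assms(1)])
next
  case (insert i I)
  have "\<mu> (\<Union>i\<in>insert i I. A i) \<le> \<mu> (A i) + \<mu> (\<Union>i\<in>I. A i)"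
    using fap_Un_le[OF assms(1)] by simp
  then show ?case using insert by simp
qed

lemma fap_UN_disjoint:
  assumes "finitely_additive_prob \<mu>" "finite I" "disjoint_family_on A I"
  shows "\<mu> (\<Union>i\<in>I. A i) = (\<Sum>i\<in>I. \<mu> (A i))"
  using assms(2,3)
proof induction
  case empty then show ?case by (simp add: fap_empty[OF assms(1)])
next
  case (insert i I)
  have "A i \<inter> (\<Union>i\<in>I. A i) = {}" using insert by (auto simp: disjoint_family_on_def)
  moreover have "disjoint_family_on A I" using insert by (auto simp: disjoint_family_on_def)
  ultimately show ?case using insert fap_Un[OF assms(1)] by simp
qed

text \<open>Tychonoff's theorem for the cube of all functions from sets to \<open>{0..1}\<close>.
  The cluster point is taken along a filter, since a product with so many coordinates may fail to be
  sequentially compact. Additivity on a fixed pair of sets and an upper bound at a fixed set are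
  closed conditions and therefore survive.\<close>

lemma fap_cluster_point:
  fixes \<mu> :: "nat \<Rightarrow> 'a set \<Rightarrow> real"
  assumes fap: "\<And>k. finitely_additive_prob (\<mu> k)"
  shows "\<exists>\<nu>. finitely_additive_prob \<nu> \<and>
    (\<forall>A c. (\<forall>\<^sub>F k in sequentially. \<mu> k A \<le> c) \<longrightarrow> \<nu> A \<le> c)"
proof -
  define U :: "('a set \<Rightarrow> real) set" where "U = PiE UNIV (\<lambda>_. {0..1})"
  have "compactin (product_topology (\<lambda>_. euclidean) UNIV) U"
    unfolding U_def compactin_PiE by auto
  then have "compact U" by (simp add: euclidean_product_topology)
  define F where "F = filtermap \<mu> sequentially"
  have "F \<noteq> bot" by (simp add: F_def filtermap_bot_iff)
  moreover have "eventually (\<lambda>m. m \<in> U) F"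
    using fap_nonneg[OF fap] fap_le_1[OF fap] by (simp add: F_def eventually_filtermap U_def PiE_def Pi_def)
  ultimately obtain \<nu> where \<nu>: "inf (nhds \<nu>) F \<noteq> bot"
    using \<open>compact U\<close> unfolding compact_filter by blast
  have closedD: "\<nu> \<in> C" if "closed C" "\<forall>\<^sub>F k in sequentially. \<mu> k \<in> C" for C
  proof (rule ccontr)
    assume "\<nu> \<notin> C"
    then have "eventually (\<lambda>m. m \<in> - C) (nhds \<nu>)"
      using that(1) by (intro eventually_nhds_in_open) auto
    moreover have "eventually (\<lambda>m. m \<in> C) F" using that(2) by (simp add: F_def eventually_filtermap)
    ultimately have "eventually (\<lambda>m. False) (inf (nhds \<nu>) F)"
      unfolding eventually_inf by (intro exI[of _ "\<lambda>m. m \<in> - C"] exI[of _ "\<lambda>m. m \<in> C"]) auto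
    then show False using \<nu> by simp
  qed
  have cont: "continuous_on UNIV (\<lambda>m. m A)" for A :: "'a set"
    by (rule continuous_on_product_coordinates)
  show ?thesis
  proof (intro exI[of _ \<nu>] conjI allI impI)
    show "\<nu> A \<le> c" if "\<forall>\<^sub>F k in sequentially. \<mu> k A \<le> c" for A c
      using closedD[of "{m. m A \<le> c}"] that cont by (simp add: closed_Collect_le)
    have "0 \<le> \<nu> A" for A
      using closedD[of "{m. 0 \<le> m A}"] fap_nonneg[OF fap] cont by (simp add: closed_Collect_le)
    moreover have "\<nu> UNIV = 1"
      using closedD[of "{m. m UNIV = 1}"] fap_UNIV[OF fap] cont by (simp add: closed_Collect_eq)
    moreover have "\<nu> (A \<union> B) = \<nu> A + \<nu> B" if "A \<inter> B = {}" for A B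
      using closedD[of "{m. m (A \<union> B) = m A + m B}"] fap_Un[OF fap that] cont
      by (simp add: closed_Collect_eq continuous_on_add)
    ultimately show "finitely_additive_prob \<nu>" by (auto simp: finitely_additive_prob_def)
  qed
qed

lemma fap_weights:
  assumes "finite X" "\<And>x. x \<in> X \<Longrightarrow> 0 \<le> w x" "sum w X > 0"
  shows "finitely_additive_prob (\<lambda>A. sum w (X \<inter> A) / sum w X)"
  unfolding finitely_additive_prob_def
proof (intro conjI allI impI)
  show "0 \<le> sum w (X \<inter> A) / sum w X" for A
    using assms by (intro divide_nonneg_pos sum_nonneg) auto
  show "sum w (X \<inter> UNIV) / sum w X = 1" using assms by simp
  show "sum w (X \<inter> (A \<union> B)) / sum w X = sum w (X \<inter> A) / sum w X + sum w (X \<inter> B) / sum w X"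
    if "A \<inter> B = {}" for A B
  proof -
    have "X \<inter> (A \<union> B) = (X \<inter> A) \<union> (X \<inter> B)" by auto
    then have "sum w (X \<inter> (A \<union> B)) = sum w (X \<inter> A) + sum w (X \<inter> B)"
      using assms(1) that by (simp only:) (intro sum.union_disjoint, auto)
    then show ?thesis by (simp add: add_divide_distrib)
  qed
qed

section \<open>Frostman's lemma at one scale and in the limit\<close>

lemma finite_has_argmax:
  fixes f :: "'a \<Rightarrow> 'b::linorder"
  assumes "finite A" "A \<noteq> {}"
  obtains a where "a \<in> A" "\<And>b. b \<in> A \<Longrightarrow> f b \<le> f a"
proof -
  have "Max (f ` A) \<in> f ` A" using assms by (intro Max_in) auto
  then obtain a where "a \<in> A" "f a = Max (f ` A)" by auto
  then show ?thesis using that assms(1) by (metis Max_ge finite_imageI imageI)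
qed

text \<open>Greedy selection: keep a ball of largest radius, discard all balls meeting it, which its
  threefold enlargement swallows, and recurse on the rest.\<close>

lemma Vitali_finite_balls:
  fixes a :: "'i \<Rightarrow> 'b::metric_space"
  assumes "finite I" "\<And>i. i \<in> I \<Longrightarrow> 0 < r i"
  shows "\<exists>C\<subseteq>I. pairwise (\<lambda>i j. disjnt (ball (a i) (r i)) (ball (a j) (r j))) C \<and>
           (\<Union>i\<in>I. ball (a i) (r i)) \<subseteq> (\<Union>i\<in>C. ball (a i) (3 * r i))"
  using assms
proof (induction I rule: finite_psubset_induct)
  case (psubset I)
  show ?case
  proof (cases "I = {}")
    case False
    obtain i0 where i0: "i0 \<in> I" "\<And>i. i \<in> I \<Longrightarrow> r i \<le> r i0"
      using finite_has_argmax[OF psubset(1) False, of r] by blast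
    define J where "J = {i\<in>I. disjnt (ball (a i) (r i)) (ball (a i0) (r i0))}"
    have "i0 \<notin> J" using psubset(3)[OF i0(1)] by (auto simp: J_def disjnt_def)
    then have "J \<subset> I" using i0(1) unfolding J_def by blast
    moreover have "\<And>i. i \<in> J \<Longrightarrow> 0 < r i" using psubset(3) by (auto simp: J_def)
    ultimately obtain C where C: "C \<subseteq> J" "pairwise (\<lambda>i j. disjnt (ball (a i) (r i)) (ball (a j) (r j))) C"
      "(\<Union>i\<in>J. ball (a i) (r i)) \<subseteq> (\<Union>i\<in>C. ball (a i) (3 * r i))"
      using psubset(2)[of J] by blast
    have "ball (a i) (r i) \<subseteq> ball (a i0) (3 * r i0)" if "i \<in> I" "i \<notin> J" for i
    proof
      fix x assume x: "x \<in> ball (a i) (r i)"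
      from that obtain z where "dist (a i) z < r i" "dist (a i0) z < r i0"
        by (auto simp: J_def disjnt_iff)
      moreover have "dist (a i0) x \<le> dist (a i0) z + dist (a i) z + dist (a i) x"
        by (smt (verit) dist_commute dist_triangle)
      ultimately show "x \<in> ball (a i0) (3 * r i0)" using x i0(2)[OF that(1)] by simp
    qed
    then have "(\<Union>i\<in>I. ball (a i) (r i)) \<subseteq> (\<Union>i\<in>insert i0 C. ball (a i) (3 * r i))"
      using C(3) by blast
    moreover have "pairwise (\<lambda>i j. disjnt (ball (a i) (r i)) (ball (a j) (r j))) (insert i0 C)"
      using C(1,2) by (auto simp: pairwise_insert J_def disjnt_sym)
    moreover have "insert i0 C \<subseteq> I" using C(1) i0(1) by (auto simp: J_def)
    ultimately show ?thesis by blast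
  qed auto
qed

text \<open>The points are treated one after another, and the weight at each is raised until a first
  constraint through it becomes tight. A constraint that was tight before stays tight: if it
  contains the new point, the admissible increase is zero.\<close>

lemma maximal_weights:
  fixes h :: "'i \<Rightarrow> real"
  assumes "finite F" "finite X" "\<And>i. i \<in> F \<Longrightarrow> 0 \<le> h i" "\<And>i. i \<in> F \<Longrightarrow> S i \<subseteq> X"
    "\<And>x. x \<in> X \<Longrightarrow> \<exists>i\<in>F. x \<in> S i"
  obtains w :: "'a \<Rightarrow> real" where "\<And>x. 0 \<le> w x" "\<And>i. i \<in> F \<Longrightarrow> sum w (S i) \<le> h i"
    "\<And>x. x \<in> X \<Longrightarrow> \<exists>i\<in>F. x \<in> S i \<and> sum w (S i) = h i"
proof -
  have "\<exists>w::'a \<Rightarrow> real. (\<forall>x. 0 \<le> w x) \<and> (\<forall>i\<in>F. sum w (S i) \<le> h i) \<and>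
    (\<forall>x\<in>Y. \<exists>i\<in>F. x \<in> S i \<and> sum w (S i) = h i)" if "finite Y" "Y \<subseteq> X" for Y
    using that
  proof (induction rule: finite_subset_induct)
    case empty
    show ?case using assms(3) by (intro exI[of _ "\<lambda>_. 0"]) auto
  next
    case (insert x Y)
    then obtain w :: "'a \<Rightarrow> real" where w: "\<And>x. 0 \<le> w x" "\<And>i. i \<in> F \<Longrightarrow> sum w (S i) \<le> h i"
      "\<And>x. x \<in> Y \<Longrightarrow> \<exists>i\<in>F. x \<in> S i \<and> sum w (S i) = h i" by blast
    define F' where "F' = {i\<in>F. x \<in> S i}"
    define g where "g i = h i - sum w (S i)" for i
    have F': "finite (g ` F')" "g ` F' \<noteq> {}" using assms(1,5) insert(2) by (auto simp: F'_def)
    define \<delta> where "\<delta> = Min (g ` F')"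
    obtain j where j: "j \<in> F'" "g j = \<delta>" using Min_in[OF F'] by (auto simp: \<delta>_def)
    have \<delta>_le: "\<delta> \<le> g i" if "i \<in> F'" for i using Min_le[OF F'(1)] that by (auto simp: \<delta>_def)
    have "0 \<le> \<delta>" using j w(2) by (auto simp: F'_def g_def)
    define w' where "w' y = w y + (if y = x then \<delta> else 0)" for y
    have fS: "finite (S i)" if "i \<in> F" for i using assms(2) assms(4)[OF that] by (rule finite_subset[rotated])
    have sum_w': "sum w' (S i) = sum w (S i) + (if x \<in> S i then \<delta> else 0)" if "i \<in> F" for i
      using fS[OF that] by (simp add: w'_def sum.distrib)
    have le: "sum w' (S i) \<le> h i" if "i \<in> F" for i
      using \<delta>_le[of i] w(2)[OF that] that by (auto simp: sum_w' F'_def g_def)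
    show ?case
    proof (intro exI[of _ w'] conjI ballI allI)
      show "0 \<le> w' y" for y using w(1) \<open>0 \<le> \<delta>\<close> by (simp add: w'_def)
      show "sum w' (S i) \<le> h i" if "i \<in> F" for i by (rule le[OF that])
      fix y assume "y \<in> insert x Y"
      then show "\<exists>i\<in>F. y \<in> S i \<and> sum w' (S i) = h i"
      proof
        assume "y = x"
        then show ?thesis using j by (intro bexI[of _ j]) (auto simp: F'_def g_def sum_w')
      next
        assume "y \<in> Y"
        then obtain i where "i \<in> F" "y \<in> S i" "sum w (S i) = h i" using w(3) by blast
        then show ?thesis using \<open>0 \<le> \<delta>\<close> le[of i] by (intro bexI[of _ i]) (auto simp: sum_w' split: if_splits)
      qed
    qed
  qed
  from this[OF assms(2) order_refl] that show ?thesis by blast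
qed

text \<open>
  The maximal weights are saturated at every point of a net by some ball, and the saturated balls
  form a cover; Vitali's lemma then bounds the total mass from below. This replaces the usual duality
  argument behind Frostman's lemma.
\<close>

lemma frostman_at_scale:
  fixes s c \<epsilon> :: real
  assumes comp: "compact (UNIV :: 'k::metric_space set)"
    and s: "0 \<le> s" and c: "0 < c" and \<epsilon>: "0 < \<epsilon>"
    and content: "\<And>(I :: ('k::metric_space \<times> 'k) set) p \<rho>. \<lbrakk>finite I; \<And>i. i \<in> I \<Longrightarrow> 0 < \<rho> i; (UNIV :: 'k set) = (\<Union>i\<in>I. ball (p i) (\<rho> i))\<rbrakk>
          \<Longrightarrow> c \<le> (\<Sum>i\<in>I. \<rho> i powr s)"
  obtains \<mu> :: "'k::metric_space set \<Rightarrow> real" where "finitely_additive_prob \<mu>"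
    "\<And>x r. \<epsilon> \<le> r \<Longrightarrow> \<mu> (ball x r) \<le> 4 powr s * 3 powr s / c * r powr s"
proof -
  obtain X where X: "finite X" "(UNIV :: 'k set) \<subseteq> (\<Union>x\<in>X. ball x \<epsilon>)"
    using comp \<epsilon> unfolding compact_eq_totally_bounded by blast
  \<comment> \<open>Distances between net points, enlarged by \<open>\<epsilon>\<close>, are the
    only radii used: this keeps the constraints finite in number, yet they control every ball of
    radius at least \<open>\<epsilon>\<close>.\<close>
  define \<rho> where "\<rho> = (\<lambda>(p::'k, q). dist p q + \<epsilon>)"
  define B where "B i = ball (fst i) (\<rho> i)" for i
  have \<rho>: "\<epsilon> \<le> \<rho> i" for i by (auto simp: \<rho>_def split: prod.splits)
  obtain w :: "'k \<Rightarrow> real" where w: "\<And>x. 0 \<le> w x" "\<And>i. i \<in> X \<times> X \<Longrightarrow> sum w (X \<inter> B i) \<le> \<rho> i powr s"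
    "\<And>x. x \<in> X \<Longrightarrow> \<exists>i\<in>X \<times> X. x \<in> X \<inter> B i \<and> sum w (X \<inter> B i) = \<rho> i powr s"
  proof (rule maximal_weights[of "X \<times> X" X "\<lambda>i. \<rho> i powr s" "\<lambda>i. X \<inter> B i"])
    show "\<exists>i\<in>X \<times> X. x \<in> X \<inter> B i" if "x \<in> X" for x
      using that \<epsilon> by (intro bexI[of _ "(x, x)"]) (auto simp: B_def \<rho>_def)
  qed (use X in auto)
  define T where "T = {i\<in>X \<times> X. sum w (X \<inter> B i) = \<rho> i powr s}"
  have "finite T" using X(1) by (simp add: T_def)
  moreover have "0 < \<rho> i" for i using \<rho>[of i] \<epsilon> by simp
  ultimately obtain C where C: "C \<subseteq> T" "pairwise (\<lambda>i j. disjnt (B i) (B j)) C"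
    "(\<Union>i\<in>T. B i) \<subseteq> (\<Union>i\<in>C. ball (fst i) (3 * \<rho> i))"
    using Vitali_finite_balls[of T \<rho> fst] unfolding B_def by blast
  have "finite C" using C(1) \<open>finite T\<close> by (rule finite_subset)
  \<comment> \<open>The factor 4 is Vitali's 3 plus one more radius, spent on passing from a net
    point to an arbitrary point within \<open>\<epsilon>\<close> of it.\<close>
  have cov: "UNIV = (\<Union>i\<in>C. ball (fst i) (4 * \<rho> i))"
  proof (rule UNIV_eq_I)
    fix y
    have "y \<in> (\<Union>x\<in>X. ball x \<epsilon>)" using X(2) by blast
    then obtain x where x: "x \<in> X" "dist x y < \<epsilon>" by auto
    then obtain i where "i \<in> T" "x \<in> B i" using w(3)[of x] by (auto simp: T_def)
    then have "x \<in> (\<Union>i\<in>C. ball (fst i) (3 * \<rho> i))" using C(3) by blast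
    then obtain j where j: "j \<in> C" "dist (fst j) x < 3 * \<rho> j" by auto
    have "dist (fst j) y < 4 * \<rho> j" using dist_triangle[of "fst j" y x] x(2) j(2) \<rho>[of j] by simp
    then show "y \<in> (\<Union>i\<in>C. ball (fst i) (4 * \<rho> i))" using j(1) by auto
  qed
  have "c \<le> (\<Sum>i\<in>C. (4 * \<rho> i) powr s)"
    using \<open>\<And>i. 0 < \<rho> i\<close> by (intro content[OF \<open>finite C\<close> _ cov]) simp
  also have "\<dots> = 4 powr s * (\<Sum>i\<in>C. sum w (X \<inter> B i))"
  proof -
    have "(4 * \<rho> i) powr s = 4 powr s * sum w (X \<inter> B i)" if "i \<in> C" for i
      using C(1) that less_imp_le[OF \<open>\<And>i. 0 < \<rho> i\<close>] by (auto simp: T_def powr_mult)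
    then show ?thesis unfolding sum_distrib_left[of "4 powr s" _ C] by (intro sum.cong) auto
  qed
  also have "(\<Sum>i\<in>C. sum w (X \<inter> B i)) = sum w (\<Union>i\<in>C. X \<inter> B i)"
  proof (rule sum.UNION_disjoint[symmetric])
    show "\<forall>i\<in>C. \<forall>j\<in>C. i \<noteq> j \<longrightarrow> X \<inter> B i \<inter> (X \<inter> B j) = {}"
      using C(2) unfolding pairwise_def disjnt_def by blast
  qed (use \<open>finite C\<close> X(1) in auto)
  also have "\<dots> \<le> sum w X" using X(1) w(1) by (intro sum_mono2) auto
  finally have W: "c \<le> 4 powr s * sum w X" by simp
  have "sum w X > 0"
  proof (rule ccontr)
    assume "\<not> sum w X > 0"
    then have "4 powr s * sum w X \<le> 0" by (intro mult_nonneg_nonpos) auto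
    then show False using W c by simp
  qed
  show ?thesis
  proof
    show "finitely_additive_prob (\<lambda>A. sum w (X \<inter> A) / sum w X)"
      using X(1) w(1) \<open>sum w X > 0\<close> by (intro fap_weights) auto
    fix x r assume r: "\<epsilon> \<le> r"
    have "sum w (X \<inter> ball x r) \<le> (3 * r) powr s"
    proof (cases "X \<inter> ball x r = {}")
      case False
      then obtain a where a: "a \<in> X" "dist x a < r" by auto
      \<comment> \<open>With \<open>b\<close> farthest from \<open>a\<close> among the net points of
        \<open>ball x r\<close>, the constraint ball \<open>B (a, b)\<close> contains all of them.
        Its radius is at most \<open>2 * r + \<epsilon>\<close>, hence at most \<open>3 * r\<close>;
        this is the origin of \<open>3 powr s\<close>.\<close>
      obtain b where b: "b \<in> X \<inter> ball x r" "\<And>y. y \<in> X \<inter> ball x r \<Longrightarrow> dist a y \<le> dist a b"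
        using finite_has_argmax[of "X \<inter> ball x r" "dist a"] X(1) False by blast
      have "X \<inter> ball x r \<subseteq> X \<inter> B (a, b)" using b(2) \<epsilon> by (fastforce simp: B_def \<rho>_def)
      then have "sum w (X \<inter> ball x r) \<le> sum w (X \<inter> B (a, b))" using X(1) w(1) by (intro sum_mono2) auto
      also have "\<dots> \<le> \<rho> (a, b) powr s" using a b by (intro w(2)) auto
      also have "\<dots> \<le> (3 * r) powr s"
        using a(2) b(1) r dist_triangle3[of a b x] \<rho>[of "(a,b)"] s \<epsilon>
        by (intro powr_mono2) (auto simp: \<rho>_def)
      finally show ?thesis .
    qed simp
    then have "sum w (X \<inter> ball x r) / sum w X \<le> (3 * r) powr s / (c / 4 powr s)"
      using W c by (intro frac_le) (auto simp: field_simps)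
    also have "\<dots> = 4 powr s * 3 powr s / c * r powr s"
      using r \<epsilon> by (simp add: powr_mult)
    finally show "sum w (X \<inter> ball x r) / sum w X \<le> 4 powr s * 3 powr s / c * r powr s" .
  qed
qed

text \<open>Positive measure controls fine covers only. A cover containing a ball of radius above
  \<open>\<delta> / 2\<close> is expensive because of that single ball; otherwise the balls form an
  admissible cover at scale \<open>\<delta>\<close>, and replacing diameters by radii costs the
  factor \<open>2 powr s\<close>.\<close>

lemma hausdorff_measure_nonzero_imp_content_pos:
  fixes s :: real
  assumes s: "0 < s" and nz: "hausdorff_measure s (UNIV :: 'k::metric_space set) \<noteq> 0"
  obtains c :: real where "0 < c"
    "\<And>(I :: 'i set) p \<rho>. \<lbrakk>finite I; \<And>i. i \<in> I \<Longrightarrow> 0 < \<rho> i; (UNIV :: 'k::metric_space set) = (\<Union>i\<in>I. ball (p i) (\<rho> i))\<rbrakk>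
          \<Longrightarrow> c \<le> (\<Sum>i\<in>I. \<rho> i powr s)"
proof -
  from nz obtain \<delta> where \<delta>: "0 < \<delta>" "hausdorff_premeasure \<delta> s (UNIV :: 'k set) > 0"
    unfolding hausdorff_measure_def
    by (smt (verit, best) SUP_eq_const bot_ennreal bot.not_eq_extremum ex_in_conv greaterThan_iff greaterThan_non_empty)
  obtain h :: real where h: "0 < h" "ennreal h \<le> hausdorff_premeasure \<delta> s (UNIV :: 'k set)"
    by (metis \<delta>(2) dense ennreal_less_zero_iff less_imp_le order_less_imp_not_less less_top enn2real_positive_iff
        ennreal_enn2real less_trans top.not_eq_extremum)
  show ?thesis
  proof
    show "0 < min ((\<delta> / 2) powr s) (h / 2 powr s)" using \<delta>(1) h(1) by simp
    fix I :: "'i set" and p :: "'i \<Rightarrow> 'k" and \<rho> :: "'i \<Rightarrow> real"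
    assume I: "finite I" "\<And>i. i \<in> I \<Longrightarrow> 0 < \<rho> i" "(UNIV :: 'k set) = (\<Union>i\<in>I. ball (p i) (\<rho> i))"
    show "min ((\<delta> / 2) powr s) (h / 2 powr s) \<le> (\<Sum>i\<in>I. \<rho> i powr s)"
    proof (cases "\<exists>i\<in>I. \<delta> / 2 < \<rho> i")
      case True
      then obtain i where i: "i \<in> I" "\<delta> / 2 < \<rho> i" by blast
      have "(\<delta> / 2) powr s \<le> \<rho> i powr s" using i(2) \<delta>(1) s by (intro powr_mono2) auto
      also have "\<dots> \<le> (\<Sum>i\<in>I. \<rho> i powr s)" using I(1) i(1) by (intro member_le_sum) auto
      finally show ?thesis by simp
    next
      case False
      obtain e where e: "bij_betw e {..<card I} I" using bij_betw_from_nat_into_finite[OF I(1)] by blast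
      define U where "U n = (if n < card I then ball (p (e n)) (\<rho> (e n)) else {})" for n
      have eI: "e n \<in> I" if "n < card I" for n using e that by (auto simp: bij_betw_def)
      have diam: "diameter (ball (p i) (\<rho> i)) \<le> 2 * \<rho> i" if "i \<in> I" for i
        using I(2)[OF that] unfolding diameter_def
        by (auto intro!: cSUP_least) (smt (verit) dist_triangle3 dist_commute)
      have "U \<in> delta_covers \<delta> UNIV"
      proof -
        have "x \<in> (\<Union>n. U n)" for x
        proof -
          obtain i where "i \<in> I" "x \<in> ball (p i) (\<rho> i)" using I(3) by blast
          moreover from this e obtain n where "n < card I" "e n = i"
            unfolding bij_betw_def by (metis imageE lessThan_iff)
          ultimately show ?thesis by (auto simp: U_def)
        qed
        moreover have "bounded (U n) \<and> diameter (U n) \<le> \<delta>" for n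
          using diam[OF eI] False eI \<delta>(1) by (force simp: U_def)
        ultimately show ?thesis by (auto simp: delta_covers_def)
      qed
      then have "hausdorff_premeasure \<delta> s (UNIV::'k set) \<le> (\<Sum>n. diam_pow s (U n))"
        unfolding hausdorff_premeasure_def by (rule INF_lower)
      also have "\<dots> = (\<Sum>n<card I. diam_pow s (U n))"
        by (rule suminf_finite) (auto simp: U_def diam_pow_def)
      also have "\<dots> \<le> (\<Sum>n<card I. ennreal ((2 * \<rho> (e n)) powr s))"
        using s diam[OF eI] by (intro sum_mono) (auto simp: U_def diam_pow_def intro!: ennreal_leI powr_mono2 diameter_ge_0)
      also have "\<dots> = ennreal (\<Sum>n<card I. (2 * \<rho> (e n)) powr s)" by (rule sum_ennreal) auto
      also have "(\<Sum>n<card I. (2 * \<rho> (e n)) powr s) = (\<Sum>i\<in>I. (2 * \<rho> i) powr s)"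
        by (rule sum.reindex_bij_betw[OF e])
      also have "\<dots> = 2 powr s * (\<Sum>i\<in>I. \<rho> i powr s)"
        using I(2) by (auto simp: sum_distrib_left powr_mult less_imp_le intro!: sum.cong)
      finally have "ennreal h \<le> ennreal (2 powr s * (\<Sum>i\<in>I. \<rho> i powr s))" using h(2) by simp
      then have "h \<le> 2 powr s * (\<Sum>i\<in>I. \<rho> i powr s)" by (subst (asm) ennreal_le_iff) (auto intro!: mult_nonneg_nonneg sum_nonneg)
      then show ?thesis by (simp add: field_simps min.coboundedI2)
    qed
  qed
qed

text \<open>A little-o form of the Frostman condition, uniform in the centre. The arbitrary factor
  \<open>L\<close> later absorbs the mass lost on the levels above a given one. For
  \<open>s = 0\<close> it says that small balls have uniformly small mass.\<close>

definition mass_decay :: "('k::metric_space set \<Rightarrow> real) \<Rightarrow> real \<Rightarrow> bool" where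
  "mass_decay \<mu> s \<longleftrightarrow> (\<forall>L. \<exists>D>0. \<forall>x r. 0 < r \<and> r < D \<longrightarrow> L * \<mu> (ball x r) \<le> r powr s)"

lemma hausdorff_measure_nonzero:
  assumes "0 \<le> s" "ereal s < hausdorff_dim A" 
  shows "hausdorff_measure s A \<noteq> 0"
proof
  assume "hausdorff_measure s A = 0"
  then have "Inf {ereal s | s. 0 \<le> s \<and> hausdorff_measure s A = 0} \<le> ereal s"
    using assms(1) by (intro Inf_lower) auto
  moreover have "(-1::ereal) \<le> ereal s" using assms(1) by (simp add: one_ereal_def)
  ultimately show False using assms(2) by (auto simp: hausdorff_dim_def split: if_splits)
qed

text \<open>The bound at radius \<open>r\<close> is inherited from the measures of all scales below
  \<open>r\<close>, so the cluster point satisfies it for every positive radius. The surplus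
  \<open>r powr (t - s)\<close> then beats any constant.\<close>

lemma frostman:
  assumes comp: "compact (UNIV :: 'k::metric_space set)"
    and s: "0 \<le> s" "ereal s < hausdorff_dim (UNIV :: 'k::metric_space set)"
  obtains \<mu> :: "'k::metric_space set \<Rightarrow> real" where "finitely_additive_prob \<mu>" "mass_decay \<mu> s"
proof -
  obtain t where t: "ereal s < ereal t" "ereal t < hausdorff_dim (UNIV :: 'k set)"
    using ereal_dense2[OF s(2)] by blast
  then have "0 < t" "s < t" using s(1) by auto
  then obtain c where c: "0 < c" 
    "\<And>(I :: ('k\<times>'k) set) p \<rho>. \<lbrakk>finite I; \<And>i. i \<in> I \<Longrightarrow> 0 < \<rho> i; (UNIV :: 'k set) = (\<Union>i\<in>I. ball (p i) (\<rho> i))\<rbrakk>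
          \<Longrightarrow> c \<le> (\<Sum>i\<in>I. \<rho> i powr t)"
    using hausdorff_measure_nonzero_imp_content_pos[OF \<open>0 < t\<close> hausdorff_measure_nonzero[OF less_imp_le[OF \<open>0 < t\<close>] t(2)],
        where 'i = "'k \<times> 'k"] by blast
  define C where "C = 4 powr t * 3 powr t / c"
  have "\<exists>\<mu>. finitely_additive_prob \<mu> \<and> (\<forall>(x::'k) r. 1 / real (Suc n) \<le> r \<longrightarrow> \<mu> (ball x r) \<le> C * r powr t)" for n
  proof (rule frostman_at_scale[OF comp less_imp_le[OF \<open>0 < t\<close>] c(1) _ c(2), of "1 / real (Suc n)"])
    fix \<mu> assume "finitely_additive_prob \<mu>"
      "\<And>(x::'k) r. 1 / real (Suc n) \<le> r \<Longrightarrow> \<mu> (ball x r) \<le> 4 powr t * 3 powr t / c * r powr t"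
    then show ?thesis unfolding C_def by blast
  qed auto
  then obtain \<mu>' where \<mu>': "\<And>n. finitely_additive_prob (\<mu>' n)"
    "\<And>n (x::'k) r. 1 / real (Suc n) \<le> r \<Longrightarrow> \<mu>' n (ball x r) \<le> C * r powr t" by metis
  obtain \<mu> where \<mu>: "finitely_additive_prob \<mu>" "\<And>A c. (\<forall>\<^sub>F k in sequentially. \<mu>' k A \<le> c) \<Longrightarrow> \<mu> A \<le> c"
    using fap_cluster_point[of \<mu>', OF \<mu>'(1)] by metis
  have le: "\<mu> (ball x r) \<le> C * r powr t" if r: "0 < r" for x r
  proof (rule \<mu>(2))
    obtain N where N: "1 / real (Suc N) < r" by (rule nat_approx_posE[OF r])
    have "1 / real (Suc n) \<le> r" if "N \<le> n" for n
    proof -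
      have "1 / real (Suc n) \<le> 1 / real (Suc N)" using that by (intro divide_left_mono) auto
      with N show ?thesis by simp
    qed
    then show "\<forall>\<^sub>F k in sequentially. \<mu>' k (ball x r) \<le> C * r powr t"
      using \<mu>'(2) unfolding eventually_sequentially by blast
  qed
  have "mass_decay \<mu> s"
    unfolding mass_decay_def
  proof
    fix L :: real
    define M where "M = max 1 (L * C)"
    \<comment> \<open>The solution of \<open>M * r powr (t - s) = 1\<close>.\<close>
    define D where "D = (1 / M) powr (1 / (t - s))"
    have "M > 0" by (simp add: M_def)
    show "\<exists>D>0. \<forall>x r. 0 < r \<and> r < D \<longrightarrow> L * \<mu> (ball x r) \<le> r powr s"
    proof (intro exI[of _ D] conjI allI impI)
      show "0 < D" using \<open>M > 0\<close> by (simp add: D_def)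
      fix x r assume r: "0 < r \<and> r < D"
      have "r powr (t - s) \<le> D powr (t - s)" using r \<open>s < t\<close> by (intro powr_mono2) auto
      also have "\<dots> = 1 / M" using \<open>M > 0\<close> \<open>s < t\<close> by (simp add: D_def powr_powr)
      finally have rM: "M * r powr (t - s) \<le> 1" using \<open>M > 0\<close> by (simp add: field_simps)
      show "L * \<mu> (ball x r) \<le> r powr s"
      proof (cases "0 \<le> L")
        case True
        have "L * \<mu> (ball x r) \<le> L * (C * r powr t)" using le r True by (intro mult_left_mono) auto
        also have "\<dots> \<le> M * r powr t" by (simp add: M_def mult.assoc[symmetric] mult_right_mono)
        also have "\<dots> = M * r powr (t - s) * r powr s" using r by (simp add: powr_add[symmetric] mult.assoc)
        also have "\<dots> \<le> r powr s" using mult_right_mono[OF rM, of "r powr s"] by simp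
        finally show ?thesis .
      next
        case False
        then have "L * \<mu> (ball x r) \<le> 0" using fap_nonneg[OF \<mu>(1)] by (simp add: mult_nonpos_nonneg)
        then show ?thesis by (smt (verit) powr_ge_zero)
      qed
    qed
  qed
  then show ?thesis using \<mu>(1) that by blast
qed

section \<open>Diffuse measures and separated partitions\<close>

lemma fap_counting:
  fixes p :: "'i \<Rightarrow> 'a"
  assumes "finite I" "I \<noteq> {}"
  shows "finitely_additive_prob (\<lambda>A. real (card {i\<in>I. p i \<in> A}) / real (card I))"
  unfolding finitely_additive_prob_def
proof (intro conjI allI impI)
  show "real (card {i\<in>I. p i \<in> UNIV}) / real (card I) = 1" using assms by simp
  show "real (card {i\<in>I. p i \<in> A \<union> B}) / real (card I)
      = real (card {i\<in>I. p i \<in> A}) / real (card I) + real (card {i\<in>I. p i \<in> B}) / real (card I)"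
    if "A \<inter> B = {}" for A B
  proof -
    have "{i\<in>I. p i \<in> A \<union> B} = {i\<in>I. p i \<in> A} \<union> {i\<in>I. p i \<in> B}" by auto
    moreover have "card ({i\<in>I. p i \<in> A} \<union> {i\<in>I. p i \<in> B}) = card {i\<in>I. p i \<in> A} + card {i\<in>I. p i \<in> B}"
      using assms(1) that by (intro card_Un_disjoint) auto
    ultimately show ?thesis by (simp add: add_divide_distrib)
  qed
qed simp

text \<open>By compactness \<open>S\<close> has a condensation point \<open>p\<close>. Apart from
  \<open>p\<close>, the set \<open>S\<close> is a countable union of its parts outside balls around
  \<open>p\<close>, so one such part is uncountable; the part inside the ball of half that radius is
  the other piece.\<close>

lemma uncountable_split:
  fixes S :: "'k::metric_space set"
  assumes comp: "compact (UNIV :: 'k set)" and S: "uncountable S"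
  shows "\<exists>S1 S2 \<delta>. uncountable S1 \<and> uncountable S2 \<and> S1 \<subseteq> S \<and> S2 \<subseteq> S \<and> 0 < \<delta> \<and>
            (\<forall>x\<in>S1. \<forall>y\<in>S2. \<delta> \<le> dist x y)"
proof -
  have "\<exists>p. \<forall>e>0. uncountable (S \<inter> ball p e)"
  proof (rule ccontr)
    assume "\<nexists>p. \<forall>e>0. uncountable (S \<inter> ball p e)"
    then obtain e where e: "\<And>p. 0 < e p" "\<And>p. countable (S \<inter> ball p (e p))" by metis
    obtain C :: "'k set" where C: "finite C" "(UNIV :: 'k set) \<subseteq> (\<Union>p\<in>C. ball p (e p))"
    proof (rule compactE_image[OF comp, of UNIV "\<lambda>p. ball p (e p)"])
      show "UNIV \<subseteq> (\<Union>p. ball p (e p))"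
      proof
        fix x show "x \<in> (\<Union>p. ball p (e p))" using e(1)[of x] by (intro UN_I[of x]) simp_all
      qed
    qed simp
    then have "S = (\<Union>p\<in>C. S \<inter> ball p (e p))" by blast
    also have "countable \<dots>" using C(1) e(2) by (intro countable_UN) (auto simp: countable_finite)
    finally show False using S by simp
  qed
  then obtain p where p: "\<And>e. 0 < e \<Longrightarrow> uncountable (S \<inter> ball p e)" by blast
  have "\<exists>n. uncountable (S - ball p (1 / real (Suc n)))"
  proof (rule ccontr)
    assume "\<nexists>n. uncountable (S - ball p (1 / real (Suc n)))"
    then have "countable (\<Union>n. S - ball p (1 / real (Suc n)))" by (intro countable_UN) auto
    moreover have "S \<subseteq> insert p (\<Union>n. S - ball p (1 / real (Suc n)))"
    proof
      fix x assume "x \<in> S"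
      show "x \<in> insert p (\<Union>n. S - ball p (1 / real (Suc n)))"
      proof (cases "x = p")
        case False
        then have "0 < dist p x" by simp
        then obtain n where "1 / real (Suc n) < dist p x" by (rule nat_approx_posE)
        then show ?thesis using \<open>x \<in> S\<close> by (auto intro!: exI[of _ n])
      qed simp
    qed
    ultimately show False using S countable_subset countable_insert by metis
  qed
  then obtain n where n: "uncountable (S - ball p (1 / real (Suc n)))" by blast
  define \<delta> where "\<delta> = 1 / real (Suc n) / 2"
  have "0 < \<delta>" by (simp add: \<delta>_def)
  show ?thesis
  proof (rule exI[of _ "S - ball p (1 / real (Suc n))"], rule exI[of _ "S \<inter> ball p \<delta>"], rule exI[of _ \<delta>],
      intro conjI ballI)
    fix x y assume "x \<in> S - ball p (1 / real (Suc n))" "y \<in> S \<inter> ball p \<delta>"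
    moreover have "1 / real (Suc n) = 2 * \<delta>" by (simp add: \<delta>_def del: of_nat_Suc)
    ultimately have "2 * \<delta> \<le> dist p x" "dist p y < \<delta>" by (auto simp del: of_nat_Suc)
    then show "\<delta> \<le> dist x y" using dist_triangle2[of p x y] by (simp add: dist_commute)
  qed (use n p \<open>0 < \<delta>\<close> in auto)
qed

text \<open>A Cantor scheme of uncountable sets: the \<open>2 ^ n\<close> pieces of level
  \<open>n\<close> have positive mutual distance, so a small ball meets only one of them. The
  counting measure on one point from each piece of level \<open>k\<close> gives every piece of a
  level \<open>n\<close> up to \<open>k\<close> the mass \<open>1 / 2 ^ n\<close>, and the cluster
  point inherits the bound for small balls.\<close>

lemma uncountable_imp_diffuse_fap:
  assumes comp: "compact (UNIV :: 'k::metric_space set)" and unc: "uncountable (UNIV :: 'k set)"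
  shows "\<exists>\<mu> :: 'k set \<Rightarrow> real. finitely_additive_prob \<mu> \<and> mass_decay \<mu> 0"
proof -
  obtain F :: "bool \<Rightarrow> 'k set \<Rightarrow> 'k set" and d where F: "\<And>S b. uncountable S \<Longrightarrow> uncountable (F b S) \<and> F b S \<subseteq> S \<and> 0 < d S"
    "\<And>S x y. uncountable S \<Longrightarrow> x \<in> F True S \<Longrightarrow> y \<in> F False S \<Longrightarrow> (d S::real) \<le> dist x y"
  proof -
    obtain F1 F2 :: "'k set \<Rightarrow> 'k set" and d where "\<And>S. uncountable S \<Longrightarrow> uncountable (F1 S) \<and> uncountable (F2 S)
      \<and> F1 S \<subseteq> S \<and> F2 S \<subseteq> S \<and> 0 < d S \<and> (\<forall>x\<in>F1 S. \<forall>y\<in>F2 S. (d S :: real) \<le> dist x y)"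
      using uncountable_split[OF comp] by metis
    then show ?thesis using that[of "\<lambda>b. if b then F1 else F2" d] by auto
  qed
  \<comment> \<open>The head of the list is the latest choice, so ancestors arise by dropping
    initial entries.\<close>
  define S where "S l = foldr F l UNIV" for l
  have S_Cons: "S (b # l) = F b (S l)" for b l by (simp add: S_def)
  have unc_S: "uncountable (S l)" for l
    by (induction l) (use unc F(1) in \<open>auto simp: S_def\<close>)
  have S_drop: "S l \<subseteq> S (drop m l)" for l m
  proof (induction l arbitrary: m)
    case (Cons b l)
    have "S (b # l) \<subseteq> S l" using F(1)[OF unc_S] by (simp add: S_Cons)
    then show ?case using Cons[of "m - 1"] by (cases m) auto
  qed simp
  have sep: "\<exists>\<delta>>0. \<forall>l l'. length l = n \<longrightarrow> length l' = n \<longrightarrow> l \<noteq> l' \<longrightarrow> (\<forall>x\<in>S l. \<forall>y\<in>S l'. \<delta> \<le> dist x y)" for n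
  proof (induction n)
    case 0
    then show ?case by (auto intro!: exI[of _ 1])
  next
    case (Suc n)
    then obtain \<delta> where \<delta>: "0 < \<delta>" "\<And>l l' x y. length l = n \<Longrightarrow> length l' = n \<Longrightarrow> l \<noteq> l' \<Longrightarrow> x \<in> S l \<Longrightarrow> y \<in> S l' \<Longrightarrow> \<delta> \<le> dist x y"
      by blast
    have fin: "finite {l :: bool list. length l = n}" by (rule finite_list_length)
    define \<eta> where "\<eta> = Min (insert \<delta> ((\<lambda>l. d (S l)) ` {l. length l = n}))"
    have \<eta>: "\<eta> \<le> \<delta>" "\<And>l. length l = n \<Longrightarrow> \<eta> \<le> d (S l)" using fin by (auto simp: \<eta>_def)
    have "0 < \<eta>" using fin \<delta>(1) F(1)[OF unc_S] by (auto simp: \<eta>_def)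
    moreover have "\<eta> \<le> dist x y" if l: "length l = Suc n" "length l' = Suc n" "l \<noteq> l'" and xy: "x \<in> S l" "y \<in> S l'" for l l' x y
    proof -
      obtain b m b' m' where lm: "l = b # m" "l' = b' # m'" "length m = n" "length m' = n"
        using l(1,2) by (auto simp: length_Suc_conv)
      show ?thesis
      proof (cases "m = m'")
        case True
        then have "d (S m) \<le> dist x y"
          using l(3) lm xy F(2)[OF unc_S, of x m y] F(2)[OF unc_S, of y m x]
          by (cases b; cases b') (auto simp: S_Cons dist_commute)
        then show ?thesis using \<eta>(2)[OF lm(3)] by simp
      next
        case False
        have "x \<in> S m" "y \<in> S m'" using xy F(1)[OF unc_S] by (auto simp: lm S_Cons)
        then have "\<delta> \<le> dist x y" using \<delta>(2) lm False by blast
        then show ?thesis using \<eta>(1) by simp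
      qed
    qed
    ultimately show ?case by (intro exI[of _ \<eta>]) blast
  qed
  have "S l \<noteq> {}" for l using unc_S[of l] by force
  then have "\<exists>p. \<forall>l. p l \<in> S l" by (intro choice) auto
  then obtain p where p: "\<And>l. p l \<in> S l" by blast
  define I where "I n = {l :: bool list. length l = n}" for n
  have fin: "finite (I n)" for n unfolding I_def by (rule finite_list_length)
  have card_I: "card (I n) = 2 ^ n" for n using card_lists_length_eq[of "UNIV :: bool set" n] by (simp add: I_def)
  define \<mu>' where "\<mu>' n A = real (card {i\<in>I n. p i \<in> A}) / real (card (I n))" for n A
  have "I n \<noteq> {}" for n using card_I[of n] by force
  then have "finitely_additive_prob (\<mu>' n)" for n unfolding \<mu>'_def by (intro fap_counting fin)
  then obtain \<mu> where \<mu>: "finitely_additive_prob \<mu>" "\<And>A c. (\<forall>\<^sub>F k in sequentially. \<mu>' k A \<le> c) \<Longrightarrow> \<mu> A \<le> c"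
    using fap_cluster_point[of \<mu>'] by metis
  have small: "\<exists>D>0. \<forall>x r. 0 < r \<and> r < D \<longrightarrow> \<mu> (ball x r) \<le> 1 / 2 ^ n" for n
  proof -
    obtain \<delta> where \<delta>: "0 < \<delta>" "\<And>l l' x y. length l = n \<Longrightarrow> length l' = n \<Longrightarrow> l \<noteq> l' \<Longrightarrow> x \<in> S l \<Longrightarrow> y \<in> S l' \<Longrightarrow> \<delta> \<le> dist x y"
      using sep[of n] by blast
    have "\<mu> (ball x r) \<le> 1 / 2 ^ n" if r: "0 < r" "r < \<delta> / 2" for x r
    proof (rule \<mu>(2))
      have "\<mu>' k (ball x r) \<le> 1 / 2 ^ n" if k: "n \<le> k" for k
      proof (cases "{i\<in>I k. p i \<in> ball x r} = {}")
        case False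
        then obtain i0 where i0: "i0 \<in> I k" "p i0 \<in> ball x r" by blast
        have "{i\<in>I k. p i \<in> ball x r} \<subseteq> (\<lambda>m. m @ drop (k - n) i0) ` I (k - n)"
        proof safe
          fix i assume i: "i \<in> I k" "p i \<in> ball x r"
          have "dist (p i) (p i0) < \<delta>"
            using i(2) i0(2) r dist_triangle3[of "p i" "p i0" x] by (simp add: dist_commute)
          moreover have "p i \<in> S (drop (k - n) i)" "p i0 \<in> S (drop (k - n) i0)" using p S_drop by blast+
          ultimately have "drop (k - n) i = drop (k - n) i0"
            using \<delta>(2)[of "drop (k - n) i" "drop (k - n) i0" "p i" "p i0"] i(1) i0(1) k by (force simp: I_def)
          then have "i = take (k - n) i @ drop (k - n) i0" by (metis append_take_drop_id)
          then show "i \<in> (\<lambda>m. m @ drop (k - n) i0) ` I (k - n)"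
            using i(1) by (intro image_eqI[of _ _ "take (k - n) i"]) (auto simp: I_def)
        qed
        then have "card {i\<in>I k. p i \<in> ball x r} \<le> card (I (k - n))"
          using fin by (meson card_image_le card_mono finite_imageI order_trans)
        then have "real (card {i\<in>I k. p i \<in> ball x r}) \<le> 2 ^ (k - n)"
          by (metis card_I of_nat_le_iff of_nat_numeral of_nat_power)
        then have "\<mu>' k (ball x r) \<le> 2 ^ (k - n) / 2 ^ k"
          by (simp add: \<mu>'_def card_I divide_right_mono)
        also have "\<dots> = 1 / 2 ^ n" using k by (simp add: power_diff)
        finally show ?thesis .
      qed (simp only: \<mu>'_def, simp)
      then show "\<forall>\<^sub>F k in sequentially. \<mu>' k (ball x r) \<le> 1 / 2 ^ n"
        unfolding eventually_sequentially by blast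
    qed
    then show ?thesis using \<delta>(1) by (intro exI[of _ "\<delta> / 2"]) auto
  qed
  have "mass_decay \<mu> 0"
    unfolding mass_decay_def
  proof
    fix L :: real
    obtain n where n: "L < 2 ^ n" using real_arch_pow[of 2 L] by auto
    obtain D where D: "D > 0" "\<And>x r. 0 < r \<Longrightarrow> r < D \<Longrightarrow> \<mu> (ball x r) \<le> 1 / 2 ^ n" using small[of n] by blast
    have "L * \<mu> (ball x r) \<le> r powr 0" if "0 < r \<and> r < D" for x r
    proof -
      have "L * \<mu> (ball x r) \<le> 2 ^ n * \<mu> (ball x r)"
        using n fap_nonneg[OF \<mu>(1)] by (intro mult_right_mono) auto
      also have "\<dots> \<le> 2 ^ n * (1 / 2 ^ n)" using D(2) that by (intro mult_left_mono) auto
      finally show ?thesis using that by simp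
    qed
    then show "\<exists>D>0. \<forall>x r. 0 < r \<and> r < D \<longrightarrow> L * \<mu> (ball x r) \<le> r powr 0" using D(1) by blast
  qed
  then show ?thesis using \<mu>(1) by blast
qed

text \<open>
  Among many disjoint annuli around a centre one has small mass; cutting along it separates the cells
  although \<open>\<mu>\<close> is not assumed to be regular.
\<close>

lemma thin_annulus:
  assumes fap: "finitely_additive_prob \<mu>" and "0 < D" "0 < \<epsilon>"
  shows "\<exists>\<rho> \<eta>. D \<le> \<rho> \<and> 0 < \<eta> \<and> \<rho> + \<eta> \<le> 2 * D \<and> \<mu> (ball x (\<rho> + \<eta>) - ball x \<rho>) \<le> \<epsilon>"
proof -
  obtain N where N: "1 / real (Suc N) < \<epsilon>" using assms(3) by (rule nat_approx_posE)
  define \<eta> where "\<eta> = D / real (Suc N)"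
  define \<rho> where "\<rho> i = D + real i * \<eta>" for i
  define A where "A i = ball x (\<rho> i + \<eta>) - ball x (\<rho> i)" for i
  have "0 < \<eta>" using assms(2) by (simp add: \<eta>_def)
  have mono: "\<rho> i + \<eta> \<le> \<rho> j" if "i < j" for i j :: nat
  proof -
    have "real (Suc i) * \<eta> \<le> real j * \<eta>" using that \<open>0 < \<eta>\<close> by (intro mult_right_mono) linarith+
    then show ?thesis by (simp add: \<rho>_def algebra_simps)
  qed
  have "disjoint_family_on A {..<Suc N}"
    unfolding disjoint_family_on_def
  proof (intro ballI impI)
    fix i j :: nat assume "i \<noteq> j"
    then consider "i < j" | "j < i" by linarith
    then show "A i \<inter> A j = {}" by cases (use mono in \<open>fastforce simp: A_def\<close>)+
  qed
  then have "\<mu> (\<Union>i<Suc N. A i) = (\<Sum>i<Suc N. \<mu> (A i))"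
    by (intro fap_UN_disjoint[OF fap]) auto
  then have sum: "(\<Sum>i<Suc N. \<mu> (A i)) \<le> 1" using fap_le_1[OF fap] by metis
  have "\<exists>i<Suc N. \<mu> (A i) \<le> \<epsilon>"
  proof (rule ccontr)
    assume "\<not> ?thesis"
    then have "(\<Sum>i<Suc N. \<epsilon>) \<le> (\<Sum>i<Suc N. \<mu> (A i))" by (intro sum_mono) force
    then have "real (Suc N) * \<epsilon> \<le> 1" using sum by simp
    then show False using N by (simp add: field_simps)
  qed
  then obtain i where i: "i < Suc N" "\<mu> (A i) \<le> \<epsilon>" by blast
  have "real (Suc i) * \<eta> \<le> real (Suc N) * \<eta>" using i(1) \<open>0 < \<eta>\<close> by (intro mult_right_mono) linarith+
  moreover have "real (Suc N) * \<eta> = D" by (simp add: \<eta>_def)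
  ultimately have "\<rho> i + \<eta> \<le> 2 * D" by (simp add: \<rho>_def algebra_simps)
  moreover have "D \<le> \<rho> i" using \<open>0 < \<eta>\<close> by (simp add: \<rho>_def)
  ultimately show ?thesis using i(2) \<open>0 < \<eta>\<close> by (auto simp: A_def)
qed

definition separated_family :: "real \<Rightarrow> 'a::metric_space set set \<Rightarrow> bool" where
  "separated_family \<delta> \<C> \<longleftrightarrow> 0 < \<delta> \<and> (\<forall>s\<in>\<C>. \<forall>t\<in>\<C>. s \<noteq> t \<longrightarrow> (\<forall>x\<in>s. \<forall>y\<in>t. \<delta> \<le> dist x y))"

text \<open>A cell is a ball minus all earlier balls enlarged by their annuli, which leaves a gap
  between any two cells. A point missed by all cells lies in the annulus of the first enlarged ball
  containing it, and these annuli have small total mass.\<close>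

lemma separated_partition:
  assumes comp: "compact (UNIV :: 'k::metric_space set)" and fap: "finitely_additive_prob (\<mu> :: 'k set \<Rightarrow> real)"
    and "0 < D" "0 < \<epsilon>"
  obtains \<C> \<delta> where "finite \<C>" "separated_family \<delta> \<C>" "\<And>s. s \<in> \<C> \<Longrightarrow> \<exists>x. s \<subseteq> ball x D" "\<mu> (- \<Union>\<C>) \<le> \<epsilon>"
proof -
  obtain X where X: "finite X" "(UNIV :: 'k set) \<subseteq> (\<Union>x\<in>X. ball x (D / 2))"
    using comp assms(3) unfolding compact_eq_totally_bounded by (metis half_gt_zero)
  then have "X \<noteq> {}" by blast
  define \<epsilon>' where "\<epsilon>' = \<epsilon> / real (card X)"
  have "0 < card X" using X(1) \<open>X \<noteq> {}\<close> by (simp add: card_gt_0_iff)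
  then have "0 < \<epsilon>'" using assms(4) by (simp add: \<epsilon>'_def)
  then have "\<exists>\<rho> \<eta>. D / 2 \<le> \<rho> \<and> 0 < \<eta> \<and> \<rho> + \<eta> \<le> D \<and> \<mu> (ball x (\<rho> + \<eta>) - ball x \<rho>) \<le> \<epsilon>'" for x
    using thin_annulus[OF fap, of "D / 2" \<epsilon>' x] assms(3) by simp
  then obtain \<rho> \<eta> where \<rho>: "\<And>x. D / 2 \<le> \<rho> x" "\<And>x. 0 < \<eta> x" "\<And>x. \<rho> x + \<eta> x \<le> D"
    "\<And>x. \<mu> (ball x (\<rho> x + \<eta> x) - ball x (\<rho> x)) \<le> \<epsilon>'" by metis
  obtain e where e: "bij_betw e {..<card X} X" using bij_betw_from_nat_into_finite[OF X(1)] by blast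
  define c where "c i = ball (e i) (\<rho> (e i)) - (\<Union>j<i. ball (e j) (\<rho> (e j) + \<eta> (e j)))" for i
  define \<delta> where "\<delta> = Min (\<eta> ` X)"
  have "0 < \<delta>" using X(1) \<open>X \<noteq> {}\<close> \<rho>(2) by (simp add: \<delta>_def)
  have eX: "e i \<in> X" if "i < card X" for i using e that by (auto simp: bij_betw_def)
  have sep: "\<delta> \<le> dist x y" if "i < j" "j < card X" "x \<in> c i" "y \<in> c j" for i j x y
  proof -
    have "\<delta> \<le> \<eta> (e i)" using X(1) eX that by (auto simp: \<delta>_def)
    moreover have "dist (e i) x < \<rho> (e i)" using that by (auto simp: c_def)
    moreover have "\<rho> (e i) + \<eta> (e i) \<le> dist (e i) y" using that(1,4) by (force simp: c_def)
    ultimately show ?thesis using dist_triangle[of "e i" y x] by simp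
  qed
  show ?thesis
  proof
    show "finite (c ` {..<card X})" by simp
    show "separated_family \<delta> (c ` {..<card X})"
      unfolding separated_family_def
    proof (intro conjI ballI impI \<open>0 < \<delta>\<close>)
      fix s t x y assume s: "s \<in> c ` {..<card X}" "t \<in> c ` {..<card X}" "s \<noteq> t" "x \<in> s" "y \<in> t"
      then obtain i j where ij: "i < card X" "j < card X" "s = c i" "t = c j" by auto
      with s have "i \<noteq> j" by auto
      then consider "i < j" | "j < i" by linarith
      then show "\<delta> \<le> dist x y"
      proof cases
        case 1
        then show ?thesis using sep ij s by blast
      next
        case 2
        then show ?thesis using sep[of j i y x] ij s by (simp add: dist_commute)
      qed
    qed
    show "\<exists>x. s \<subseteq> ball x D" if "s \<in> c ` {..<card X}" for s
    proof -
      obtain i where i: "s = c i" using \<open>s \<in> c ` {..<card X}\<close> by blast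
      have "\<rho> (e i) \<le> D" using \<rho>(2)[of "e i"] \<rho>(3)[of "e i"] by simp
      then show ?thesis unfolding i c_def by (intro exI[of _ "e i"]) auto
    qed
    have "- \<Union>(c ` {..<card X}) \<subseteq> (\<Union>x\<in>X. ball x (\<rho> x + \<eta> x) - ball x (\<rho> x))"
    proof
      fix y assume y: "y \<in> - \<Union>(c ` {..<card X})"
      define P where "P i \<longleftrightarrow> i < card X \<and> y \<in> ball (e i) (\<rho> (e i) + \<eta> (e i))" for i
      have "y \<in> (\<Union>x\<in>X. ball x (D / 2))" using X(2) by blast
      then obtain x where x: "x \<in> X" "dist x y < D / 2" by auto
      then obtain i0 where "i0 < card X" "e i0 = x" using e unfolding bij_betw_def by (metis imageE lessThan_iff)
      then have "P i0" using x(2) \<rho>(1)[of x] \<rho>(2)[of x] by (simp add: P_def)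
      then obtain i where i: "P i" "\<And>j. j < i \<Longrightarrow> \<not> P j" using exists_least_iff[of P] by blast
      have "y \<notin> c i" using y i(1) by (auto simp: P_def)
      moreover have "y \<notin> (\<Union>j<i. ball (e j) (\<rho> (e j) + \<eta> (e j)))"
      proof safe
        fix j assume "j < i" "y \<in> ball (e j) (\<rho> (e j) + \<eta> (e j))"
        then show False using i(2)[of j] i(1) by (simp add: P_def)
      qed
      ultimately have "y \<notin> ball (e i) (\<rho> (e i))" by (auto simp: c_def)
      then show "y \<in> (\<Union>x\<in>X. ball x (\<rho> x + \<eta> x) - ball x (\<rho> x))"
        using i(1) eX[of i] unfolding P_def by (intro UN_I[of "e i"]) auto
    qed
    then have "\<mu> (- \<Union>(c ` {..<card X})) \<le> (\<Sum>x\<in>X. \<mu> (ball x (\<rho> x + \<eta> x) - ball x (\<rho> x)))"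
      by (intro order_trans[OF fap_mono[OF fap] fap_UN_le[OF fap X(1)]])
    also have "\<dots> \<le> (\<Sum>x\<in>X. \<epsilon>')" by (intro sum_mono \<rho>(4))
    also have "\<dots> = \<epsilon>" using \<open>0 < card X\<close> by (simp add: \<epsilon>'_def)
    finally show "\<mu> (- \<Union>(c ` {..<card X})) \<le> \<epsilon>" .
  qed
qed

section \<open>Trees of cells and the mass distribution principle\<close>

lemma mass_decay_imp_diffuse:
  assumes "mass_decay \<mu> s" "0 \<le> s" "0 < \<kappa>"
  obtains D where "0 < D" "\<And>x r. 0 < r \<Longrightarrow> r < D \<Longrightarrow> \<mu> (ball x r) \<le> \<kappa>"
proof -
  obtain D where D: "0 < D" "\<And>x r. 0 < r \<and> r < D \<Longrightarrow> 1 / \<kappa> * \<mu> (ball x r) \<le> r powr s"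
    using assms(1) unfolding mass_decay_def by meson
  have "\<mu> (ball x r) \<le> \<kappa>" if r: "0 < r" "r < min D 1" for x r
  proof -
    have "1 / \<kappa> * \<mu> (ball x r) \<le> r powr s" using D(2) r by simp
    also have "\<dots> \<le> 1" using r assms(2) by (intro powr_le1) auto
    finally show ?thesis using assms(3) by (simp add: field_simps)
  qed
  then show ?thesis using D(1) by (intro that[of "min D 1"]) auto
qed

lemma refine_cells:
  fixes \<mu> :: "'k::metric_space set \<Rightarrow> real"
  assumes comp: "compact (UNIV :: 'k set)" and fap: "finitely_additive_prob \<mu>"
    and decay: "mass_decay \<mu> s" "0 \<le> s"
    and P: "finite P" "P \<noteq> {}" "separated_family \<delta> P" "\<And>t. t \<in> P \<Longrightarrow> 0 < \<mu> t"
    and "0 < D" "0 < \<kappa>"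
  shows "\<exists>P' \<delta>'. finite P' \<and> P' \<noteq> {} \<and> separated_family \<delta>' P' \<and> (\<forall>s\<in>P'. 0 < \<mu> s) \<and>
    (\<forall>s\<in>P'. \<exists>t\<in>P. s \<subseteq> t) \<and> (\<forall>s\<in>P'. \<exists>x. s \<subseteq> ball x D) \<and>
    (\<forall>t\<in>P. \<mu> t / 2 \<le> (\<Sum>s | s \<in> P' \<and> s \<subseteq> t. \<mu> s)) \<and> (\<forall>s\<in>P'. \<mu> s \<le> \<kappa>)"
proof -
  obtain D1 where D1: "0 < D1" "\<And>x r. 0 < r \<Longrightarrow> r < D1 \<Longrightarrow> \<mu> (ball x r) \<le> \<kappa>"
    using mass_decay_imp_diffuse[OF decay \<open>0 < \<kappa>\<close>] by blast
  define D' where "D' = min D (D1 / 2)"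
  have D': "0 < D'" "D' < D1" "D' \<le> D" using D1(1) \<open>0 < D\<close> by (auto simp: D'_def)
  define \<epsilon> where "\<epsilon> = Min (\<mu> ` P) / 2"
  have \<epsilon>: "0 < \<epsilon>" using P by (simp add: \<epsilon>_def)
  have \<epsilon>_le: "\<epsilon> \<le> \<mu> t / 2" if "t \<in> P" for t using P(1) that by (simp add: \<epsilon>_def)
  obtain C \<eta> where C: "finite C" "separated_family \<eta> C" "\<And>s. s \<in> C \<Longrightarrow> \<exists>x. s \<subseteq> ball x D'" "\<mu> (- \<Union>C) \<le> \<epsilon>"
    using separated_partition[OF comp fap D'(1) \<epsilon>] by blast
  define P' where "P' = {s \<in> (\<lambda>(t, c). t \<inter> c) ` (P \<times> C). 0 < \<mu> s}"
  have fin: "finite P'" using P(1) C(1) by (simp add: P'_def)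
  have P'E: "\<exists>t\<in>P. \<exists>c\<in>C. s = t \<inter> c" if "s \<in> P'" for s using that by (auto simp: P'_def)
  have sep: "separated_family (min \<delta> \<eta>) P'"
    unfolding separated_family_def
  proof (intro conjI ballI impI)
    show "0 < min \<delta> \<eta>" using P(3) C(2) by (simp add: separated_family_def)
    fix s s' x y assume *: "s \<in> P'" "s' \<in> P'" "s \<noteq> s'" "x \<in> s" "y \<in> s'"
    obtain t c where tc: "t \<in> P" "c \<in> C" "s = t \<inter> c" using P'E *(1) by blast
    obtain t' c' where tc': "t' \<in> P" "c' \<in> C" "s' = t' \<inter> c'" using P'E *(2) by blast
    show "min \<delta> \<eta> \<le> dist x y"
    proof (cases "t = t'")
      case True
      then have "c \<noteq> c'" using * tc tc' by auto
      then have "\<eta> \<le> dist x y" using C(2) * tc tc' unfolding separated_family_def by blast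
      then show ?thesis by simp
    next
      case False
      then have "\<delta> \<le> dist x y" using P(3) * tc tc' unfolding separated_family_def by blast
      then show ?thesis by simp
    qed
  qed
  have kept: "\<mu> t / 2 \<le> (\<Sum>s | s \<in> P' \<and> s \<subseteq> t. \<mu> s)" if t: "t \<in> P" for t
  proof -
    define C0 where "C0 = {c\<in>C. \<mu> (t \<inter> c) \<le> 0}"
    define Q where "Q = {s. s \<in> P' \<and> s \<subseteq> t}"
    have "t \<subseteq> - \<Union>C \<union> ((\<Union>c\<in>C0. t \<inter> c) \<union> (\<Union>s\<in>Q. s))"
    proof
      fix x assume x: "x \<in> t"
      have "x \<in> (\<Union>c\<in>C0. t \<inter> c) \<union> (\<Union>s\<in>Q. s)" if c: "c \<in> C" "x \<in> c" for c
      proof (cases "0 < \<mu> (t \<inter> c)")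
        case True
        then have "t \<inter> c \<in> Q" using t c(1) by (auto simp: Q_def P'_def)
        then show ?thesis using x c(2) by blast
      next
        case False
        then have "c \<in> C0" using c(1) by (simp add: C0_def)
        then show ?thesis using x c(2) by blast
      qed
      then show "x \<in> - \<Union>C \<union> ((\<Union>c\<in>C0. t \<inter> c) \<union> (\<Union>s\<in>Q. s))" by blast
    qed
    then have "\<mu> t \<le> \<mu> (- \<Union>C \<union> ((\<Union>c\<in>C0. t \<inter> c) \<union> (\<Union>s\<in>Q. s)))" by (rule fap_mono[OF fap])
    also have "\<dots> \<le> \<mu> (- \<Union>C) + (\<mu> (\<Union>c\<in>C0. t \<inter> c) + \<mu> (\<Union>s\<in>Q. s))"
      using fap_Un_le[OF fap] by (meson add_left_mono order_trans)
    also have "\<mu> (\<Union>c\<in>C0. t \<inter> c) \<le> (\<Sum>c\<in>C0. \<mu> (t \<inter> c))"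
      using C(1) by (intro fap_UN_le[OF fap]) (simp add: C0_def)
    also have "(\<Sum>c\<in>C0. \<mu> (t \<inter> c)) \<le> 0" by (intro sum_nonpos) (simp add: C0_def)
    also have "\<mu> (\<Union>s\<in>Q. s) \<le> (\<Sum>s\<in>Q. \<mu> s)" using fin by (intro fap_UN_le[OF fap]) (simp add: Q_def)
    also have "\<mu> (- \<Union>C) \<le> \<mu> t / 2" using C(4) \<epsilon>_le[OF t] by simp
    finally show ?thesis by (simp add: Q_def)
  qed
  have "P' \<noteq> {}"
  proof
    assume "P' = {}"
    obtain t where "t \<in> P" using P(2) by blast
    then show False using kept[of t] P(4)[of t] \<open>P' = {}\<close> by simp
  qed
  moreover have "\<exists>x. s \<subseteq> ball x D \<and> \<mu> s \<le> \<kappa>" if "s \<in> P'" for s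
  proof -
    obtain x where x: "s \<subseteq> ball x D'" using P'E[OF \<open>s \<in> P'\<close>] C(3) by blast
    then have "\<mu> s \<le> \<kappa>" using fap_mono[OF fap x] D1(2)[OF D'(1,2), of x] by simp
    moreover have "s \<subseteq> ball x D" using x D'(3) by auto
    ultimately show ?thesis by blast
  qed
  moreover have "\<forall>s\<in>P'. 0 < \<mu> s" "\<forall>s\<in>P'. \<exists>t\<in>P. s \<subseteq> t" by (auto simp: P'_def)
  ultimately show ?thesis
    using fin sep kept by (intro exI[of _ P'] exI[of _ "min \<delta> \<eta>"]) blast
qed

text \<open>Children may fail to cover their parent; only half of its mass is guaranteed. The size
  bound \<open>D n\<close> refers to level \<open>Suc n\<close>, since the only cell of level 0 is
  the whole space.\<close>

locale cell_tree =
  fixes \<mu> :: "'k::metric_space set \<Rightarrow> real" and P :: "nat \<Rightarrow> 'k set set" and D :: "nat \<Rightarrow> real"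
  assumes compact_UNIV: "compact (UNIV :: 'k set)"
    and fap: "finitely_additive_prob \<mu>"
    and level_0: "P 0 = {UNIV}"
    and finite_level: "finite (P n)"
    and level_nonempty: "P n \<noteq> {}"
    and separated_level: "\<exists>\<delta>. separated_family \<delta> (P n)"
    and parent: "s \<in> P (Suc n) \<Longrightarrow> \<exists>t\<in>P n. s \<subseteq> t"
    and cell_pos: "t \<in> P n \<Longrightarrow> 0 < \<mu> t"
    and cell_small: "s \<in> P (Suc n) \<Longrightarrow> \<exists>x. s \<subseteq> ball x (D n)"
    and kept_mass: "t \<in> P n \<Longrightarrow> \<mu> t / 2 \<le> (\<Sum>s | s \<in> P (Suc n) \<and> s \<subseteq> t. \<mu> s)"

text \<open>The mass bound \<open>\<kappa>\<close> takes the previous level as an argument, hence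
  the dependent choice: the later probability estimate has to beat the number and the masses of the
  cells already constructed.\<close>

lemma cell_tree_exists:
  fixes \<mu> :: "'k::metric_space set \<Rightarrow> real"
  assumes comp: "compact (UNIV :: 'k set)" and fap: "finitely_additive_prob \<mu>"
    and decay: "mass_decay \<mu> s" "0 \<le> s"
    and D: "\<And>n. 0 < D n"
    and \<kappa>: "\<And>n P. finite P \<Longrightarrow> P \<noteq> {} \<Longrightarrow> (\<forall>t\<in>P. 0 < \<mu> t) \<Longrightarrow> 0 < \<kappa> n P"
  obtains P where "cell_tree \<mu> P D" "\<And>n s. s \<in> P (Suc n) \<Longrightarrow> \<mu> s \<le> \<kappa> n (P n)"
proof -
  define good where "good P \<longleftrightarrow> finite P \<and> P \<noteq> {} \<and> (\<exists>\<delta>. separated_family \<delta> P) \<and> (\<forall>t\<in>P. 0 < \<mu> t)" for P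
  define step where "step n P P' \<longleftrightarrow> (\<forall>s\<in>P'. \<exists>t\<in>P. s \<subseteq> t) \<and> (\<forall>s\<in>P'. \<exists>x. s \<subseteq> ball x (D n)) \<and>
    (\<forall>t\<in>P. \<mu> t / 2 \<le> (\<Sum>s | s \<in> P' \<and> s \<subseteq> t. \<mu> s)) \<and> (\<forall>s\<in>P'. \<mu> s \<le> \<kappa> n P)" for n P P'
  have "good {UNIV}"
    by (auto simp: good_def separated_family_def fap_UNIV[OF fap] intro!: exI[of _ 1])
  moreover have "\<exists>P'. good P' \<and> step n P P'" if P: "good P" for n P
  proof -
    obtain \<delta> where "separated_family \<delta> P" using P by (auto simp: good_def)
    moreover have "0 < \<kappa> n P" using P by (intro \<kappa>) (auto simp: good_def)
    moreover have "finite P" "P \<noteq> {}" "\<And>t. t \<in> P \<Longrightarrow> 0 < \<mu> t" using P by (auto simp: good_def)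
    ultimately obtain P' \<delta>' where "finite P' \<and> P' \<noteq> {} \<and> separated_family \<delta>' P' \<and> (\<forall>s\<in>P'. 0 < \<mu> s) \<and>
      (\<forall>s\<in>P'. \<exists>t\<in>P. s \<subseteq> t) \<and> (\<forall>s\<in>P'. \<exists>x. s \<subseteq> ball x (D n)) \<and>
      (\<forall>t\<in>P. \<mu> t / 2 \<le> (\<Sum>s | s \<in> P' \<and> s \<subseteq> t. \<mu> s)) \<and> (\<forall>s\<in>P'. \<mu> s \<le> \<kappa> n P)"
      using refine_cells[OF comp fap decay, of P \<delta> "D n" "\<kappa> n P"] D[of n] by blast
    then show ?thesis unfolding good_def step_def by (intro exI[of _ P']) blast
  qed
  ultimately have "\<exists>P. \<forall>n. (good (P n) \<and> (n = 0 \<longrightarrow> P n = {UNIV})) \<and> step n (P n) (P (Suc n))"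
    by (intro dependent_nat_choice) auto
  then obtain P where P: "\<And>n. good (P n)" "P 0 = {UNIV}" "\<And>n. step n (P n) (P (Suc n))" by blast
  have "cell_tree \<mu> P D"
    by unfold_locales (use P comp fap in \<open>auto simp: good_def step_def\<close>)
  moreover have "\<mu> s \<le> \<kappa> n (P n)" if "s \<in> P (Suc n)" for n s
    using P(3)[of n] that by (auto simp: step_def)
  ultimately show ?thesis by (rule that)
qed

text \<open>
  Balls of radius \<open>0\<close> are empty and \<open>0 powr s = 0\<close> also for \<open>s = 0\<close>, so finite covers are included.
\<close>

definition content_ge :: "real \<Rightarrow> real \<Rightarrow> 'a::metric_space set \<Rightarrow> bool" where
  "content_ge s c A \<longleftrightarrow> (\<forall>x r. (\<forall>i::nat. 0 \<le> r i) \<longrightarrow> A \<subseteq> (\<Union>i. ball (x i) (r i)) \<longrightarrow>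
      ennreal c \<le> (\<Sum>i. ennreal (r i powr s)))"

lemma sum_UN_le:
  fixes f :: "'a \<Rightarrow> real"
  assumes "finite I" "\<And>i. i \<in> I \<Longrightarrow> finite (A i)" "\<And>x. 0 \<le> f x"
  shows "sum f (\<Union>i\<in>I. A i) \<le> (\<Sum>i\<in>I. sum f (A i))"
  using assms(1,2)
proof induction
  case (insert i I)
  have "sum f (\<Union>i\<in>insert i I. A i) \<le> sum f (A i) + sum f (\<Union>i\<in>I. A i)"
    using sum.union_inter[of "A i" "\<Union>i\<in>I. A i" f] sum_nonneg[of "A i \<inter> (\<Union>i\<in>I. A i)" f] insert assms(3) by simp
  then show ?case using insert by simp
qed simp

section \<open>The mass distribution principle on subtrees\<close>

context cell_tree
begin

lemma cell_nonempty: "t \<in> P n \<Longrightarrow> t \<noteq> {}"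
  using cell_pos[of t n] fap_empty[OF fap] by auto

lemma cells_disjoint:
  assumes "t \<in> P n" "t' \<in> P n" "t \<noteq> t'"
  shows "t \<inter> t' = {}"
proof -
  obtain \<delta> where \<delta>: "separated_family \<delta> (P n)" using separated_level by blast
  show ?thesis
  proof (rule ccontr)
    assume "t \<inter> t' \<noteq> {}"
    then obtain x where "x \<in> t" "x \<in> t'" by blast
    then have "\<delta> \<le> dist x x" "0 < \<delta>" using \<delta> assms unfolding separated_family_def by blast+
    then show False by simp
  qed
qed

lemma sum_cells:
  assumes "A \<subseteq> P n"
  shows "(\<Sum>t\<in>A. \<mu> t) = \<mu> (\<Union>A)"
proof -
  have "disjoint_family_on (\<lambda>t. t) A"
    using cells_disjoint[of _ n] assms unfolding disjoint_family_on_def by blast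
  moreover have "finite A" using finite_level assms by (rule finite_subset[rotated])
  ultimately show ?thesis using fap_UN_disjoint[OF fap, of A "\<lambda>t. t"] by simp
qed

text \<open>The mass of a cell is passed on to its selected children in proportion to
  \<open>\<mu>\<close>, so level \<open>n\<close> costs at most the factor
  \<open>1 / \<theta> n\<close>. The last clause lets a set \<open>U\<close> be measured at any
  single level: the mass of the cells meeting \<open>U\<close> cannot grow under refinement.\<close>

lemma mass_distribution:
  assumes T: "\<And>n. T n \<subseteq> P n" and t0: "t0 \<in> T n0"
    and \<theta>: "\<And>n. 0 < \<theta> n" "\<And>n. \<theta> n \<le> 1"
    and kept: "\<forall>n\<ge>n0. \<forall>t\<in>T n. \<theta> n * \<mu> t \<le> (\<Sum>s | s \<in> T (Suc n) \<and> s \<subseteq> t. \<mu> s)"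
  shows "\<exists>m. (\<forall>n t. 0 \<le> m n t) \<and> (\<forall>n\<ge>n0. (\<Sum>t\<in>T n. m n t) = 1) \<and>
    (\<forall>n\<ge>n0. \<forall>t\<in>T n. m n t \<le> (\<Prod>k<n. 1 / \<theta> k) * \<mu> t / \<mu> t0) \<and>
    (\<forall>j\<ge>n0. \<forall>n\<ge>j. \<forall>U. (\<Sum>t | t \<in> T n \<and> t \<inter> U \<noteq> {}. m n t) \<le> (\<Sum>t | t \<in> T j \<and> t \<inter> U \<noteq> {}. m j t))"
proof -
  have fin: "finite (T n)" for n using finite_level T by (rule finite_subset[rotated])
  have pos: "0 < \<mu> t" if "t \<in> T n" for t n using cell_pos T that by blast
  define M where "M n t = (\<Sum>s | s \<in> T (Suc n) \<and> s \<subseteq> t. \<mu> s)" for n t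
  have M_ge: "\<theta> n * \<mu> t \<le> M n t" if "n0 \<le> n" "t \<in> T n" for n t using kept that by (simp add: M_def)
  have M_pos: "0 < M n t" if "n0 \<le> n" "t \<in> T n" for n t
    using M_ge[OF that] \<theta>(1)[of n] pos[OF that(2)] by (smt (verit) mult_pos_pos)
  have M_nonneg: "0 \<le> M n t" for n t unfolding M_def by (intro sum_nonneg fap_nonneg[OF fap])
  \<comment> \<open>Up to level \<open>n0\<close> the recursion only repeats the unit mass at
    \<open>t0\<close>; in this way \<open>m n0\<close> has that value whether or not
    \<open>n0\<close> is zero.\<close>
  define m :: "nat \<Rightarrow> 'k set \<Rightarrow> real" where "m = rec_nat (\<lambda>t. of_bool (t = t0))
    (\<lambda>n mn s. if Suc n \<le> n0 then of_bool (s = t0) else \<Sum>t | t \<in> T n \<and> s \<subseteq> t. mn t * \<mu> s / M n t)"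
  have m_start: "m n0 t = of_bool (t = t0)" for t by (cases n0) (auto simp: m_def)
  have m_Suc: "m (Suc n) s = (\<Sum>t | t \<in> T n \<and> s \<subseteq> t. m n t * \<mu> s / M n t)" if "n0 \<le> n" for n s
    using that by (simp add: m_def)
  have m_nonneg: "0 \<le> m n t" for n t
  proof (induction n arbitrary: t)
    case 0 then show ?case by (simp add: m_def)
  next
    case (Suc n)
    show ?case
    proof (cases "n0 \<le> n")
      case True
      then show ?thesis unfolding m_Suc[OF True]
        by (intro sum_nonneg divide_nonneg_nonneg mult_nonneg_nonneg Suc fap_nonneg[OF fap] M_nonneg)
    next
      case False
      then show ?thesis by (simp add: m_def)
    qed
  qed
  have swap: "(\<Sum>s | s \<in> T (Suc n) \<and> s \<inter> U \<noteq> {}. m (Suc n) s) =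
      (\<Sum>t\<in>T n. m n t * (\<Sum>s | s \<in> T (Suc n) \<and> s \<subseteq> t \<and> s \<inter> U \<noteq> {}. \<mu> s) / M n t)" if n: "n0 \<le> n" for n U
  proof -
    have "(\<Sum>s | s \<in> T (Suc n) \<and> s \<inter> U \<noteq> {}. m (Suc n) s) =
      (\<Sum>s | s \<in> T (Suc n) \<and> s \<inter> U \<noteq> {}. \<Sum>t | t \<in> T n \<and> s \<subseteq> t. m n t * \<mu> s / M n t)"
      using m_Suc[OF n] by simp
    also have "\<dots> = (\<Sum>t\<in>T n. \<Sum>s | s \<in> {s. s \<in> T (Suc n) \<and> s \<inter> U \<noteq> {}} \<and> s \<subseteq> t. m n t * \<mu> s / M n t)"
      using fin by (intro sum.swap_restrict) auto
    also have "\<dots> = (\<Sum>t\<in>T n. m n t * (\<Sum>s | s \<in> T (Suc n) \<and> s \<subseteq> t \<and> s \<inter> U \<noteq> {}. \<mu> s) / M n t)"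
    proof (intro sum.cong refl)
      fix t
      have eq: "{s. s \<in> {s. s \<in> T (Suc n) \<and> s \<inter> U \<noteq> {}} \<and> s \<subseteq> t} = {s. s \<in> T (Suc n) \<and> s \<subseteq> t \<and> s \<inter> U \<noteq> {}}" by blast
      show "(\<Sum>s | s \<in> {s. s \<in> T (Suc n) \<and> s \<inter> U \<noteq> {}} \<and> s \<subseteq> t. m n t * \<mu> s / M n t) =
        m n t * (\<Sum>s | s \<in> T (Suc n) \<and> s \<subseteq> t \<and> s \<inter> U \<noteq> {}. \<mu> s) / M n t"
        unfolding eq by (simp add: sum_distrib_left sum_divide_distrib)
    qed
    finally show ?thesis .
  qed
  have total: "(\<Sum>t\<in>T n. m n t) = 1" if "n0 \<le> n" for n
    using that
  proof (induction n rule: dec_induct)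
    case base
    show ?case using fin t0 by (simp add: m_start)
  next
    case (step n)
    have ne: "s \<noteq> {}" if "s \<in> T (Suc n)" for s using that T cell_nonempty by blast
    then have "(\<Sum>t\<in>T (Suc n). m (Suc n) t) = (\<Sum>s | s \<in> T (Suc n) \<and> s \<inter> UNIV \<noteq> {}. m (Suc n) s)"
      by (intro sum.cong) auto
    also have "\<dots> = (\<Sum>t\<in>T n. m n t * (\<Sum>s | s \<in> T (Suc n) \<and> s \<subseteq> t \<and> s \<inter> UNIV \<noteq> {}. \<mu> s) / M n t)"
      by (rule swap[OF step(1)])
    also have "\<dots> = (\<Sum>t\<in>T n. m n t)"
    proof (intro sum.cong refl)
      fix t assume t: "t \<in> T n"
      have "{s. s \<in> T (Suc n) \<and> s \<subseteq> t \<and> s \<inter> UNIV \<noteq> {}} = {s. s \<in> T (Suc n) \<and> s \<subseteq> t}" using ne by auto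
      then show "m n t * (\<Sum>s | s \<in> T (Suc n) \<and> s \<subseteq> t \<and> s \<inter> UNIV \<noteq> {}. \<mu> s) / M n t = m n t"
        using M_pos[OF step(1) t] by (simp add: M_def[symmetric])
    qed
    finally show ?case using step by simp
  qed
  have decr: "(\<Sum>t | t \<in> T (Suc n) \<and> t \<inter> U \<noteq> {}. m (Suc n) t) \<le> (\<Sum>t | t \<in> T n \<and> t \<inter> U \<noteq> {}. m n t)"
    if n: "n0 \<le> n" for n U
  proof -
    have "(\<Sum>t\<in>T n. m n t * (\<Sum>s | s \<in> T (Suc n) \<and> s \<subseteq> t \<and> s \<inter> U \<noteq> {}. \<mu> s) / M n t) \<le>
        (\<Sum>t\<in>T n. if t \<inter> U \<noteq> {} then m n t else 0)"
    proof (intro sum_mono)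
      fix t assume t: "t \<in> T n"
      have le: "(\<Sum>s | s \<in> T (Suc n) \<and> s \<subseteq> t \<and> s \<inter> U \<noteq> {}. \<mu> s) \<le> M n t"
        unfolding M_def using fin fap_nonneg[OF fap] by (intro sum_mono2) auto
      show "m n t * (\<Sum>s | s \<in> T (Suc n) \<and> s \<subseteq> t \<and> s \<inter> U \<noteq> {}. \<mu> s) / M n t \<le> (if t \<inter> U \<noteq> {} then m n t else 0)"
      proof (cases "t \<inter> U = {}")
        case True
        then have empty: "{s. s \<in> T (Suc n) \<and> s \<subseteq> t \<and> s \<inter> U \<noteq> {}} = {}" by blast
        show ?thesis unfolding empty using True by simp
      next
        case False
        have "m n t * (\<Sum>s | s \<in> T (Suc n) \<and> s \<subseteq> t \<and> s \<inter> U \<noteq> {}. \<mu> s) \<le> m n t * M n t"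
          by (rule mult_left_mono[OF le m_nonneg])
        then show ?thesis using M_pos[OF n t] False by (simp add: pos_divide_le_eq)
      qed
    qed
    also have "\<dots> = (\<Sum>t | t \<in> T n \<and> t \<inter> U \<noteq> {}. m n t)"
      using fin by (simp add: sum.inter_filter)
    finally show ?thesis using swap[OF n] by simp
  qed
  have mono: "(\<Sum>t | t \<in> T n \<and> t \<inter> U \<noteq> {}. m n t) \<le> (\<Sum>t | t \<in> T j \<and> t \<inter> U \<noteq> {}. m j t)"
    if "n0 \<le> j" "j \<le> n" for j n U
    using that(2)
  proof (induction n rule: dec_induct)
    case (step n)
    then show ?case using decr[of n U] that(1) by linarith
  qed simp
  have upper: "m n t \<le> (\<Prod>k<n. 1 / \<theta> k) * \<mu> t / \<mu> t0" if "n0 \<le> n" "t \<in> T n" for n t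
    using that
  proof (induction n arbitrary: t rule: dec_induct)
    case base
    have "1 \<le> (\<Prod>k<n0. 1 / \<theta> k)" using \<theta> by (intro prod_ge_1) simp
    then show ?case using pos[OF base] pos[OF t0] by (auto simp: m_start intro!: divide_nonneg_pos mult_nonneg_nonneg)
  next
    case (step n s)
    have bound: "m n t * \<mu> s / M n t \<le> (\<Prod>k<Suc n. 1 / \<theta> k) * \<mu> s / \<mu> t0" if t: "t \<in> T n" for t
    proof -
      have "m n t * \<mu> s / M n t \<le> ((\<Prod>k<n. 1 / \<theta> k) * \<mu> t / \<mu> t0) * \<mu> s / (\<theta> n * \<mu> t)"
        using step.IH[OF t] fap_nonneg[OF fap] m_nonneg M_ge[OF step(1) t] \<theta>(1)[of n] pos[OF t] pos[OF t0]
        by (intro frac_le mult_right_mono) (auto intro!: mult_nonneg_nonneg divide_nonneg_nonneg prod_nonneg less_imp_le[OF \<theta>(1)])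
      also have "\<dots> = (\<Prod>k<Suc n. 1 / \<theta> k) * \<mu> s / \<mu> t0"
        using pos[OF t] pos[OF t0] \<theta>(1)[of n] by simp
      finally show ?thesis .
    qed
    have nn: "0 \<le> (\<Prod>k<Suc n. 1 / \<theta> k) * \<mu> s / \<mu> t0"
      using fap_nonneg[OF fap] \<theta>(1) by (intro divide_nonneg_nonneg mult_nonneg_nonneg prod_nonneg) (auto intro: less_imp_le)
    show ?case
    proof (cases "{t. t \<in> T n \<and> s \<subseteq> t} = {}")
      case True
      then show ?thesis using nn unfolding m_Suc[OF step(1)] True by simp
    next
      case False
      then obtain t where t: "t \<in> T n" "s \<subseteq> t" by blast
      have "{t. t \<in> T n \<and> s \<subseteq> t} = {t}"
      proof (intro set_eqI iffI)
        fix t' assume "t' \<in> {t. t \<in> T n \<and> s \<subseteq> t}"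
        then have "t' \<in> P n" "t \<in> P n" "s \<subseteq> t \<inter> t'" "s \<noteq> {}"
          using t T cell_nonempty[of s "Suc n"] step(3,4) by auto
        then show "t' \<in> {t}" using cells_disjoint[of t n t'] by blast
      qed (use t in auto)
      then show ?thesis using bound[OF t(1)] unfolding m_Suc[OF step(1)] by simp
    qed
  qed
  show ?thesis
    using m_nonneg total upper mono by (intro exI[of _ m]) auto
qed

text \<open>\<open>F\<close> is tied to the tree only through its neighbourhoods, each of which
  meets all sufficiently deep cells. By compactness finitely many balls of the cover remain. Each is
  estimated at a level suited to its radius, and the estimates are then carried to a common deep
  level, where the cells meeting the balls must account for the full mass 1. The first entry of the
  minimum accounts for balls too large for this comparison.\<close>

lemma content_ge_mass_distribution:
  assumes T: "\<And>n. T n \<subseteq> P n" and t0: "t0 \<in> T n0"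
    and \<theta>: "\<And>n. 0 < \<theta> n" "\<And>n. \<theta> n \<le> 1"
    and kept: "\<And>n t. n0 \<le> n \<Longrightarrow> t \<in> T n \<Longrightarrow> \<theta> n * \<mu> t \<le> (\<Sum>s | s \<in> T (Suc n) \<and> s \<subseteq> t. \<mu> s)"
    and D: "\<And>n. 0 < D n" "decseq D" "D \<longlonglongrightarrow> 0"
    and decay: "\<And>n x r. 0 < r \<Longrightarrow> r < 4 * D n \<Longrightarrow> (\<Prod>k<n + 2. 1 / \<theta> k) * \<mu> (ball x r) \<le> r powr s"
    and "0 \<le> s"
    and F: "closed F" "\<And>W. open W \<Longrightarrow> F \<subseteq> W \<Longrightarrow> \<exists>n1. \<forall>n\<ge>n1. \<forall>t\<in>T n. t \<inter> W \<noteq> {}"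
  shows "content_ge s (min ((2 * D n0) powr s) (\<mu> t0 / 2 powr s)) F"
  unfolding content_ge_def
proof (intro allI impI)
  fix x :: "nat \<Rightarrow> 'k" and r :: "nat \<Rightarrow> real"
  assume r: "\<forall>i. 0 \<le> r i" and cov: "F \<subseteq> (\<Union>i. ball (x i) (r i))"
  have "compact F" using compact_Int_closed[OF compact_UNIV F(1)] by simp
  then obtain I0 where I0: "finite I0" "F \<subseteq> (\<Union>i\<in>I0. ball (x i) (r i))"
    by (rule compactE_image[of F UNIV "\<lambda>i. ball (x i) (r i)"]) (use cov in auto)
  define I where "I = {i\<in>I0. 0 < r i}"
  have "finite I" using I0(1) by (simp add: I_def)
  have Fcov: "F \<subseteq> (\<Union>i\<in>I. ball (x i) (r i))"
  proof
    fix y assume "y \<in> F"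
    then obtain i where "i \<in> I0" "dist (x i) y < r i" using I0(2) by auto
    moreover then have "0 < r i" using zero_le_dist[of "x i" y] by linarith
    ultimately show "y \<in> (\<Union>i\<in>I. ball (x i) (r i))" by (auto simp: I_def)
  qed
  have "min ((2 * D n0) powr s) (\<mu> t0 / 2 powr s) \<le> (\<Sum>i\<in>I. r i powr s)"
  proof (cases "\<exists>i\<in>I. 2 * D n0 \<le> r i")
    case True
    then obtain i where i: "i \<in> I" "2 * D n0 \<le> r i" by blast
    have "(2 * D n0) powr s \<le> r i powr s" using i(2) D(1)[of n0] \<open>0 \<le> s\<close> by (intro powr_mono2) auto
    also have "\<dots> \<le> (\<Sum>i\<in>I. r i powr s)" using \<open>finite I\<close> i(1) by (intro member_le_sum) auto
    finally show ?thesis by simp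
  next
    case False
    have kept': "\<forall>n\<ge>n0. \<forall>t\<in>T n. \<theta> n * \<mu> t \<le> (\<Sum>s | s \<in> T (Suc n) \<and> s \<subseteq> t. \<mu> s)"
      using kept by blast
    obtain m where m': "\<forall>n t. 0 \<le> m n t" "\<forall>n\<ge>n0. (\<Sum>t\<in>T n. m n t) = 1"
      "\<forall>n\<ge>n0. \<forall>t\<in>T n. m n t \<le> (\<Prod>k<n. 1 / \<theta> k) * \<mu> t / \<mu> t0"
      "\<forall>j\<ge>n0. \<forall>n\<ge>j. \<forall>U. (\<Sum>t | t \<in> T n \<and> t \<inter> U \<noteq> {}. m n t) \<le> (\<Sum>t | t \<in> T j \<and> t \<inter> U \<noteq> {}. m j t)"
      using mass_distribution[OF T t0 \<theta> kept'] by (elim exE conjE) (rule that)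
    then have m: "\<And>n t. 0 \<le> m n t" "\<And>n. n0 \<le> n \<Longrightarrow> (\<Sum>t\<in>T n. m n t) = 1"
      "\<And>n t. n0 \<le> n \<Longrightarrow> t \<in> T n \<Longrightarrow> m n t \<le> (\<Prod>k<n. 1 / \<theta> k) * \<mu> t / \<mu> t0"
      "\<And>j n U. n0 \<le> j \<Longrightarrow> j \<le> n \<Longrightarrow> (\<Sum>t | t \<in> T n \<and> t \<inter> U \<noteq> {}. m n t) \<le> (\<Sum>t | t \<in> T j \<and> t \<inter> U \<noteq> {}. m j t)"
      by simp_all
    have fin: "finite (T n)" for n using finite_level T by (rule finite_subset[rotated])
    have pos0: "0 < \<mu> t0" using cell_pos T t0 by blast
    have level: "\<exists>j. n0 \<le> j \<and> (\<Sum>t | t \<in> T j \<and> t \<inter> ball (x i) (r i) \<noteq> {}. m j t) \<le> (2 * r i) powr s / \<mu> t0"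
      if i: "i \<in> I" for i
    proof -
      have ri: "0 < r i" "r i < 2 * D n0" using i False by (auto simp: I_def not_le)
      have "(\<lambda>n. 2 * D n) \<longlonglongrightarrow> 2 * 0" by (intro tendsto_mult_left D(3))
      then have "eventually (\<lambda>n. 2 * D n < r i) sequentially" using ri(1) by (intro order_tendstoD(2)) auto
      then have "\<exists>n. 2 * D n \<le> r i" by (auto simp: eventually_sequentially intro: less_imp_le)
      \<comment> \<open>\<open>k\<close> is the first index with \<open>2 * D k \<le> r i\<close>;
        it exceeds \<open>n0\<close>, so \<open>k = Suc n\<close>. Cells of level
        \<open>n + 2\<close> lie in balls of radius \<open>D k\<close>, so any two of their points
        are closer than \<open>r i\<close>. Minimality gives \<open>r i < 2 * D n\<close>, which is
        the range in which \<open>decay\<close> applies to the doubled radius.\<close>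
      then obtain k where k: "2 * D k \<le> r i" "\<And>k'. k' < k \<Longrightarrow> \<not> 2 * D k' \<le> r i"
        using exists_least_iff[of "\<lambda>n. 2 * D n \<le> r i"] by blast
      have "n0 < k"
      proof (rule ccontr)
        assume "\<not> n0 < k"
        then have "D n0 \<le> D k" using D(2) by (simp add: decseq_def)
        then show False using k(1) ri(2) by simp
      qed
      then obtain n where n: "k = Suc n" "n0 \<le> n" by (cases k) auto
      have rn: "r i < 2 * D n" using k(2)[of n] n(1) by simp
      define A where "A = {t. t \<in> T (n + 2) \<and> t \<inter> ball (x i) (r i) \<noteq> {}}"
      have AP: "A \<subseteq> P (n + 2)" using T by (auto simp: A_def)
      have "\<Union>A \<subseteq> ball (x i) (2 * r i)"
      proof
        fix y assume "y \<in> \<Union>A"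
        then obtain t where t: "t \<in> A" "y \<in> t" by blast
        then obtain z where z: "z \<in> t" "dist (x i) z < r i" by (auto simp: A_def)
        obtain c where "t \<subseteq> ball c (D (Suc n))" using cell_small[of t "Suc n"] AP t(1) by auto
        then have "dist c y < D k" "dist c z < D k" using t z n(1) by auto
        then have "dist z y < r i" using k(1) dist_triangle3[of z y c] by simp
        then show "y \<in> ball (x i) (2 * r i)" using z(2) dist_triangle[of "x i" y z] by simp
      qed
      then have A_le: "(\<Sum>t\<in>A. \<mu> t) \<le> \<mu> (ball (x i) (2 * r i))"
        unfolding sum_cells[OF AP] by (rule fap_mono[OF fap])
      have "(\<Sum>t\<in>A. m (n + 2) t) \<le> (\<Sum>t\<in>A. (\<Prod>k<n + 2. 1 / \<theta> k) * \<mu> t / \<mu> t0)"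
        using n(2) by (intro sum_mono m(3)) (auto simp: A_def)
      also have "\<dots> = (\<Prod>k<n + 2. 1 / \<theta> k) * (\<Sum>t\<in>A. \<mu> t) / \<mu> t0"
        by (simp add: sum_distrib_left sum_divide_distrib)
      also have "\<dots> \<le> (\<Prod>k<n + 2. 1 / \<theta> k) * \<mu> (ball (x i) (2 * r i)) / \<mu> t0"
        using A_le pos0 \<theta>(1) by (intro divide_right_mono mult_left_mono prod_nonneg) (auto intro: less_imp_le)
      also have "\<dots> \<le> (2 * r i) powr s / \<mu> t0"
        using decay[of "2 * r i" n "x i"] ri rn pos0 by (intro divide_right_mono) auto
      finally show ?thesis using n(2) unfolding A_def by (intro exI[of _ "n + 2"]) auto
    qed
    then have "\<exists>j. \<forall>i\<in>I. n0 \<le> j i \<and>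
        (\<Sum>t | t \<in> T (j i) \<and> t \<inter> ball (x i) (r i) \<noteq> {}. m (j i) t) \<le> (2 * r i) powr s / \<mu> t0"
      by (intro bchoice) blast
    then obtain j where j: "\<And>i. i \<in> I \<Longrightarrow> n0 \<le> j i"
      "\<And>i. i \<in> I \<Longrightarrow> (\<Sum>t | t \<in> T (j i) \<and> t \<inter> ball (x i) (r i) \<noteq> {}. m (j i) t) \<le> (2 * r i) powr s / \<mu> t0"
      by blast
    obtain n1 where n1: "\<And>n t. n1 \<le> n \<Longrightarrow> t \<in> T n \<Longrightarrow> t \<inter> (\<Union>i\<in>I. ball (x i) (r i)) \<noteq> {}"
      using F(2)[OF open_UN Fcov] by blast
    define n where "n = n0 + n1 + sum j I"
    have n: "n0 \<le> n" "n1 \<le> n" "\<And>i. i \<in> I \<Longrightarrow> j i \<le> n"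
      using member_le_sum[of _ I j] \<open>finite I\<close> by (auto simp: n_def intro: trans_le_add2)
    have "1 = (\<Sum>t\<in>T n. m n t)" using m(2) n(1) by simp
    also have "\<dots> \<le> (\<Sum>t\<in>(\<Union>i\<in>I. {t. t \<in> T n \<and> t \<inter> ball (x i) (r i) \<noteq> {}}). m n t)"
    proof (intro sum_mono2)
      show "T n \<subseteq> (\<Union>i\<in>I. {t. t \<in> T n \<and> t \<inter> ball (x i) (r i) \<noteq> {}})" using n1[OF n(2)] by blast
    qed (use fin \<open>finite I\<close> m(1) in auto)
    also have "\<dots> \<le> (\<Sum>i\<in>I. \<Sum>t | t \<in> T n \<and> t \<inter> ball (x i) (r i) \<noteq> {}. m n t)"
      using \<open>finite I\<close> fin m(1) by (intro sum_UN_le) auto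
    also have "\<dots> \<le> (\<Sum>i\<in>I. (2 * r i) powr s / \<mu> t0)"
      using m(4)[OF j(1) n(3)] j(2) by (intro sum_mono) (meson order_trans)
    also have "\<dots> = 2 powr s / \<mu> t0 * (\<Sum>i\<in>I. r i powr s)"
      using r by (simp add: powr_mult sum_distrib_left)
    finally have "\<mu> t0 / 2 powr s \<le> (\<Sum>i\<in>I. r i powr s)" using pos0 by (simp add: field_simps)
    then show ?thesis by simp
  qed
  then have "ennreal (min ((2 * D n0) powr s) (\<mu> t0 / 2 powr s)) \<le> ennreal (\<Sum>i\<in>I. r i powr s)"
    by (rule ennreal_leI)
  also have "\<dots> = (\<Sum>i\<in>I. ennreal (r i powr s))" by (rule sum_ennreal[symmetric]) auto
  also have "\<dots> \<le> (\<Sum>i. ennreal (r i powr s))"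
    by (intro sum_le_suminf summableI \<open>finite I\<close>) auto
  finally show "ennreal (min ((2 * D n0) powr s) (\<mu> t0 / 2 powr s)) \<le> (\<Sum>i. ennreal (r i powr s))" .
qed

end

section \<open>Fibres of a perturbed map\<close>

text \<open>The contrapositive of a Koenig-type argument: if finitely many candidates supply, for
  every \<open>m\<close>, one that satisfies the decreasing predicate at \<open>m\<close>, then some
  candidate satisfies it at all \<open>m\<close>.\<close>

lemma decreasing_predicates_fail_uniformly:
  assumes "finite A" "\<And>a. a \<in> A \<Longrightarrow> \<exists>m. \<not> Q m a" "\<And>m m' a. m \<le> m' \<Longrightarrow> a \<in> A \<Longrightarrow> Q m' a \<Longrightarrow> Q m a"
  shows "\<exists>m::nat. \<forall>a\<in>A. \<not> Q m a"
proof -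
  obtain k where k: "\<And>a. a \<in> A \<Longrightarrow> \<not> Q (k a) a" using assms(2) by metis
  have "\<not> Q (sum k A) a" if "a \<in> A" for a
    using assms(3)[of "k a" "sum k A" a] k[OF that] that member_le_sum[of a A k] assms(1) by auto
  then show ?thesis by blast
qed

text \<open>\<open>N\<close> is kept apart from \<open>card (Z n)\<close> because it is chosen
  before \<open>f\<close> and dominates the nets only from \<open>n0\<close> on. Values are
  approximated within \<open>b n\<close>, but passing between consecutive levels moves them by at
  most \<open>b n / 4\<close>; with ratio 3/4 an error \<open>b (Suc n)\<close> plus such a move is
  again at most \<open>b n\<close>.\<close>

locale value_tree = cell_tree \<mu> P D
  for \<mu> :: "'k::metric_space set \<Rightarrow> real" and P :: "nat \<Rightarrow> 'k set set" and D :: "nat \<Rightarrow> real" +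
  fixes f :: "'k \<Rightarrow> 'e::real_normed_vector" and b :: "nat \<Rightarrow> real" and Z :: "nat \<Rightarrow> 'e set"
    and N :: "nat \<Rightarrow> nat" and \<Gamma> :: "'e set" and n0 :: nat
  assumes b_pos: "0 < b n" and b_Suc: "b (Suc n) = 3 / 4 * b n"
    and finite_Z: "finite (Z n)"
    and Z_net_f: "n0 \<le> n \<Longrightarrow> \<exists>v\<in>Z n. dist (f x) v \<le> b n"
    and Z_net_Z: "n0 \<le> n \<Longrightarrow> w \<in> Z (Suc n) \<Longrightarrow> \<exists>v\<in>Z n. dist w v \<le> b n / 4"
    and card_Z: "n0 \<le> n \<Longrightarrow> card (Z n) \<le> N n" and N_pos: "0 < N n"
    and finite_\<Gamma>: "finite \<Gamma>"
    and \<Gamma>_net: "norm u \<le> 1 \<Longrightarrow> \<exists>\<gamma>\<in>\<Gamma>. norm (u - \<gamma>) \<le> 1 / 2"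
begin

text \<open>
  \<open>approx m n t v\<close>: \<open>f\<close> is near \<open>v\<close> on a subtree of depth \<open>m\<close> below \<open>t\<close>. No modulus of continuity of
  \<open>f\<close> enters, since \<open>v\<close> need not be a value at a prescribed point of \<open>t\<close>: it is found from the leaves
  upwards by the pigeonhole principle. As \<open>Z n\<close> is finite, the depth can be made infinite.
\<close>

primrec approx :: "nat \<Rightarrow> nat \<Rightarrow> 'k set \<Rightarrow> 'e \<Rightarrow> bool" where
  "approx 0 n t v \<longleftrightarrow> v \<in> Z n \<and> (\<exists>x\<in>t. dist (f x) v \<le> b n)"
| "approx (Suc m) n t v \<longleftrightarrow> v \<in> Z n \<and> \<mu> t / (2 * real (N n)) \<le>
     (\<Sum>s | s \<in> P (Suc n) \<and> s \<subseteq> t \<and> (\<exists>w. approx m (Suc n) s w \<and> dist w v \<le> b n / 4). \<mu> s)"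

definition approx_all :: "nat \<Rightarrow> 'k set \<Rightarrow> 'e \<Rightarrow> bool" where
  "approx_all n t v \<longleftrightarrow> (\<forall>m. approx m n t v)"

text \<open>A cluster is determined by \<open>f\<close> and the tree alone. For fixed
  \<open>f\<close> the digits on its members are therefore independent of its choice.\<close>

definition cluster :: "nat \<Rightarrow> 'k set \<Rightarrow> 'e \<Rightarrow> 'k set set" where
  "cluster n t v = {s. s \<in> P (Suc n) \<and> s \<subseteq> t \<and> (\<exists>w. approx_all (Suc n) s w \<and> dist w v \<le> b n / 4)}"

lemma finite_cluster: "finite (cluster n t v)"
  using finite_level[of "Suc n"] by (simp add: cluster_def)

lemma approx_in_Z: "approx m n t v \<Longrightarrow> v \<in> Z n"
  by (cases m) auto

text \<open>Round the approximate value of each child to a point of \<open>Z n\<close>. The children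
  carry half of the mass of \<open>t\<close>, and at most \<open>N n\<close> rounded values share
  it.\<close>

lemma approx_exists: "n0 \<le> n \<Longrightarrow> t \<in> P n \<Longrightarrow> \<exists>v. approx m n t v"
proof (induction m arbitrary: n t)
  case 0
  then obtain x where "x \<in> t" using cell_nonempty by blast
  then show ?case using Z_net_f[OF 0(1), of x] by auto
next
  case (Suc m)
  have "\<forall>s\<in>P (Suc n). \<exists>v\<in>Z n. \<exists>w. approx m (Suc n) s w \<and> dist w v \<le> b n / 4"
  proof
    fix s assume "s \<in> P (Suc n)"
    then obtain w where "approx m (Suc n) s w" using Suc.IH[of "Suc n" s] Suc.prems by auto
    then show "\<exists>v\<in>Z n. \<exists>w. approx m (Suc n) s w \<and> dist w v \<le> b n / 4"
      using Z_net_Z[OF Suc.prems(1) approx_in_Z] by blast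
  qed
  then obtain h where h: "\<And>s. s \<in> P (Suc n) \<Longrightarrow> h s \<in> Z n"
    "\<And>s. s \<in> P (Suc n) \<Longrightarrow> \<exists>w. approx m (Suc n) s w \<and> dist w (h s) \<le> b n / 4" by metis
  define C where "C v = {s. s \<in> P (Suc n) \<and> s \<subseteq> t \<and> (\<exists>w. approx m (Suc n) s w \<and> dist w v \<le> b n / 4)}" for v
  have fin: "finite (C v)" for v using finite_level[of "Suc n"] by (simp add: C_def)
  have "Z n \<noteq> {}" using Z_net_f[OF Suc.prems(1)] by blast
  have "\<exists>v\<in>Z n. \<mu> t / (2 * real (N n)) \<le> (\<Sum>s\<in>C v. \<mu> s)"
  proof (rule ccontr)
    assume "\<not> ?thesis"
    then have less: "(\<Sum>s\<in>C v. \<mu> s) < \<mu> t / (2 * real (N n))" if "v \<in> Z n" for v using that by (auto simp: not_le)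
    have "\<mu> t / 2 \<le> (\<Sum>s | s \<in> P (Suc n) \<and> s \<subseteq> t. \<mu> s)" by (rule kept_mass[OF Suc.prems(2)])
    also have "\<dots> \<le> (\<Sum>s\<in>(\<Union>v\<in>Z n. C v). \<mu> s)"
    proof (intro sum_mono2)
      show "{s. s \<in> P (Suc n) \<and> s \<subseteq> t} \<subseteq> (\<Union>v\<in>Z n. C v)" 
      proof
        fix s assume s: "s \<in> {s. s \<in> P (Suc n) \<and> s \<subseteq> t}"
        then have "s \<in> C (h s)" using h(2)[of s] by (simp add: C_def)
        then show "s \<in> (\<Union>v\<in>Z n. C v)" using h(1)[of s] s by blast
      qed
    qed (use fin finite_Z fap_nonneg[OF fap] in auto)
    also have "\<dots> \<le> (\<Sum>v\<in>Z n. \<Sum>s\<in>C v. \<mu> s)"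
      using fin finite_Z fap_nonneg[OF fap] by (intro sum_UN_le)
    also have "\<dots> < (\<Sum>v\<in>Z n. \<mu> t / (2 * real (N n)))"
      using less finite_Z \<open>Z n \<noteq> {}\<close> by (intro sum_strict_mono)
    also have "\<dots> = real (card (Z n)) * (\<mu> t / (2 * real (N n)))" by simp
    also have "\<dots> \<le> real (N n) * (\<mu> t / (2 * real (N n)))"
      using card_Z[OF Suc.prems(1)] fap_nonneg[OF fap] by (intro mult_right_mono) auto
    also have "\<dots> = \<mu> t / 2" using N_pos[of n] by simp
    finally show False by simp
  qed
  then show ?case by (auto simp: C_def)
qed

lemma approx_Suc: "approx (Suc m) n t v \<Longrightarrow> t \<in> P n \<Longrightarrow> approx m n t v"
proof (induction m arbitrary: n t v)
  case 0
  have "0 < \<mu> t / (2 * real (N n))" using cell_pos[OF 0(2)] N_pos by simp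
  then have "(\<Sum>s | s \<in> P (Suc n) \<and> s \<subseteq> t \<and> (\<exists>w. approx 0 (Suc n) s w \<and> dist w v \<le> b n / 4). \<mu> s) \<noteq> 0"
    using 0(1) by simp
  then have "{s. s \<in> P (Suc n) \<and> s \<subseteq> t \<and> (\<exists>w. approx 0 (Suc n) s w \<and> dist w v \<le> b n / 4)} \<noteq> {}"
    by (metis sum.empty)
  then obtain s where "s \<in> P (Suc n) \<and> s \<subseteq> t \<and> (\<exists>w. approx 0 (Suc n) s w \<and> dist w v \<le> b n / 4)"
    by blast
  then obtain w x where "x \<in> t" "dist (f x) w \<le> b (Suc n)" "dist w v \<le> b n / 4" by auto
  moreover then have "dist (f x) v \<le> b n" using dist_triangle[of "f x" v w] by (simp add: b_Suc)
  ultimately show ?case using 0(1) by auto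
next
  case (Suc m)
  have "(\<Sum>s | s \<in> P (Suc n) \<and> s \<subseteq> t \<and> (\<exists>w. approx (Suc m) (Suc n) s w \<and> dist w v \<le> b n / 4). \<mu> s)
      \<le> (\<Sum>s | s \<in> P (Suc n) \<and> s \<subseteq> t \<and> (\<exists>w. approx m (Suc n) s w \<and> dist w v \<le> b n / 4). \<mu> s)"
  proof (rule sum_mono2)
    show "finite {s. s \<in> P (Suc n) \<and> s \<subseteq> t \<and> (\<exists>w. approx m (Suc n) s w \<and> dist w v \<le> b n / 4)}"
      using finite_level[of "Suc n"] by (auto intro: rev_finite_subset)
    show "{s. s \<in> P (Suc n) \<and> s \<subseteq> t \<and> (\<exists>w. approx (Suc m) (Suc n) s w \<and> dist w v \<le> b n / 4)}
        \<subseteq> {s. s \<in> P (Suc n) \<and> s \<subseteq> t \<and> (\<exists>w. approx m (Suc n) s w \<and> dist w v \<le> b n / 4)}"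
      using Suc.IH[of "Suc n"] by blast
  qed (rule fap_nonneg[OF fap])
  moreover note Suc.prems(1)[unfolded approx.simps(2)[of "Suc m" n t v]]
  ultimately show ?case unfolding approx.simps(2)[of m n t v] by linarith
qed

lemma approx_antimono: "m \<le> m' \<Longrightarrow> approx m' n t v \<Longrightarrow> t \<in> P n \<Longrightarrow> approx m n t v"
  by (induction m' rule: dec_induct) (use approx_Suc in blast)+

lemma approx_all_exists:
  assumes "n0 \<le> n" "t \<in> P n"
  shows "\<exists>v. approx_all n t v"
proof (rule ccontr)
  assume "\<not> ?thesis"
  then have "\<exists>m. \<forall>v\<in>Z n. \<not> approx m n t v"
    using approx_antimono assms(2)
    by (intro decreasing_predicates_fail_uniformly finite_Z) (auto simp: approx_all_def)
  then show False using approx_exists[OF assms] approx_in_Z by blast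
qed

text \<open>Every child outside the cluster fails at some finite depth. Since the children are
  finite in number, one depth \<open>m\<close> excludes all of these, and the mass bound contained
  in \<open>approx (Suc m)\<close> becomes a bound for the cluster.\<close>

lemma approx_all_cluster:
  assumes "n0 \<le> n" "t \<in> P n" "approx_all n t v"
  shows "\<mu> t / (2 * real (N n)) \<le> (\<Sum>s\<in>cluster n t v. \<mu> s)"
proof -
  define C where "C m = {s. s \<in> P (Suc n) \<and> s \<subseteq> t \<and> (\<exists>w. approx m (Suc n) s w \<and> dist w v \<le> b n / 4)}" for m
  define B where "B = {s. s \<in> P (Suc n) \<and> s \<subseteq> t} - cluster n t v"
  have fin: "finite B" using finite_level[of "Suc n"] by (simp add: B_def)
  have "\<exists>m. \<forall>s\<in>B. \<not> (\<exists>w. approx m (Suc n) s w \<and> dist w v \<le> b n / 4)"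
  proof (rule decreasing_predicates_fail_uniformly[OF fin])
    fix s assume s: "s \<in> B"
    have "\<exists>m. \<forall>w\<in>{w \<in> Z (Suc n). dist w v \<le> b n / 4}. \<not> approx m (Suc n) s w"
      using s approx_antimono finite_Z
      by (intro decreasing_predicates_fail_uniformly) (auto simp: B_def cluster_def approx_all_def)
    then show "\<exists>m. \<not> (\<exists>w. approx m (Suc n) s w \<and> dist w v \<le> b n / 4)" using approx_in_Z by blast
  next
    fix m m' :: nat and s assume "m \<le> m'" "s \<in> B" "\<exists>w. approx m' (Suc n) s w \<and> dist w v \<le> b n / 4"
    then show "\<exists>w. approx m (Suc n) s w \<and> dist w v \<le> b n / 4"
      using approx_antimono[of m m' "Suc n" s] by (auto simp: B_def)
  qed
  then obtain m where "\<forall>s\<in>B. \<not> (\<exists>w. approx m (Suc n) s w \<and> dist w v \<le> b n / 4)" by blast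
  then have "C m \<subseteq> cluster n t v" by (auto simp: C_def B_def)
  then have "(\<Sum>s\<in>C m. \<mu> s) \<le> (\<Sum>s\<in>cluster n t v. \<mu> s)"
    using finite_cluster fap_nonneg[OF fap] by (intro sum_mono2) auto
  moreover have "\<mu> t / (2 * real (N n)) \<le> (\<Sum>s\<in>C m. \<mu> s)"
  proof -
    have "approx (Suc m) n t v" using assms(3) by (simp only: approx_all_def)
    then show ?thesis by (simp add: C_def)
  qed
  ultimately show ?thesis by simp
qed

text \<open>Each digit gets at least half of its expected share \<open>1 / card \<Gamma>\<close> of
  the least admissible cluster mass. Quantifying over \<open>v \<in> Z n\<close>, with the mass
  bound as a premise, leaves finitely many events on each level.\<close>

definition good_digits :: "(nat \<Rightarrow> 'k set \<Rightarrow> 'e) \<Rightarrow> bool" where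
  "good_digits dig \<longleftrightarrow> (\<forall>n\<ge>n0. \<forall>t\<in>P n. \<forall>v\<in>Z n. \<forall>\<gamma>\<in>\<Gamma>.
     \<mu> t / (2 * real (N n)) \<le> (\<Sum>s\<in>cluster n t v. \<mu> s) \<longrightarrow>
     \<mu> t / (4 * real (N n) * real (card \<Gamma>)) \<le> (\<Sum>s | s \<in> cluster n t v \<and> dig n s = \<gamma>. \<mu> s))"

lemma card_\<Gamma>: "0 < card \<Gamma>"
  using \<Gamma>_net[of 0] finite_\<Gamma> by (auto simp: card_gt_0_iff)

lemma b_to_0: "b \<longlonglongrightarrow> 0"
proof -
  have eq: "b n = b 0 * (3 / 4) ^ n" for n by (induction n) (auto simp: b_Suc)
  have "(\<lambda>n. b 0 * (3 / 4 :: real) ^ n) \<longlonglongrightarrow> b 0 * 0"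
    by (intro tendsto_mult_left LIMSEQ_realpow_zero) auto
  then show ?thesis by (simp only: eq[symmetric] mult_zero_right)
qed

text \<open>The digits steer towards \<open>y\<close>: a residual of size at most \<open>b n\<close>
  is reduced to \<open>b n / 2\<close> by a suitable digit and disturbed by at most
  \<open>b n / 4\<close> when \<open>f\<close> is read on the child, so at most
  \<open>b (Suc n)\<close> is left. Every \<open>y\<close> in the ball of radius \<open>b n0\<close>
  around the initial value starts with an admissible residual, and the content bound does not vary
  with \<open>y\<close>.\<close>

theorem fibres_large:
  fixes g :: "'k \<Rightarrow> 'e" and p :: "nat \<Rightarrow> 'k \<Rightarrow> 'e"
  assumes dig: "good_digits dig"
    and p: "\<And>x. p 0 x = 0" "\<And>n s x. s \<in> P (Suc n) \<Longrightarrow> x \<in> s \<Longrightarrow> p (Suc n) x = p n x + b n *\<^sub>R dig n s"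
    and g: "\<And>n x. dist (g x) (p n x) \<le> 4 * b n"
    and cont: "continuous_on UNIV (\<lambda>x. f x + g x)"
    and D: "\<And>n. 0 < D n" "decseq D" "D \<longlonglongrightarrow> 0"
    and decay: "\<And>n x r. 0 < r \<Longrightarrow> r < 4 * D n \<Longrightarrow>
        (\<Prod>k<n + 2. 4 * real (N k) * real (card \<Gamma>)) * \<mu> (ball x r) \<le> r powr s"
    and s: "0 \<le> s"
  shows "\<exists>U c. open U \<and> U \<noteq> {} \<and> 0 < c \<and> (\<forall>y\<in>U. content_ge s c {x. f x + g x = y})"
proof -
  obtain t0 where t0: "t0 \<in> P n0" using level_nonempty by blast
  obtain v0 where v0: "approx_all n0 t0 v0" using approx_all_exists[OF order_refl t0] by blast
  have p_const: "\<exists>q. \<forall>x\<in>t. p n x = q" if "t \<in> P n" for n t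
    using that
  proof (induction n arbitrary: t)
    case (Suc n)
    obtain t' where t': "t' \<in> P n" "t \<subseteq> t'" using parent[OF Suc.prems] by blast
    then obtain q where "\<forall>x\<in>t'. p n x = q" using Suc.IH by blast
    then show ?case using p(2)[OF Suc.prems] t'(2) by (intro exI[of _ "q + b n *\<^sub>R dig n t"]) auto
  qed (simp add: p)
  obtain q0 where q0: "\<And>x. x \<in> t0 \<Longrightarrow> p n0 x = q0" using p_const[OF t0] by blast
  define c where "c = min ((2 * D n0) powr s) (\<mu> t0 / 2 powr s)"
  have "0 < c" using D(1)[of n0] cell_pos[OF t0] by (simp add: c_def)
  have "content_ge s c {x. f x + g x = y}" if y: "y \<in> ball (v0 + q0) (b n0)" for y
  proof -
    \<comment> \<open>The invariant of the steering: \<open>v\<close> stands for \<open>f\<close>,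
      \<open>q\<close> is the constant value of the partial perturbation on \<open>t\<close>, and
      \<open>y - v - q\<close> is what the later digits still have to supply.\<close>
    define T where "T n = {t \<in> P n. \<exists>v q. approx_all n t v \<and> (\<forall>x\<in>t. p n x = q) \<and> norm (y - v - q) \<le> b n}" for n
    define \<theta> where "\<theta> n = 1 / (4 * real (N n) * real (card \<Gamma>))" for n
    have "norm (y - v0 - q0) \<le> b n0" using y by (simp add: dist_norm norm_minus_commute diff_diff_eq)
    then have t0T: "t0 \<in> T n0" using t0 v0 q0 by (auto simp: T_def)
    have N1: "1 \<le> real (N n)" "1 \<le> real (card \<Gamma>)" for n using N_pos[of n] card_\<Gamma> by linarith+
    have \<theta>: "0 < \<theta> n" "\<theta> n \<le> 1" for n
    proof -
      define K where "K = 4 * real (N n) * real (card \<Gamma>)"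
      have "1 * 1 \<le> 4 * real (N n) * real (card \<Gamma>)" using N1(1)[of n] N1(2) by (intro mult_mono) auto
      then have "1 \<le> K" by (simp only: K_def mult_1)
      then show "0 < \<theta> n" "\<theta> n \<le> 1" unfolding \<theta>_def K_def[symmetric] by auto
    qed
    have kept: "\<theta> n * \<mu> t \<le> (\<Sum>s | s \<in> T (Suc n) \<and> s \<subseteq> t. \<mu> s)" if n: "n0 \<le> n" and t: "t \<in> T n" for n t
    proof -
      obtain v q where vq: "approx_all n t v" "\<And>x. x \<in> t \<Longrightarrow> p n x = q" "norm (y - v - q) \<le> b n" and tP: "t \<in> P n"
        using t by (auto simp: T_def)
      define u where "u = (1 / b n) *\<^sub>R (y - v - q)"
      have "norm u \<le> 1" using vq(3) b_pos[of n] by (simp add: u_def divide_simps)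
      then obtain \<gamma> where \<gamma>: "\<gamma> \<in> \<Gamma>" "norm (u - \<gamma>) \<le> 1 / 2" using \<Gamma>_net by blast
      have "y - v - q - b n *\<^sub>R \<gamma> = b n *\<^sub>R (u - \<gamma>)" using b_pos[of n] by (simp add: u_def scaleR_diff_right)
      then have near: "norm (y - v - q - b n *\<^sub>R \<gamma>) \<le> b n / 2"
        using \<gamma>(2) b_pos[of n] by (simp add: mult_left_mono[of _ "1/2" "b n", simplified])
      have "v \<in> Z n" using vq(1) approx_in_Z[of 0 n t v] by (simp only: approx_all_def)
      then have "\<mu> t / (4 * real (N n) * real (card \<Gamma>)) \<le> (\<Sum>s | s \<in> cluster n t v \<and> dig n s = \<gamma>. \<mu> s)"
        using dig n tP \<gamma>(1) approx_all_cluster[OF n tP vq(1)] unfolding good_digits_def by blast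
      also have "\<dots> \<le> (\<Sum>s | s \<in> T (Suc n) \<and> s \<subseteq> t. \<mu> s)"
      proof (rule sum_mono2)
        show "finite {s. s \<in> T (Suc n) \<and> s \<subseteq> t}" using finite_level[of "Suc n"] by (simp add: T_def)
        show "{s. s \<in> cluster n t v \<and> dig n s = \<gamma>} \<subseteq> {s. s \<in> T (Suc n) \<and> s \<subseteq> t}"
        proof
          fix s assume "s \<in> {s. s \<in> cluster n t v \<and> dig n s = \<gamma>}"
          then obtain w where s: "s \<in> P (Suc n)" "s \<subseteq> t" "dig n s = \<gamma>" "approx_all (Suc n) s w" "dist w v \<le> b n / 4"
            by (auto simp: cluster_def)
          have "p (Suc n) x = q + b n *\<^sub>R \<gamma>" if "x \<in> s" for x
            using p(2)[OF s(1) that] vq(2)[of x] s(2,3) that by auto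
          moreover have "norm (y - w - (q + b n *\<^sub>R \<gamma>)) \<le> b (Suc n)"
          proof -
            have "y - w - (q + b n *\<^sub>R \<gamma>) = (y - v - q - b n *\<^sub>R \<gamma>) + (v - w)" by simp
            then have "norm (y - w - (q + b n *\<^sub>R \<gamma>)) \<le> norm (y - v - q - b n *\<^sub>R \<gamma>) + norm (v - w)"
              by (metis norm_triangle_ineq)
            then show ?thesis using near s(5) by (simp add: b_Suc dist_norm norm_minus_commute)
          qed
          ultimately show "s \<in> {s. s \<in> T (Suc n) \<and> s \<subseteq> t}" using s unfolding T_def by blast
        qed
      qed (simp add: fap_nonneg[OF fap])
      finally show ?thesis by (simp add: \<theta>_def)
    qed
    \<comment> \<open>The 6 is \<open>1 + 4 + 1\<close>: the distance of \<open>f x\<close> from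
      \<open>v\<close>, the tail of the perturbation, and the residual of \<open>y\<close>.\<close>
    have near: "\<exists>x\<in>t. dist (f x + g x) y \<le> 6 * b n" if t: "t \<in> T n" for n t
    proof -
      obtain v q where vq: "approx 0 n t v" "\<And>x. x \<in> t \<Longrightarrow> p n x = q" "norm (y - v - q) \<le> b n"
        using t by (auto simp: T_def approx_all_def simp del: approx.simps)
      then obtain x where x: "x \<in> t" "dist (f x) v \<le> b n" by auto
      have "f x + g x - y = (f x - v) + (g x - q) - (y - v - q)" by simp
      then have "norm (f x + g x - y) \<le> norm (f x - v) + norm (g x - q) + norm (y - v - q)"
        by (metis norm_triangle_le_diff norm_triangle_ineq add_mono order_refl)
      then have "dist (f x + g x) y \<le> 6 * b n"
        using g[of x n] vq(2)[OF x(1)] vq(3) x(2) by (simp add: dist_norm)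
      then show ?thesis using x(1) by blast
    qed
    have closed: "closed {x. f x + g x = y}"
      using cont by (intro closed_Collect_eq) auto
    \<comment> \<open>Outside \<open>W\<close> the distance from \<open>f x + g x\<close> to
      \<open>y\<close> has a positive minimum. Once \<open>6 * b n\<close> falls below it, the point
      of each cell given by \<open>near\<close> must lie in \<open>W\<close>.\<close>
    have meets: "\<exists>n1. \<forall>n\<ge>n1. \<forall>t\<in>T n. t \<inter> W \<noteq> {}" if W: "open W" "{x. f x + g x = y} \<subseteq> W" for W
    proof (cases "W = UNIV")
      case True
      then show ?thesis using cell_nonempty by (auto simp: T_def)
    next
      case False
      have "compact (- W)" using compact_Int_closed[OF compact_UNIV] W(1) by (metis closed_Compl inf_top_left)
      moreover have "continuous_on (- W) (\<lambda>x. dist (f x + g x) y)"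
        by (intro continuous_on_dist continuous_on_subset[OF cont]) auto
      ultimately obtain z where z: "z \<in> - W" "\<And>x. x \<in> - W \<Longrightarrow> dist (f z + g z) y \<le> dist (f x + g x) y"
        using continuous_attains_inf[of "- W"] False by blast
      have "0 < dist (f z + g z) y" using z(1) W(2) by auto
      moreover have "(\<lambda>n. 6 * b n) \<longlonglongrightarrow> 0" using tendsto_mult_left[OF b_to_0, of 6] by simp
      ultimately have "eventually (\<lambda>n. 6 * b n < dist (f z + g z) y) sequentially"
        by (intro order_tendstoD(2))
      then obtain n1 where n1: "\<And>n. n1 \<le> n \<Longrightarrow> 6 * b n < dist (f z + g z) y"
        by (auto simp: eventually_sequentially)
      have "t \<inter> W \<noteq> {}" if "n1 \<le> n" "t \<in> T n" for n t
        using near[OF that(2)] n1[OF that(1)] z(2) by (meson ComplI disjoint_iff le_less_trans not_le)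
      then show ?thesis by blast
    qed
    show ?thesis
      unfolding c_def
    proof (rule content_ge_mass_distribution[of T t0 n0 \<theta>, OF _ t0T \<theta> kept D _ s closed meets])
      show "T n \<subseteq> P n" for n by (auto simp: T_def)
      show "(\<Prod>k<n + 2. 1 / \<theta> k) * \<mu> (ball x r) \<le> r powr s" if "0 < r" "r < 4 * D n" for n x r
        using decay[OF that, of x] by (simp add: \<theta>_def)
    qed
  qed
  then show ?thesis using \<open>0 < c\<close> b_pos[of n0] by (intro exI[of _ "ball (v0 + q0) (b n0)"] exI[of _ c]) auto
qed

end

section \<open>The random perturbation\<close>

lemma finite_net_cball:
  assumes "0 < (e::real)"
  obtains Z :: "'e::euclidean_space set" where "finite Z" "Z \<subseteq> cball 0 r" "\<And>x. x \<in> cball 0 r \<Longrightarrow> \<exists>v\<in>Z. dist x v \<le> e"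
proof -
  obtain Z where Z: "finite Z" "Z \<subseteq> cball (0::'e) r" "cball 0 r \<subseteq> (\<Union>v\<in>Z. ball v e)"
    using compact_cball[of "0::'e" r] assms compactE_image[of "cball (0::'e) r" "cball 0 r" "\<lambda>v. ball v e"]
    by (metis (no_types, lifting) UN_I centre_in_ball open_ball subsetI)
  have "\<exists>v\<in>Z. dist x v \<le> e" if "x \<in> cball 0 r" for x
  proof -
    have "x \<in> (\<Union>v\<in>Z. ball v e)" using Z(3) that by blast
    then show ?thesis by (auto simp: dist_commute intro: less_imp_le)
  qed
  then show ?thesis using Z that by blast
qed

section \<open>Independent uniform digits and their concentration\<close>

definition digits :: "'e::euclidean_space set" where
  "digits = (SOME \<Gamma>. finite \<Gamma> \<and> \<Gamma> \<subseteq> cball 0 1 \<and> (\<forall>u\<in>cball 0 1. \<exists>\<gamma>\<in>\<Gamma>. dist u \<gamma> \<le> 1 / 2))"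

lemma digits:
  shows finite_digits: "finite (digits :: 'e::euclidean_space set)"
    and digits_subset: "(digits :: 'e set) \<subseteq> cball 0 1"
    and digits_net: "norm (u :: 'e) \<le> 1 \<Longrightarrow> \<exists>\<gamma>\<in>digits. norm (u - \<gamma>) \<le> 1 / 2"
    and digits_nonempty: "(digits :: 'e set) \<noteq> {}"
proof -
  obtain Z :: "'e set" where "finite Z" "Z \<subseteq> cball 0 1" "\<And>x. x \<in> cball 0 1 \<Longrightarrow> \<exists>v\<in>Z. dist x v \<le> 1 / 2"
    using finite_net_cball[of "1/2" 1] by auto
  then have "\<exists>\<Gamma>::'e set. finite \<Gamma> \<and> \<Gamma> \<subseteq> cball 0 1 \<and> (\<forall>u\<in>cball 0 1. \<exists>\<gamma>\<in>\<Gamma>. dist u \<gamma> \<le> 1 / 2)" by blast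
  then have *: "finite (digits :: 'e set) \<and> (digits :: 'e set) \<subseteq> cball 0 1 \<and> (\<forall>u\<in>cball 0 1. \<exists>\<gamma>\<in>(digits :: 'e set). dist u \<gamma> \<le> 1 / 2)"
    unfolding digits_def by (rule someI_ex)
  then show "finite (digits :: 'e set)" "(digits :: 'e set) \<subseteq> cball 0 1" by auto
  show net: "norm u \<le> 1 \<Longrightarrow> \<exists>\<gamma>\<in>digits. norm (u - \<gamma>) \<le> 1 / 2" for u :: 'e
    using * by (simp add: dist_norm)
  show "(digits :: 'e set) \<noteq> {}" using net[of 0] by auto
qed

text \<open>The uniform law is moved from the discrete to the Borel sigma-algebra, so that the
  countable power lives on the Borel sets of sequence space and continuous functions of the digits
  are measurable.\<close>

definition digit_measure :: "'e::euclidean_space measure" where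
  "digit_measure = distr (measure_pmf (pmf_of_set digits)) borel (\<lambda>x. x)"

definition digits_measure :: "(nat \<Rightarrow> 'e::euclidean_space) measure" where
  "digits_measure = PiM UNIV (\<lambda>_. digit_measure)"

lemma prob_space_digit_measure: "prob_space digit_measure"
  unfolding digit_measure_def by (rule measure_pmf.prob_space_distr) simp

lemma sets_digit_measure [simp]: "sets digit_measure = sets borel"
  and space_digit_measure [simp]: "space digit_measure = UNIV"
  by (auto simp: digit_measure_def)

lemma prob_space_digits_measure: "prob_space digits_measure"
  unfolding digits_measure_def by (intro prob_space_PiM prob_space_digit_measure)

lemma sets_digits_measure: "sets (digits_measure :: (nat \<Rightarrow> 'e::euclidean_space) measure) = sets borel"
proof -
  have "sets (digits_measure :: (nat \<Rightarrow> 'e) measure) = sets (PiM UNIV (\<lambda>_::nat. borel :: 'e measure))"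
    unfolding digits_measure_def by (intro sets_PiM_cong) auto
  then show ?thesis by (simp only: sets_PiM_equal_borel)
qed

lemma space_digits_measure [simp]: "space digits_measure = UNIV"
  using sets_eq_imp_space_eq[OF sets_digits_measure] by simp

lemma measure_digit:
  assumes "\<gamma> \<in> digits"
  shows "measure digit_measure {\<gamma> :: 'e::euclidean_space} = 1 / real (card (digits :: 'e set))"
proof -
  have "measure digit_measure {\<gamma>} = measure (measure_pmf (pmf_of_set digits)) {\<gamma>}"
    by (simp add: digit_measure_def measure_distr)
  also have "\<dots> = 1 / real (card (digits :: 'e set))"
    using assms finite_digits by (subst measure_pmf_of_set) auto
  finally show ?thesis .
qed

lemma distr_digits_component:
  "distr digits_measure borel (\<lambda>\<omega>. \<omega> i) = (digit_measure :: 'e::euclidean_space measure)"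
proof -
  interpret product_prob_space "\<lambda>_::nat. digit_measure :: 'e measure" UNIV
    by (intro product_prob_spaceI prob_space_digit_measure)
  have "distr digits_measure borel (\<lambda>\<omega>. \<omega> i) = distr digits_measure (digit_measure :: 'e measure) (\<lambda>\<omega>. \<omega> i)"
    by (intro distr_cong) auto
  also have "\<dots> = digit_measure" unfolding digits_measure_def by (rule PiM_component) simp
  finally show ?thesis .
qed

lemma measurable_digit [measurable]: "(\<lambda>\<omega>. \<omega> i) \<in> digits_measure \<rightarrow>\<^sub>M borel"
proof -
  have "(\<lambda>\<omega>. \<omega> i) \<in> digits_measure \<rightarrow>\<^sub>M (digit_measure :: 'a measure)"
    unfolding digits_measure_def by (rule measurable_component_singleton) simp
  then show ?thesis using measurable_cong_sets[OF refl sets_digit_measure] by blast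
qed

lemma indep_digits:
  "prob_space.indep_vars digits_measure (\<lambda>_. borel) (\<lambda>i \<omega>. \<omega> i :: 'e::euclidean_space) UNIV"
proof -
  interpret prob_space "digits_measure :: (nat \<Rightarrow> 'e) measure" by (rule prob_space_digits_measure)
  have "distr digits_measure (PiM UNIV (\<lambda>_::nat. borel :: 'e measure)) (\<lambda>\<omega>. \<lambda>i\<in>UNIV. \<omega> i) = 
    distr digits_measure digits_measure (\<lambda>\<omega>. \<omega>)"
    by (intro distr_cong) (auto simp: sets_digits_measure sets_PiM_equal_borel)
  also have "\<dots> = digits_measure" by simp
  also have "\<dots> = PiM UNIV (\<lambda>i. distr digits_measure borel (\<lambda>\<omega>. \<omega> i))"
    unfolding distr_digits_component by (simp add: digits_measure_def)
  finally show ?thesis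
    by (subst indep_vars_iff_distr_eq_PiM) auto
qed

text \<open>Hoeffding's inequality for weighted indicators of independent digits, at half of the
  mean. As every weight is at most \<open>\<kappa>\<close>, the squared weights sum to at most
  \<open>\<kappa> * sum w I\<close>: small individual weights force concentration.\<close>

lemma digit_deviation:
  fixes \<gamma> :: "'e::euclidean_space"
  assumes I: "finite I" "inj_on \<iota> I" and w: "\<And>i. i \<in> I \<Longrightarrow> 0 \<le> w i" "\<And>i. i \<in> I \<Longrightarrow> w i \<le> \<kappa>"
    and W: "0 < sum w I" and \<gamma>: "\<gamma> \<in> digits"
  defines "q \<equiv> real (card (digits :: 'e set))"
  shows "measure digits_measure {\<omega>. (\<Sum>i | i \<in> I \<and> \<omega> (\<iota> i :: nat) = \<gamma>. w i) \<le> sum w I / (2 * q)} \<le> 2 * q\<^sup>2 * \<kappa> / sum w I"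
proof -
  interpret prob_space "digits_measure :: (nat \<Rightarrow> 'e) measure" by (rule prob_space_digits_measure)
  define X where "X j \<omega> = w (inv_into I \<iota> j) * indicator {\<gamma>} (\<omega> j)" for j and \<omega> :: "nat \<Rightarrow> 'e"
  define J where "J = \<iota> ` I"
  have inv: "inv_into I \<iota> (\<iota> i) = i" if "i \<in> I" for i using I(2) that by (rule inv_into_f_f)
  have q: "0 < q" using finite_digits digits_nonempty by (simp add: q_def card_gt_0_iff)
  have indep: "indep_vars (\<lambda>_. borel) X J"
  proof -
    have "indep_vars (\<lambda>_. borel) (\<lambda>i \<omega>. \<omega> i :: 'e) J" using indep_vars_subset[OF indep_digits] by auto
    then show ?thesis unfolding X_def by (rule indep_vars_compose2) measurable
  qed
  interpret H: Hoeffding_ineq digits_measure J X "\<lambda>_. 0" "\<lambda>j. w (inv_into I \<iota> j)" "\<Sum>j\<in>J. expectation (X j)"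
  proof unfold_locales
    show "finite J" using I(1) by (simp add: J_def)
    show "indep_vars (\<lambda>_. borel) X J" by (rule indep)
    show "AE x in digits_measure. X j x \<in> {0..w (inv_into I \<iota> j)}" if "j \<in> J" for j
      using that w(1) inv by (auto simp: X_def J_def indicator_def)
  qed auto
  have exp: "expectation (X j) = w (inv_into I \<iota> j) / q" for j
  proof -
    have "expectation (\<lambda>\<omega>. indicator {\<gamma>} (\<omega> j)) = measure digit_measure {\<gamma>}"
    proof -
      have "integral\<^sup>L (distr digits_measure borel (\<lambda>\<omega>. \<omega> j)) (indicator {\<gamma>} :: 'e \<Rightarrow> real)
          = expectation (\<lambda>\<omega>. indicator {\<gamma>} (\<omega> j))"
        by (rule integral_distr) auto
      then have "expectation (\<lambda>\<omega>. indicator {\<gamma>} (\<omega> j))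
          = integral\<^sup>L (distr digits_measure borel (\<lambda>\<omega>. \<omega> j)) (indicator {\<gamma>} :: 'e \<Rightarrow> real)" by simp
      also have "\<dots> = measure digit_measure {\<gamma>}" unfolding distr_digits_component by simp
      finally show ?thesis .
    qed
    then show ?thesis by (simp add: X_def[abs_def] measure_digit[OF \<gamma>] q_def)
  qed
  have sum_J: "(\<Sum>j\<in>J. h (inv_into I \<iota> j)) = (\<Sum>i\<in>I. h i)" for h :: "_ \<Rightarrow> real"
    unfolding J_def using I(2) inv by (subst sum.reindex) (auto intro!: sum.cong)
  have mean: "(\<Sum>j\<in>J. expectation (X j)) = sum w I / q"
    unfolding exp sum_J[of "\<lambda>i. w i / q"] by (simp add: sum_divide_distrib)
  have sq: "(\<Sum>j\<in>J. (w (inv_into I \<iota> j) - 0)\<^sup>2) = (\<Sum>i\<in>I. (w i)\<^sup>2)" using sum_J[of "\<lambda>i. (w i)\<^sup>2"] by simp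
  obtain i0 where "i0 \<in> I" "w i0 \<noteq> 0" using W by (metis less_irrefl sum.neutral)
  then have sq_pos: "0 < (\<Sum>i\<in>I. (w i)\<^sup>2)"
    using I(1) by (intro sum_pos2[of _ i0]) auto
  have "\<kappa> > 0" using w \<open>i0 \<in> I\<close> \<open>w i0 \<noteq> 0\<close> by (smt (verit))
  have sq_le: "(\<Sum>i\<in>I. (w i)\<^sup>2) \<le> \<kappa> * sum w I"
    unfolding sum_distrib_left power2_eq_square using w by (intro sum_mono mult_right_mono) auto
  have sum_X: "(\<Sum>j\<in>J. X j \<omega>) = (\<Sum>i | i \<in> I \<and> \<omega> (\<iota> i) = \<gamma>. w i)" for \<omega>
  proof -
    have "(\<Sum>j\<in>J. X j \<omega>) = (\<Sum>i\<in>I. X (\<iota> i) \<omega>)" unfolding J_def using I(2) by (subst sum.reindex) auto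
    also have "\<dots> = (\<Sum>i\<in>I. if \<omega> (\<iota> i) = \<gamma> then w i else 0)" by (intro sum.cong) (auto simp: X_def inv)
    also have "\<dots> = (\<Sum>i | i \<in> I \<and> \<omega> (\<iota> i) = \<gamma>. w i)" using I(1) by (simp add: sum.inter_filter)
    finally show ?thesis .
  qed
  define \<epsilon> where "\<epsilon> = sum w I / (2 * q)"
  have "0 < \<epsilon>" using W q by (simp add: \<epsilon>_def)
  define S where "S = (\<Sum>i\<in>I. (w i)\<^sup>2)"
  have "measure digits_measure {\<omega>. (\<Sum>i | i \<in> I \<and> \<omega> (\<iota> i) = \<gamma>. w i) \<le> sum w I / (2 * q)}
      = prob {\<omega>\<in>space digits_measure. (\<Sum>j\<in>J. X j \<omega>) \<le> (\<Sum>j\<in>J. expectation (X j)) - \<epsilon>}"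
    unfolding sum_X mean \<epsilon>_def using q by (simp add: field_simps)
  also have "\<dots> \<le> exp (- 2 * \<epsilon>\<^sup>2 / (\<Sum>j\<in>J. (w (inv_into I \<iota> j) - 0)\<^sup>2))"
    using \<open>0 < \<epsilon>\<close> sq sq_pos by (intro H.Hoeffding_ineq_le) auto
  also have "\<dots> = exp (- (2 * \<epsilon>\<^sup>2 / S))" unfolding sq S_def by simp
  \<comment> \<open>The crude estimate \<open>exp (- a) \<le> 1 / a\<close> suffices: it leaves a
    bound linear in \<open>\<kappa>\<close>, which the construction of the tree can make as small as
    desired.\<close>
  also have "\<dots> \<le> 1 / (2 * \<epsilon>\<^sup>2 / S)"
  proof -
    define a where "a = 2 * \<epsilon>\<^sup>2 / S"
    have "0 < a" using \<open>0 < \<epsilon>\<close> sq_pos by (simp add: a_def S_def)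
    moreover have "a \<le> exp a" using exp_ge_add_one_self[of a] by linarith
    ultimately show ?thesis unfolding a_def[symmetric] by (simp add: exp_minus divide_simps)
  qed
  also have "\<dots> = S / (2 * \<epsilon>\<^sup>2)" by simp
  also have "\<dots> \<le> (\<kappa> * sum w I) / (2 * \<epsilon>\<^sup>2)" using sq_le \<open>0 < \<epsilon>\<close> by (intro divide_right_mono) (auto simp: S_def)
  also have "\<dots> = 2 * q\<^sup>2 * \<kappa> / sum w I" using W q by (simp add: \<epsilon>_def field_simps power2_eq_square)
  finally show ?thesis .
qed

section \<open>Random fields as continuous maps\<close>

instance bcontfun :: (metric_space, banach) banach ..

lemma apply_bcontfun_sum: "apply_bcontfun (\<Sum>k\<in>A. h k) x = (\<Sum>k\<in>A. apply_bcontfun (h k) x)"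
  for h :: "_ \<Rightarrow> 'k::metric_space \<Rightarrow>\<^sub>C 'e::real_normed_vector"
  by (induction A rule: infinite_finite_induct) (auto simp: plus_bcontfun.rep_eq zero_bcontfun.rep_eq)

text \<open>Digits lie in the unit ball only almost surely, and bumps may overlap off the cells.
  Clipping bounds the field for every \<open>\<omega>\<close> and every point; it is 1-Lipschitz,
  which preserves continuity, and it fixes the digits themselves.\<close>

definition unit_clip :: "'e::euclidean_space \<Rightarrow> 'e" where
  "unit_clip v = closest_point (cball 0 1) v"

lemma norm_unit_clip: "norm (unit_clip v) \<le> 1"
  using closest_point_in_set[of "cball (0::'a) 1" v] by (simp add: unit_clip_def)

lemma unit_clip_id: "norm v \<le> 1 \<Longrightarrow> unit_clip v = v"
  by (simp add: unit_clip_def closest_point_self)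

lemma dist_unit_clip: "dist (unit_clip v) (unit_clip w) \<le> dist v w"
  unfolding unit_clip_def by (rule closest_point_lipschitz) auto

lemma continuous_on_unit_clip: "continuous_on A unit_clip"
  unfolding unit_clip_def by (rule continuous_on_closest_point) auto

context cell_tree
begin

definition gap :: "nat \<Rightarrow> real" where
  "gap n = (SOME \<delta>. separated_family \<delta> (P n))"

definition bump :: "nat \<Rightarrow> 'k set \<Rightarrow> 'k \<Rightarrow> real" where
  "bump n t x = max 0 (1 - infdist x t / gap n)"

text \<open>
  All levels read their digits from the same sequence \<open>\<omega>\<close>: only independence within a level is used.
\<close>

definition cell_index :: "nat \<Rightarrow> 'k set \<Rightarrow> nat" where
  "cell_index n = to_nat_on (P n)"

definition random_field :: "nat \<Rightarrow> (nat \<Rightarrow> 'e::euclidean_space) \<Rightarrow> 'k \<Rightarrow> 'e" where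
  "random_field n \<omega> x = unit_clip (\<Sum>t\<in>P n. bump n t x *\<^sub>R \<omega> (cell_index n t))"

definition random_field_bcontfun :: "nat \<Rightarrow> (nat \<Rightarrow> 'e::euclidean_space) \<Rightarrow> 'k \<Rightarrow>\<^sub>C 'e" where
  "random_field_bcontfun n \<omega> = Bcontfun (random_field n \<omega>)"

lemma gap: "separated_family (gap n) (P n)"
  unfolding gap_def using separated_level by (rule someI_ex)

lemma gap_pos: "0 < gap n"
  using gap by (simp add: separated_family_def)

lemma inj_on_cell_index: "inj_on (cell_index n) (P n)"
  unfolding cell_index_def by (intro inj_on_to_nat_on countable_finite finite_level)

lemma bump_bounds: "0 \<le> bump n t x" "bump n t x \<le> 1"
  using gap_pos[of n] infdist_nonneg[of x t] by (auto simp: bump_def)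

text \<open>Other cells of the level are at distance at least \<open>gap n\<close>, where their
  bumps have dropped to zero, so a single digit survives in the sum.\<close>

lemma random_field_on_cell:
  assumes t: "t \<in> P n" "x \<in> t"
  shows "random_field n \<omega> x = unit_clip (\<omega> (cell_index n t))"
proof -
  have "bump n t' x = (if t' = t then 1 else 0)" if t': "t' \<in> P n" for t'
  proof (cases "t' = t")
    case True
    then show ?thesis using t by (simp add: bump_def)
  next
    case False
    have "gap n \<le> infdist x t'"
      unfolding infdist_notempty[OF cell_nonempty[OF t']]
      using gap[of n] t t' False cell_nonempty[OF t']
      by (intro cINF_greatest) (auto simp: separated_family_def)
    then show ?thesis using False gap_pos[of n] by (simp add: bump_def)
  qed
  then have "(\<Sum>t'\<in>P n. bump n t' x *\<^sub>R \<omega> (cell_index n t')) = (\<Sum>t'\<in>P n. if t' = t then \<omega> (cell_index n t') else 0)"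
    by (intro sum.cong) auto
  also have "\<dots> = \<omega> (cell_index n t)" using t(1) finite_level by (simp add: sum.delta)
  finally show ?thesis by (simp add: random_field_def)
qed

lemma norm_random_field: "norm (random_field n \<omega> x) \<le> 1"
  by (simp add: random_field_def norm_unit_clip)

lemma continuous_on_random_field: "continuous_on UNIV (random_field n \<omega>)"
  unfolding random_field_def bump_def
  by (intro continuous_on_compose2[OF continuous_on_unit_clip[of UNIV]] continuous_intros) (use gap_pos[of n] in auto)

lemma apply_random_field_bcontfun: "apply_bcontfun (random_field_bcontfun n \<omega>) = random_field n \<omega>"
  unfolding random_field_bcontfun_def
  by (intro Bcontfun_inverse bcontfun_normI[OF continuous_on_random_field norm_random_field])

lemma norm_random_field_bcontfun: "norm (random_field_bcontfun n \<omega>) \<le> 1"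
  by (rule norm_bound) (simp add: apply_random_field_bcontfun norm_random_field)

lemma dist_random_field_bcontfun:
  "dist (random_field_bcontfun n \<omega>) (random_field_bcontfun n \<omega>')
    \<le> (\<Sum>t\<in>P n. norm (\<omega> (cell_index n t) - \<omega>' (cell_index n t)))"
proof (rule dist_bound)
  fix x
  have "dist (random_field n \<omega> x) (random_field n \<omega>' x)
      \<le> norm (\<Sum>t\<in>P n. bump n t x *\<^sub>R (\<omega> (cell_index n t) - \<omega>' (cell_index n t)))"
    unfolding random_field_def by (rule order_trans[OF dist_unit_clip]) (simp add: dist_norm scaleR_diff_right sum_subtractf)
  also have "\<dots> \<le> (\<Sum>t\<in>P n. norm (\<omega> (cell_index n t) - \<omega>' (cell_index n t)))"
    using bump_bounds by (intro sum_norm_le) (auto intro!: mult_left_le_one_le)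
  finally show "dist (random_field_bcontfun n \<omega> x) (random_field_bcontfun n \<omega>' x)
      \<le> (\<Sum>t\<in>P n. norm (\<omega> (cell_index n t) - \<omega>' (cell_index n t)))"
    by (simp add: apply_random_field_bcontfun)
qed

text \<open>One level reads finitely many coordinates, hence continuity in \<open>\<omega>\<close>
  for the product topology. This is what makes the law of the perturbation a Borel measure on the
  space of maps.\<close>

lemma continuous_on_random_field_bcontfun: "continuous_on UNIV (random_field_bcontfun n)"
  unfolding continuous_on
proof
  fix \<omega>' :: "nat \<Rightarrow> 'e::euclidean_space"
  define h where "h \<omega> = (\<Sum>t\<in>P n. norm (\<omega> (cell_index n t) - \<omega>' (cell_index n t)))" for \<omega>
  have "continuous_on UNIV h" unfolding h_def
    by (intro continuous_intros continuous_on_product_coordinates)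
  then have "(h \<longlongrightarrow> h \<omega>') (at \<omega>')" by (simp add: continuous_on)
  then have "(h \<longlongrightarrow> 0) (at \<omega>')" by (simp add: h_def)
  moreover have "dist (random_field_bcontfun n \<omega>) (random_field_bcontfun n \<omega>') \<le> h \<omega>" for \<omega>
    unfolding h_def by (rule dist_random_field_bcontfun)
  ultimately have "((\<lambda>\<omega>. dist (random_field_bcontfun n \<omega>) (random_field_bcontfun n \<omega>')) \<longlongrightarrow> 0) (at \<omega>')"
    by (intro tendsto_sandwich[OF _ _ tendsto_const[of 0] \<open>(h \<longlongrightarrow> 0) (at \<omega>')\<close>]) auto
  then show "(random_field_bcontfun n \<longlongrightarrow> random_field_bcontfun n \<omega>') (at \<omega>')"
    by (rule tendsto_dist_iff[THEN iffD2])
qed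

definition perturbation :: "real \<Rightarrow> (nat \<Rightarrow> 'e::euclidean_space) \<Rightarrow> 'k \<Rightarrow>\<^sub>C 'e" where
  "perturbation a \<omega> = (\<Sum>n. (a * (3 / 4) ^ n) *\<^sub>R random_field_bcontfun (Suc n) \<omega>)"

definition partial_perturbation :: "real \<Rightarrow> nat \<Rightarrow> (nat \<Rightarrow> 'e::euclidean_space) \<Rightarrow> 'k \<Rightarrow> 'e" where
  "partial_perturbation a n \<omega> x = (\<Sum>k<n. (a * (3 / 4) ^ k) *\<^sub>R random_field (Suc k) \<omega> x)"

lemma norm_perturbation_term:
  "0 \<le> a \<Longrightarrow> norm ((a * (3 / 4) ^ n) *\<^sub>R random_field_bcontfun (Suc n) \<omega>) \<le> a * (3 / 4) ^ n"
  using norm_random_field_bcontfun[of "Suc n" \<omega>] by (simp add: mult_left_le)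

lemma sums_perturbation_bound: "(\<lambda>k. a * (3 / 4) ^ (k + n)) sums (4 * (a * (3 / 4) ^ n) :: real)"
proof -
  have "(\<lambda>k. (a * (3 / 4) ^ n) * (3 / 4) ^ k) sums ((a * (3 / 4) ^ n) * (1 / (1 - 3 / 4 :: real)))"
    by (intro sums_mult geometric_sums) auto
  then show ?thesis by (simp add: power_add mult_ac)
qed

lemma summable_perturbation:
  assumes "0 \<le> a"
  shows "summable (\<lambda>n. (a * (3 / 4) ^ n) *\<^sub>R random_field_bcontfun (Suc n) \<omega>)"
proof (rule summable_comparison_test')
  show "summable (\<lambda>n. a * (3 / 4 :: real) ^ n)" using sums_perturbation_bound[of a 0] by (simp add: sums_iff)
qed (rule norm_perturbation_term[OF assms])

lemma perturbation_tail:
  assumes "0 \<le> a"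
  shows "norm (perturbation a \<omega> - (\<Sum>k<n. (a * (3 / 4) ^ k) *\<^sub>R random_field_bcontfun (Suc k) \<omega>)) \<le> 4 * (a * (3 / 4) ^ n)"
proof -
  let ?F = "\<lambda>n. (a * (3 / 4) ^ n) *\<^sub>R random_field_bcontfun (Suc n) \<omega>"
  have "perturbation a \<omega> - (\<Sum>k<n. ?F k) = (\<Sum>k. ?F (k + n))"
    unfolding perturbation_def using suminf_split_initial_segment[OF summable_perturbation[OF assms], of \<omega> n] by simp
  also have "norm \<dots> \<le> (\<Sum>k. a * (3 / 4) ^ (k + n))"
    by (intro norm_suminf_le norm_perturbation_term[OF assms] sums_summable[OF sums_perturbation_bound])
  also have "\<dots> = 4 * (a * (3 / 4) ^ n)" by (rule sums_unique[OF sums_perturbation_bound, symmetric])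
  finally show ?thesis .
qed

lemma norm_perturbation: "0 \<le> a \<Longrightarrow> norm (perturbation a \<omega>) \<le> 4 * a"
  using perturbation_tail[of a \<omega> 0] by simp

lemma dist_partial_perturbation:
  assumes "0 \<le> a"
  shows "dist (perturbation a \<omega> x) (partial_perturbation a n \<omega> x) \<le> 4 * (a * (3 / 4) ^ n)"
proof -
  let ?S = "\<Sum>k<n. (a * (3 / 4) ^ k) *\<^sub>R random_field_bcontfun (Suc k) \<omega>"
  have "partial_perturbation a n \<omega> x = ?S x"
    by (simp add: partial_perturbation_def apply_bcontfun_sum scaleR_bcontfun.rep_eq apply_random_field_bcontfun)
  then have "dist (perturbation a \<omega> x) (partial_perturbation a n \<omega> x) \<le> dist (perturbation a \<omega>) ?S"
    by (simp only: dist_bounded)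
  also have "\<dots> \<le> 4 * (a * (3 / 4) ^ n)"
    unfolding dist_norm by (rule perturbation_tail[OF assms])
  finally show ?thesis .
qed

lemma continuous_on_perturbation:
  assumes "0 \<le> a"
  shows "continuous_on UNIV (perturbation a :: (nat \<Rightarrow> 'e::euclidean_space) \<Rightarrow> _)"
proof -
  have "uniform_limit UNIV (\<lambda>n \<omega>::nat \<Rightarrow> 'e. \<Sum>k<n. (a * (3 / 4) ^ k) *\<^sub>R random_field_bcontfun (Suc k) \<omega>)
      (perturbation a) sequentially"
    unfolding perturbation_def
    by (rule Weierstrass_m_test[of _ _ "\<lambda>n. a * (3 / 4) ^ n"])
       (use norm_perturbation_term[OF assms] sums_perturbation_bound[of a 0] in \<open>auto simp: sums_iff\<close>)
  moreover have "continuous_on UNIV (\<lambda>\<omega>::nat \<Rightarrow> 'e. \<Sum>k<n. (a * (3 / 4) ^ k) *\<^sub>R random_field_bcontfun (Suc k) \<omega>)" for n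
    by (intro continuous_on_sum continuous_on_scaleR continuous_on_const continuous_on_random_field_bcontfun)
  ultimately show ?thesis by (intro uniform_limit_theorem[where F = sequentially]) auto
qed

end

text \<open>For a given \<open>f\<close>, Borel-Cantelli yields a random level from which all digits
  are good, and the fibre theorem is applied from there. Thus \<open>U\<close> and \<open>c\<close>
  may depend on \<open>\<omega>\<close>, whereas \<open>X\<close> is the same for all
  \<open>f\<close>.\<close>

lemma random_perturbation:
  fixes \<mu> :: "'k::metric_space set \<Rightarrow> real"
  assumes comp: "compact (UNIV :: 'k set)" and fap: "finitely_additive_prob \<mu>"
    and decay: "mass_decay \<mu> s" and s: "0 \<le> s" and \<epsilon>: "0 < \<epsilon>"
  shows "\<exists>X :: (nat \<Rightarrow> 'e::euclidean_space) \<Rightarrow> 'k \<Rightarrow>\<^sub>C 'e. continuous_on UNIV X \<and> (\<forall>\<omega>. norm (X \<omega>) \<le> \<epsilon>) \<and>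
    (\<forall>f. AE \<omega> in digits_measure. \<exists>U c. open U \<and> U \<noteq> {} \<and> 0 < c \<and>
      (\<forall>y\<in>U. content_ge s c {x. apply_bcontfun f x + apply_bcontfun (X \<omega>) x = y}))"
proof -
  \<comment> \<open>The series of amplitudes \<open>a * (3 / 4) ^ n\<close> sums to
    \<open>4 * a\<close>.\<close>
  define a where "a = \<epsilon> / 4"
  define b where "b n = a * (3 / 4) ^ n" for n :: nat
  have a: "0 < a" using \<epsilon> by (simp add: a_def)
  have b_pos: "0 < b n" for n using a by (simp add: b_def)
  have b_Suc: "b (Suc n) = 3 / 4 * b n" for n by (simp add: b_def)
  have b_anti: "b (Suc n) \<le> b n" for n using b_pos[of n] by (simp add: b_Suc)
  have "\<forall>A n. \<exists>Z::'e set. finite Z \<and> Z \<subseteq> cball 0 (real A) \<and> (\<forall>x\<in>cball 0 (real A). \<exists>v\<in>Z. dist x v \<le> b n / 4)"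
  proof (intro allI)
    fix A n :: nat
    have "0 < b n / 4" using b_pos[of n] by simp
    from finite_net_cball[OF this, of "real A"]
    show "\<exists>Z::'e set. finite Z \<and> Z \<subseteq> cball 0 (real A) \<and> (\<forall>x\<in>cball 0 (real A). \<exists>v\<in>Z. dist x v \<le> b n / 4)"
      by metis
  qed
  then obtain Z :: "nat \<Rightarrow> nat \<Rightarrow> 'e set" where Z: "\<And>A n. finite (Z A n)" "\<And>A n. Z A n \<subseteq> cball 0 (real A)"
    "\<And>A n x. x \<in> cball 0 (real A) \<Longrightarrow> \<exists>v\<in>Z A n. dist x v \<le> b n / 4" by metis
  \<comment> \<open>A diagonal choice: \<open>N n\<close> dominates the nets for all integer radii
    up to \<open>n\<close>, so a map bounded by \<open>A\<close> is accommodated from level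
    \<open>A\<close> on.\<close>
  define N where "N n = 1 + (\<Sum>A\<le>n. card (Z A n))" for n
  have N: "0 < N n" "A \<le> n \<Longrightarrow> card (Z A n) \<le> N n" for n A
    using member_le_sum[of A "{..n}" "\<lambda>A. card (Z A n)"] by (auto simp: N_def)
  define q where "q = real (card (digits :: 'e set))"
  have q: "0 < q" using finite_digits digits_nonempty by (simp add: q_def card_gt_0_iff)
  have "\<forall>n. \<exists>D>0. \<forall>x r. 0 < r \<and> r < D \<longrightarrow> (\<Prod>k<n + 2. 4 * real (N k) * q) * \<mu> (ball x r) \<le> r powr s"
    using decay unfolding mass_decay_def by blast
  then obtain D' where D': "\<And>n. 0 < D' n"
    "\<And>n x r. 0 < r \<Longrightarrow> r < D' n \<Longrightarrow> (\<Prod>k<n + 2. 4 * real (N k) * q) * \<mu> (ball x r) \<le> r powr s"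
    by metis
  \<comment> \<open>The running minimum makes \<open>D\<close> decreasing, the term
    \<open>1 / real (Suc k)\<close> sends it to zero, and the division by 4 below matches the range
    \<open>r < 4 * D n\<close> of the decay condition.\<close>
  define E where "E n = Min ((\<lambda>k. min (D' k) (1 / real (Suc k))) ` {..n})" for n
  define D where "D n = E n / 4" for n
  have E_le: "E n \<le> min (D' n) (1 / real (Suc n))" for n unfolding E_def by (intro Min_le) auto
  have D_pos: "0 < D n" for n unfolding D_def E_def using D'(1) by (auto simp: Min_gr_iff)
  have D_decseq: "decseq D"
    unfolding decseq_def D_def E_def by (intro allI impI divide_right_mono Min_antimono image_mono) auto
  have D_lim: "D \<longlonglongrightarrow> 0"
  proof (rule tendsto_sandwich[OF _ _ tendsto_const[of 0] lim_inverse_n'[THEN LIMSEQ_Suc]])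
    show "\<forall>\<^sub>F n in sequentially. D n \<le> 1 / real (Suc n)"
    proof (intro always_eventually allI)
      fix n
      have "D n \<le> E n" using D_pos[of n] by (simp add: D_def)
      then show "D n \<le> 1 / real (Suc n)" using E_le[of n] by simp
    qed
    show "\<forall>\<^sub>F n in sequentially. 0 \<le> D n" using D_pos by (auto intro!: always_eventually less_imp_le)
  qed
  have D_decay: "(\<Prod>k<n + 2. 4 * real (N k) * q) * \<mu> (ball x r) \<le> r powr s" if "0 < r" "r < 4 * D n" for n x r
  proof (rule D'(2)[OF that(1)])
    have "4 * D n = E n" by (simp add: D_def)
    then show "r < D' n" using E_le[of n] that(2) by simp
  qed
  \<comment> \<open>Chosen by solving the union bound. By \<open>digit_deviation\<close> a bad event
    for \<open>t\<close> has probability at most \<open>4 * q^2 * N n * \<kappa> / \<mu> t\<close>,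
    since the cluster mass is at least \<open>\<mu> t / (2 * N n)\<close>. From level
    \<open>A\<close> on there are at most \<open>card Q * N n * q\<close> such events, so their
    total is at most \<open>1 / 2 ^ n\<close>.\<close>
  define \<kappa> where "\<kappa> n Q = Min (\<mu> ` Q) / (2 ^ n * 4 * q ^ 3 * real (N n) ^ 2 * real (card Q))" for n and Q :: "'k set set"
  have \<kappa>_pos: "0 < \<kappa> n Q" if "finite Q" "Q \<noteq> {}" "\<forall>t\<in>Q. 0 < \<mu> t" for n Q
    using that q N(1)[of n] unfolding \<kappa>_def
    by (intro divide_pos_pos mult_pos_pos) (auto simp: card_gt_0_iff)
  obtain P where P: "cell_tree \<mu> P D" "\<And>n s. s \<in> P (Suc n) \<Longrightarrow> \<mu> s \<le> \<kappa> n (P n)"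
  proof (rule cell_tree_exists[OF comp fap decay s, of D \<kappa>])
    show "0 < D n" for n by (rule D_pos)
    show "0 < \<kappa> n Q" if "finite Q" "Q \<noteq> {}" "\<forall>t\<in>Q. 0 < \<mu> t" for n Q by (rule \<kappa>_pos[OF that])
    fix P assume "cell_tree \<mu> P D" "\<And>n s. s \<in> P (Suc n) \<Longrightarrow> \<mu> s \<le> \<kappa> n (P n)"
    then show thesis by (rule that)
  qed
  interpret cell_tree \<mu> P D by (rule P(1))
  have bad_null: "AE \<omega> in digits_measure. \<exists>U c. open U \<and> U \<noteq> {} \<and> 0 < c \<and>
      (\<forall>y\<in>U. content_ge s c {x. apply_bcontfun f x + apply_bcontfun (perturbation a \<omega>) x = y})"
    for f :: "'k \<Rightarrow>\<^sub>C 'e"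
  proof -
    obtain A where A: "norm f \<le> real A" using real_arch_simple by blast
    have fA: "apply_bcontfun f x \<in> cball 0 (real A)" for x using norm_bounded[of f x] A by simp
    have value_tree: "value_tree \<mu> P D (apply_bcontfun f) b (Z A) N digits n0" if "A \<le> n0" for n0
    proof
      show "\<exists>v\<in>Z A n. dist (apply_bcontfun f x) v \<le> b n" for n x
        using Z(3)[OF fA[of x], of n] b_pos[of n] by force
      show "\<exists>v\<in>Z A n. dist w v \<le> b n / 4" if "w \<in> Z A (Suc n)" for n w
        using Z(3)[of w A n] Z(2)[of A "Suc n"] that by blast
      show "card (Z A n) \<le> N n" if "n0 \<le> n" for n using N(2)[of A n] that \<open>A \<le> n0\<close> by simp
      show "\<exists>\<gamma>\<in>digits. norm (u - \<gamma>) \<le> 1 / 2" if "norm u \<le> 1" for u :: 'e using digits_net[OF that] .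
    qed (use b_pos b_Suc Z(1) N(1) finite_digits in auto)
    interpret V: value_tree \<mu> P D "apply_bcontfun f" b "Z A" N digits A
      by (rule value_tree) simp
    define bad where "bad n t v \<gamma> = {\<omega>. \<mu> t / (2 * real (N n)) \<le> (\<Sum>s\<in>V.cluster n t v. \<mu> s) \<and>
       (\<Sum>s | s \<in> V.cluster n t v \<and> \<omega> (cell_index (Suc n) s) = \<gamma>. \<mu> s) < \<mu> t / (4 * real (N n) * q)}" for n t v and \<gamma> :: 'e
    define Bad where "Bad n = (\<Union>i\<in>P n \<times> Z A n \<times> digits. case i of (t, v, \<gamma>) \<Rightarrow> bad n t v \<gamma>)" for n
    have cluster_sub: "V.cluster n t v \<subseteq> P (Suc n)" for n t v by (auto simp: V.cluster_def)
    have meas: "bad n t v \<gamma> \<in> sets digits_measure" for n t v \<gamma>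
    proof -
      have "(\<lambda>\<omega>. \<Sum>s\<in>V.cluster n t v. \<mu> s * indicator {\<gamma>} (\<omega> (cell_index (Suc n) s))) \<in> borel_measurable digits_measure"
        by measurable
      moreover have "(\<Sum>s\<in>V.cluster n t v. \<mu> s * indicator {\<gamma>} (\<omega> (cell_index (Suc n) s))) =
        (\<Sum>s | s \<in> V.cluster n t v \<and> \<omega> (cell_index (Suc n) s) = \<gamma>. \<mu> s)" for \<omega> :: "nat \<Rightarrow> 'e"
        using V.finite_cluster by (auto simp: sum.inter_filter intro!: sum.cong)
      ultimately have "(\<lambda>\<omega>. \<Sum>s | s \<in> V.cluster n t v \<and> \<omega> (cell_index (Suc n) s) = \<gamma>. \<mu> s) \<in> borel_measurable digits_measure"
        by simp
      then have "{\<omega> \<in> space digits_measure. \<mu> t / (2 * real (N n)) \<le> (\<Sum>s\<in>V.cluster n t v. \<mu> s) \<and>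
       (\<Sum>s | s \<in> V.cluster n t v \<and> \<omega> (cell_index (Suc n) s) = \<gamma>. \<mu> s) < \<mu> t / (4 * real (N n) * q)} \<in> sets digits_measure"
        by measurable
      then show ?thesis by (simp add: bad_def)
    qed
    have finI: "finite (P n \<times> Z A n \<times> (digits :: 'e set))" for n
      by (intro finite_cartesian_product finite_level Z(1) finite_digits)
    have meas_Bad: "Bad n \<in> sets digits_measure" for n
      unfolding Bad_def using meas finI by (intro sets.finite_UN) (auto split: prod.splits)
    interpret M: prob_space "digits_measure :: (nat \<Rightarrow> 'e) measure" by (rule prob_space_digits_measure)
    have prob_bad: "M.prob (bad n t v \<gamma>) \<le> 1 / (2 ^ n * (real (card (P n)) * (real (N n) * q)))"
      if t: "t \<in> P n" and \<gamma>: "\<gamma> \<in> digits" for n t v \<gamma>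
    proof (cases "\<mu> t / (2 * real (N n)) \<le> (\<Sum>s\<in>V.cluster n t v. \<mu> s)")
      case False
      then have "bad n t v \<gamma> = {}" by (auto simp: bad_def)
      then show ?thesis using q by simp
    next
      case True
      define W where "W = (\<Sum>s\<in>V.cluster n t v. \<mu> s)"
      have \<mu>t: "0 < \<mu> t" by (rule cell_pos[OF t])
      have Np: "0 < real (N n)" using N(1) by simp
      have cp: "0 < real (card (P n))" using finite_level level_nonempty by (simp add: card_gt_0_iff)
      have W: "\<mu> t / (2 * real (N n)) \<le> W" using True by (simp add: W_def)
      then have "0 < W" using \<mu>t Np by (smt (verit) divide_pos_pos)
      have "bad n t v \<gamma> \<subseteq> {\<omega>. (\<Sum>s | s \<in> V.cluster n t v \<and> \<omega> (cell_index (Suc n) s) = \<gamma>. \<mu> s) \<le> W / (2 * q)}"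
      proof
        fix \<omega> assume "\<omega> \<in> bad n t v \<gamma>"
        then have "(\<Sum>s | s \<in> V.cluster n t v \<and> \<omega> (cell_index (Suc n) s) = \<gamma>. \<mu> s) \<le> (\<mu> t / (2 * real (N n))) / (2 * q)"
          by (simp add: bad_def)
        also have "\<dots> \<le> W / (2 * q)" using W q by (intro divide_right_mono) auto
        finally show "\<omega> \<in> {\<omega>. (\<Sum>s | s \<in> V.cluster n t v \<and> \<omega> (cell_index (Suc n) s) = \<gamma>. \<mu> s) \<le> W / (2 * q)}" by simp
      qed
      moreover have "{\<omega>. (\<Sum>s | s \<in> V.cluster n t v \<and> \<omega> (cell_index (Suc n) s) = \<gamma>. \<mu> s) \<le> W / (2 * q)} \<in> sets digits_measure"
      proof -
        have eq: "(\<Sum>s\<in>V.cluster n t v. \<mu> s * indicator {\<gamma>} (\<omega> (cell_index (Suc n) s))) =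
          (\<Sum>s | s \<in> V.cluster n t v \<and> \<omega> (cell_index (Suc n) s) = \<gamma>. \<mu> s)" for \<omega> :: "nat \<Rightarrow> 'e"
          using V.finite_cluster by (auto simp: sum.inter_filter intro!: sum.cong)
        have "{\<omega> \<in> space digits_measure. (\<Sum>s\<in>V.cluster n t v. \<mu> s * indicator {\<gamma>} (\<omega> (cell_index (Suc n) s))) \<le> W / (2 * q)} \<in> sets digits_measure"
          by measurable
        then show ?thesis by (simp add: eq)
      qed
      ultimately have "M.prob (bad n t v \<gamma>) \<le> M.prob {\<omega>. (\<Sum>s | s \<in> V.cluster n t v \<and> \<omega> (cell_index (Suc n) s) = \<gamma>. \<mu> s) \<le> W / (2 * q)}"
        by (rule M.finite_measure_mono)
      also have "\<dots> \<le> 2 * q\<^sup>2 * \<kappa> n (P n) / W"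
        unfolding W_def q_def
      proof (rule digit_deviation)
        show "inj_on (cell_index (Suc n)) (V.cluster n t v)"
          using inj_on_cell_index cluster_sub by (rule inj_on_subset)
        show "\<mu> s \<le> \<kappa> n (P n)" if "s \<in> V.cluster n t v" for s
          using P(2) cluster_sub that by blast
      qed (use V.finite_cluster fap_nonneg[OF fap] \<gamma> \<open>0 < W\<close> in \<open>auto simp: W_def\<close>)
      also have "\<dots> \<le> 2 * q\<^sup>2 * \<kappa> n (P n) / (\<mu> t / (2 * real (N n)))"
      proof (rule frac_le)
        have "0 < \<kappa> n (P n)" using cell_pos by (intro \<kappa>_pos finite_level level_nonempty) auto
        then show "0 \<le> 2 * q\<^sup>2 * \<kappa> n (P n)" by simp
        show "0 < \<mu> t / (2 * real (N n))" using \<mu>t Np by simp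
      qed (use W in auto)
      also have "\<dots> = (4 * q\<^sup>2 * real (N n) / \<mu> t) * \<kappa> n (P n)" using Np by simp
      also have "\<dots> \<le> (4 * q\<^sup>2 * real (N n) / \<mu> t) * (\<mu> t / (2 ^ n * 4 * q ^ 3 * real (N n) ^ 2 * real (card (P n))))"
        unfolding \<kappa>_def using t finite_level Np q cp \<mu>t
        by (intro mult_left_mono divide_right_mono Min_le) auto
      also have "\<dots> = 1 / (2 ^ n * (real (card (P n)) * (real (N n) * q)))"
        using \<mu>t Np q cp by (simp add: field_simps power2_eq_square power3_eq_cube)
      finally show ?thesis .
    qed
    have prob_Bad: "M.prob (Bad n) \<le> (1 / 2) ^ n" if n: "A \<le> n" for n
    proof -
      have Np: "0 < real (N n)" using N(1) by simp
      have cp: "0 < real (card (P n))" using finite_level level_nonempty by (simp add: card_gt_0_iff)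
      let ?c = "1 / (2 ^ n * (real (card (P n)) * (real (N n) * q)))"
      have "M.prob (Bad n) \<le> (\<Sum>i\<in>P n \<times> Z A n \<times> digits. M.prob (case i of (t, v, \<gamma>) \<Rightarrow> bad n t v \<gamma>))"
        unfolding Bad_def using meas finI
        by (intro M.finite_measure_subadditive_finite) (auto split: prod.splits)
      also have "\<dots> \<le> (\<Sum>i\<in>P n \<times> Z A n \<times> (digits :: 'e set). ?c)"
        using prob_bad by (intro sum_mono) (auto split: prod.splits)
      also have "\<dots> = real (card (P n)) * (real (card (Z A n)) * q) * ?c" by (simp add: card_cartesian_product q_def)
      also have "\<dots> \<le> real (card (P n)) * (real (N n) * q) * ?c"
        using N(2)[OF n] q by (intro mult_right_mono mult_left_mono) auto
      also have "\<dots> = (1 / 2) ^ n" using Np cp q by (simp add: power_divide)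
      finally show ?thesis .
    qed
    have "AE \<omega> in digits_measure. eventually (\<lambda>n. \<omega> \<in> space digits_measure - Bad n) sequentially"
    proof (rule borel_cantelli_AE1)
      show "summable (\<lambda>n. M.prob (Bad n))"
        by (rule summable_comparison_test'[of "\<lambda>n. (1 / 2 :: real) ^ n" A]) (use prob_Bad in auto)
    qed (use meas_Bad in \<open>simp_all add: M.emeasure_eq_measure\<close>)
    then show ?thesis
    proof (rule AE_mp, intro AE_I2 impI)
      fix \<omega> :: "nat \<Rightarrow> 'e"
      assume "eventually (\<lambda>n. \<omega> \<in> space digits_measure - Bad n) sequentially"
      then obtain n1 where n1: "\<And>n. n1 \<le> n \<Longrightarrow> \<omega> \<notin> Bad n" by (auto simp: eventually_sequentially)
      define n0 where "n0 = max A n1"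
      \<comment> \<open>Only the starting level differs from \<open>V\<close>. Clusters do not
        involve it, so \<open>W.cluster\<close> and \<open>V.cluster\<close> agree and the bad
        events defined with \<open>V\<close> apply.\<close>
      interpret W: value_tree \<mu> P D "apply_bcontfun f" b "Z A" N digits n0
        by (rule value_tree) (simp add: n0_def)
      define dig where "dig n s = unit_clip (\<omega> (cell_index (Suc n) s))" for n s
      have "W.good_digits dig"
        unfolding W.good_digits_def
      proof (intro allI ballI impI)
        fix n t v and \<gamma> :: 'e
        assume n: "n0 \<le> n" and t: "t \<in> P n" "v \<in> Z A n" and \<gamma>: "\<gamma> \<in> digits"
          and le: "\<mu> t / (2 * real (N n)) \<le> (\<Sum>s\<in>W.cluster n t v. \<mu> s)"
        have "\<omega> \<notin> bad n t v \<gamma>" using n1[of n] n t \<gamma> by (auto simp: n0_def Bad_def)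
        then have "\<mu> t / (4 * real (N n) * q) \<le> (\<Sum>s | s \<in> V.cluster n t v \<and> \<omega> (cell_index (Suc n) s) = \<gamma>. \<mu> s)"
          using le by (auto simp: bad_def)
        also have "\<dots> \<le> (\<Sum>s | s \<in> V.cluster n t v \<and> dig n s = \<gamma>. \<mu> s)"
        proof (rule sum_mono2)
          have "norm \<gamma> \<le> 1" using digits_subset \<gamma> by auto
          then show "{s. s \<in> V.cluster n t v \<and> \<omega> (cell_index (Suc n) s) = \<gamma>} \<subseteq> {s. s \<in> V.cluster n t v \<and> dig n s = \<gamma>}"
            by (auto simp: dig_def unit_clip_id)
        qed (use V.finite_cluster fap_nonneg[OF fap] in auto)
        finally show "\<mu> t / (4 * real (N n) * real (card (digits :: 'e set))) \<le> (\<Sum>s | s \<in> W.cluster n t v \<and> dig n s = \<gamma>. \<mu> s)"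
          by (simp add: q_def)
      qed
      then show "\<exists>U c. open U \<and> U \<noteq> {} \<and> 0 < c \<and>
        (\<forall>y\<in>U. content_ge s c {x. apply_bcontfun f x + apply_bcontfun (perturbation a \<omega>) x = y})"
      proof (rule W.fibres_large[where p = "\<lambda>n. partial_perturbation a n \<omega>"])
        show "partial_perturbation a (Suc n) \<omega> x = partial_perturbation a n \<omega> x + b n *\<^sub>R dig n t"
          if "t \<in> P (Suc n)" "x \<in> t" for n t x
          using random_field_on_cell[OF that, of \<omega>] by (simp add: partial_perturbation_def dig_def b_def)
        show "dist (apply_bcontfun (perturbation a \<omega>) x) (partial_perturbation a n \<omega> x) \<le> 4 * b n" for n x
          using dist_partial_perturbation[of a \<omega> x n] a by (simp add: b_def)
        show "continuous_on UNIV (\<lambda>x. apply_bcontfun f x + apply_bcontfun (perturbation a \<omega>) x)"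
          by (intro continuous_on_add continuous_on_apply_bcontfun)
        show "(\<Prod>k<n + 2. 4 * real (N k) * real (card (digits :: 'e set))) * \<mu> (ball x r) \<le> r powr s"
          if "0 < r" "r < 4 * D n" for n x r
          using D_decay[OF that, of x] by (simp only: q_def)
      qed (use D_pos D_decseq D_lim s in \<open>auto simp: partial_perturbation_def\<close>)
    qed
  qed
  moreover have "norm (perturbation a \<omega>) \<le> \<epsilon>" for \<omega> :: "nat \<Rightarrow> 'e"
    using norm_perturbation[of a \<omega>] a by (simp add: a_def)
  moreover have "continuous_on UNIV (perturbation a :: (nat \<Rightarrow> 'e) \<Rightarrow> _)"
    using a by (intro continuous_on_perturbation) simp
  ultimately show ?thesis by (intro exI[of _ "perturbation a"] conjI allI)
qed

section \<open>Prevalence\<close>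

text \<open>If the measure vanished for some \<open>t < s\<close>, a cheap cover by bounded sets
  could be turned into a cheap cover by balls of radius at most 1. For such radii
  \<open>r powr s \<le> r powr t\<close>, contradicting the content bound.\<close>

lemma content_ge_imp_hausdorff_dim:
  assumes A: "content_ge s c A" and c: "0 < c" and s: "0 \<le> s"
  shows "ereal s \<le> hausdorff_dim A"
proof -
  have "A \<noteq> {}"
  proof
    assume "A = {}"
    then have "ennreal c \<le> (\<Sum>i::nat. ennreal (0 powr s))"
      using A[unfolded content_ge_def, rule_format, of "\<lambda>_. 0"] by simp
    then show False using c by simp
  qed
  have "s \<le> t" if t: "0 \<le> t" "hausdorff_measure t A = 0" for t
  proof (rule ccontr)
    assume "\<not> s \<le> t"
    define e where "e = min c 1 / 2"
    have e: "0 < e" "e \<le> 1 / 2" "2 * e \<le> c" using c by (auto simp: e_def)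
    have "hausdorff_premeasure 1 t A \<le> hausdorff_measure t A"
      unfolding hausdorff_measure_def by (intro SUP_upper) auto
    then have "hausdorff_premeasure 1 t A < ennreal e" using t(2) e(1) by simp
    then obtain U where U: "U \<in> delta_covers 1 A" "(\<Sum>i. diam_pow t (U i)) < ennreal e"
      unfolding hausdorff_premeasure_def by (auto simp: INF_less_iff)
    have cov: "A \<subseteq> (\<Union>i. U i)" and bnd: "\<And>i. bounded (U i)" using U(1) by (auto simp: delta_covers_def)
    have term_le: "diam_pow t (U i) \<le> (\<Sum>i. diam_pow t (U i))" for i
      using sum_le_suminf[of "\<lambda>i. diam_pow t (U i)" "{i}"] by simp
    obtain i0 where i0: "U i0 \<noteq> {}" using cov \<open>A \<noteq> {}\<close> by blast
    have "t \<noteq> 0"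
    proof
      assume "t = 0"
      then have "diam_pow t (U i0) = ennreal 1" using i0 by (simp add: diam_pow_def)
      then have "ennreal 1 < ennreal e" using le_less_trans[OF term_le[of i0] U(2)] by simp
      then have "1 < e" by (subst (asm) ennreal_less_iff) auto
      then show False using e(2) by simp
    qed
    then have "0 < t" using t(1) by simp
    \<comment> \<open>The slack makes the ball of radius \<open>d i powr (1 / t)\<close> strictly
      larger than the diameter, so that it contains the covering set even when the latter is a
      single point. All the slack adds up to \<open>e\<close>.\<close>
    define d where "d i = diameter (U i) powr t + e * (1 / 2) ^ Suc i" for i
    have d_gt: "diameter (U i) powr t < d i" for i using e(1) by (simp add: d_def)
    have d_pos: "0 < d i" for i using d_gt[of i] powr_ge_zero[of "diameter (U i)" t] by linarith
    define r where "r i = (if U i = {} then 0 else d i powr (1 / t))" for i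
    define x where "x i = (SOME z. z \<in> U i)" for i
    have sub: "U i \<subseteq> ball (x i) (r i)" for i
    proof
      fix z assume z: "z \<in> U i"
      then have "x i \<in> U i" unfolding x_def by (rule someI)
      then have "dist (x i) z \<le> diameter (U i)" using diameter_bounded_bound[OF bnd] z by blast
      also have "\<dots> = (diameter (U i) powr t) powr (1 / t)"
        using diameter_ge_0[OF bnd] \<open>0 < t\<close> by (simp add: powr_powr)
      also have "\<dots> < d i powr (1 / t)" using d_gt \<open>0 < t\<close> by (intro powr_less_mono2) auto
      finally show "z \<in> ball (x i) (r i)" using z by (auto simp: r_def)
    qed
    have r_t: "ennreal (r i powr t) \<le> diam_pow t (U i) + ennreal (e * (1 / 2) ^ Suc i)" for i
    proof (cases "U i = {}")
      case False
      have "r i powr t = d i" using False d_pos[of i] \<open>0 < t\<close> by (simp add: r_def powr_powr)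
      then show ?thesis using False \<open>0 < t\<close> e(1) by (simp add: d_def diam_pow_def)
    qed (simp add: r_def)
    have geo: "(\<Sum>i. ennreal (e * (1 / 2) ^ Suc i)) = ennreal e"
    proof -
      have "(\<lambda>i. e * (1 / 2) ^ Suc i) sums (e * 1)" by (intro sums_mult power_half_series)
      then have "(\<lambda>i. e * (1 / 2) ^ Suc i) sums e" by (simp only: mult_1_right)
      then show ?thesis using e(1) by (intro suminf_ennreal_eq) auto
    qed
    have "(\<Sum>i. ennreal (r i powr t)) \<le> (\<Sum>i. diam_pow t (U i) + ennreal (e * (1 / 2) ^ Suc i))"
      using r_t by (intro suminf_le) auto
    also have "\<dots> = (\<Sum>i. diam_pow t (U i)) + ennreal e" by (subst suminf_add[symmetric]) (simp_all only: geo summableI)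
    also have "\<dots> < ennreal e + ennreal e" using U(2) by (subst (1) add.commute) (simp add: ennreal_add_left_cancel_less)
    also have "\<dots> = ennreal (2 * e)" using e(1) by (simp flip: ennreal_plus)
    finally have sum_t: "(\<Sum>i. ennreal (r i powr t)) < ennreal (2 * e)" .
    have r_nonneg: "0 \<le> r i" for i by (simp add: r_def)
    have r_le_1: "r i \<le> 1" for i
    proof (rule ccontr)
      assume "\<not> r i \<le> 1"
      then have "1 \<le> r i powr t" using \<open>0 < t\<close> by (intro ge_one_powr_ge_zero) auto
      moreover have "ennreal (r i powr t) < ennreal (2 * e)"
        using ennreal_suminf_lessD[of "\<lambda>i. ennreal (r i powr t)" "ennreal (2 * e)" i] sum_t by blast
      then have "r i powr t < 2 * e" by (simp add: ennreal_less_iff)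
      ultimately show False using e(2) by simp
    qed
    have "ennreal c \<le> (\<Sum>i. ennreal (r i powr s))"
      using A[unfolded content_ge_def, rule_format, of r x] r_nonneg cov sub by blast
    also have "\<dots> \<le> (\<Sum>i. ennreal (r i powr t))"
      using r_nonneg r_le_1 \<open>\<not> s \<le> t\<close> by (intro suminf_le ennreal_leI powr_mono') auto
    also have "\<dots> < ennreal (2 * e)" by (rule sum_t)
    also have "\<dots> \<le> ennreal c" using e(3) by (rule ennreal_leI)
    finally show False by simp
  qed
  then show ?thesis using \<open>A \<noteq> {}\<close> by (auto simp: hausdorff_dim_def intro!: Inf_greatest)
qed

section \<open>Measurability of the set of good maps\<close>

lemma content_ge_antimono: "content_ge s c A \<Longrightarrow> c' \<le> c \<Longrightarrow> content_ge s c' A"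
  unfolding content_ge_def by (meson ennreal_leI order_trans)

text \<open>A cheap family of open balls covering the fibre of \<open>h\<close> leaves out a compact
  set on which \<open>h\<close> keeps a positive distance from \<open>y\<close>. The same balls then
  cover the fibre of every map sufficiently close to \<open>h\<close>, so violating the content
  bound is an open condition.\<close>

lemma closed_content_ge:
  assumes comp: "compact (UNIV :: 'k::metric_space set)"
  shows "closed {h :: 'k \<Rightarrow>\<^sub>C 'e::euclidean_space. content_ge s c (apply_bcontfun h -` {y})}"
  unfolding closed_def open_dist
proof
  fix h :: "'k \<Rightarrow>\<^sub>C 'e" assume "h \<in> - {h. content_ge s c (apply_bcontfun h -` {y})}"
  then obtain x :: "nat \<Rightarrow> 'k" and r where xr: "\<And>i. 0 \<le> r i" "apply_bcontfun h -` {y} \<subseteq> (\<Union>i. ball (x i) (r i))"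
    "\<not> ennreal c \<le> (\<Sum>i. ennreal (r i powr s))" by (auto simp: content_ge_def)
  define W where "W = (\<Union>i. ball (x i) (r i))"
  have "\<exists>\<eta>>0. \<forall>z. z \<notin> W \<longrightarrow> \<eta> \<le> dist (h z) y"
  proof (cases "W = UNIV")
    case False
    have "open W" by (auto simp: W_def)
    then have "compact (- W)" using compact_Int_closed[OF comp, of "- W"] by (simp add: closed_Compl)
    moreover have "continuous_on (- W) (\<lambda>z. dist (h z) y)" by (intro continuous_intros continuous_on_apply_bcontfun)
    ultimately obtain z where z: "z \<in> - W" "\<And>z'. z' \<in> - W \<Longrightarrow> dist (h z) y \<le> dist (h z') y"
      using continuous_attains_inf[of "- W" "\<lambda>z. dist (h z) y"] False by blast
    then have "0 < dist (h z) y" using xr(2) by (auto simp: W_def)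
    then show ?thesis using z(2) by (intro exI[of _ "dist (h z) y"]) auto
  qed (auto intro: exI[of _ 1])
  then obtain \<eta> where \<eta>: "0 < \<eta>" "\<And>z. z \<notin> W \<Longrightarrow> \<eta> \<le> dist (h z) y" by blast
  have "\<not> content_ge s c (apply_bcontfun h' -` {y})" if "dist h' h < \<eta>" for h'
  proof
    assume "content_ge s c (apply_bcontfun h' -` {y})"
    moreover have "apply_bcontfun h' -` {y} \<subseteq> (\<Union>i. ball (x i) (r i))"
    proof
      fix z assume "z \<in> apply_bcontfun h' -` {y}"
      then have "dist (h z) y < \<eta>" using dist_fun_lt_imp_dist_val_lt[OF that, of z] by (simp add: dist_commute)
      then show "z \<in> (\<Union>i. ball (x i) (r i))" using \<eta>(2)[of z] by (auto simp: W_def)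
    qed
    ultimately show False using xr(1,3) unfolding content_ge_def by blast
  qed
  then show "\<exists>e>0. \<forall>h'. dist h' h < e \<longrightarrow> h' \<in> - {h. content_ge s c (apply_bcontfun h -` {y})}"
    using \<eta>(1) by blast
qed

definition large_fibre_maps :: "real \<Rightarrow> ('k::metric_space \<Rightarrow>\<^sub>C 'e::euclidean_space) set" where
  "large_fibre_maps s = {h. \<exists>U c. open U \<and> U \<noteq> {} \<and> 0 < c \<and> (\<forall>y\<in>U. content_ge s c (apply_bcontfun h -` {y}))}"

text \<open>\<open>U\<close> can be shrunk to a member of a countable basis and \<open>c\<close>
  lowered to some \<open>1 / real (Suc m)\<close>, which leaves a countable union; the uncountable
  intersection over \<open>y\<close> is one of closed sets.\<close>

lemma borel_large_fibre_maps:
  assumes comp: "compact (UNIV :: 'k::metric_space set)"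
  shows "(large_fibre_maps s :: ('k \<Rightarrow>\<^sub>C 'e::euclidean_space) set) \<in> sets borel"
proof -
  obtain \<B> :: "'e set set" where \<B>: "countable \<B>" "topological_basis \<B>" using ex_countable_basis by blast
  define G :: "'e set \<Rightarrow> nat \<Rightarrow> ('k \<Rightarrow>\<^sub>C 'e) set"
    where "G B m = (\<Inter>y\<in>B. {h. content_ge s (1 / real (Suc m)) (apply_bcontfun h -` {y})})" for B m
  have "large_fibre_maps s = (\<Union>B\<in>\<B> - {{}}. \<Union>m. G B m)"
  proof (intro set_eqI iffI)
    fix h :: "'k \<Rightarrow>\<^sub>C 'e" assume "h \<in> large_fibre_maps s"
    then obtain U c where U: "open U" "U \<noteq> {}" "0 < c" "\<And>y. y \<in> U \<Longrightarrow> content_ge s c (apply_bcontfun h -` {y})"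
      by (auto simp: large_fibre_maps_def)
    then obtain z where "z \<in> U" by blast
    then obtain B where B: "B \<in> \<B>" "z \<in> B" "B \<subseteq> U" using topological_basisE[OF \<B>(2) U(1)] by metis
    obtain m where m: "1 / real (Suc m) < c" using nat_approx_posE[OF U(3)] by blast
    have "content_ge s (1 / real (Suc m)) (apply_bcontfun h -` {y})" if "y \<in> B" for y
      using content_ge_antimono[OF U(4)] m B(3) that by (meson less_imp_le subsetD)
    then have "h \<in> G B m" by (auto simp: G_def)
    then show "h \<in> (\<Union>B\<in>\<B> - {{}}. \<Union>m. G B m)" using B by blast
  next
    fix h assume "h \<in> (\<Union>B\<in>\<B> - {{}}. \<Union>m. G B m)"
    then obtain B m where "B \<in> \<B>" "B \<noteq> {}" "h \<in> G B m" by blast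
    then show "h \<in> large_fibre_maps s"
      using topological_basis_open[OF \<B>(2)] unfolding large_fibre_maps_def G_def
      by (intro CollectI exI[of _ B] exI[of _ "1 / real (Suc m)"]) auto
  qed
  moreover have "closed (G B m)" for B m unfolding G_def by (intro closed_INT ballI closed_content_ge[OF comp])
  then have "(\<Union>B\<in>\<B> - {{}}. \<Union>m. G B m) \<in> sets borel"
    using \<B>(1) by (intro sets.countable_UN'' countable_Diff) (auto intro!: borel_closed)
  ultimately show ?thesis by simp
qed

section \<open>Countable intersections by superposed perturbations\<close>

lemma prevalent_mono: "prevalent A \<Longrightarrow> A \<subseteq> B \<Longrightarrow> prevalent B"
  unfolding prevalent_def shy_def by (meson Compl_subset_Compl_iff subset_trans)

text \<open>
  Shyness of a countable union is obtained by adding up independent small perturbations, one for each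
  set: by Fubini each of them acts as if the other ones were deterministic.
\<close>

lemma prevalent_INT_perturbations:
  fixes X :: "nat \<Rightarrow> 'a::second_countable_topology \<Rightarrow> 'g::banach"
  assumes P: "prob_space P" "sets P = sets borel"
    and X: "\<And>n. continuous_on UNIV (X n)" "\<And>n \<omega>. norm (X n \<omega>) \<le> (1 / 2) ^ n"
    and G: "\<And>n. G n \<in> sets borel" "\<And>n g. AE \<omega> in P. g + X n \<omega> \<in> G n"
  shows "prevalent (\<Inter>n. G n)"
proof -
  define M where "M = PiM (UNIV :: nat set) (\<lambda>_. P)"
  define Y where "Y \<omega> = (\<Sum>n. X n (\<omega> n))" for \<omega>
  have spP: "space P = UNIV" using sets_eq_imp_space_eq[OF P(2)] by simp
  have prob_M: "prob_space M" unfolding M_def by (intro prob_space_PiM P(1))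
  have sets_M: "sets M = sets borel"
  proof -
    have "sets M = sets (PiM UNIV (\<lambda>_::nat. borel :: 'a measure))"
      unfolding M_def by (intro sets_PiM_cong) (auto simp: P(2))
    then show ?thesis by (simp only: sets_PiM_equal_borel)
  qed
  have spM: "space M = UNIV" using sets_eq_imp_space_eq[OF sets_M] by simp
  have summ: "summable (\<lambda>n. X n (\<omega> n))" for \<omega>
    by (rule summable_comparison_test'[of "\<lambda>n. (1 / 2) ^ n" 0]) (use X(2) in auto)
  have "continuous_on UNIV Y"
  proof -
    have "uniform_limit UNIV (\<lambda>n \<omega>. \<Sum>k<n. X k (\<omega> k)) Y sequentially"
      unfolding Y_def by (rule Weierstrass_m_test[of _ _ "\<lambda>n. (1 / 2) ^ n"]) (use X(2) in auto)
    moreover have "continuous_on UNIV (\<lambda>\<omega>. \<Sum>k<n. X k (\<omega> k))" for n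
      by (intro continuous_on_sum continuous_on_compose2[OF X(1)] continuous_on_product_coordinates) auto
    ultimately show ?thesis by (intro uniform_limit_theorem[where F = sequentially]) auto
  qed
  then have Y_meas: "Y \<in> M \<rightarrow>\<^sub>M borel"
    using borel_measurable_continuous_onI measurable_cong_sets[OF sets_M refl] by blast
  have AE_n: "AE \<omega> in M. g + Y \<omega> \<in> G n" for g n
  proof -
    define M' where "M' = PiM (- {n}) (\<lambda>_. P)"
    interpret P: prob_space P by (rule P(1))
    interpret M': prob_space M' unfolding M'_def by (intro prob_space_PiM P(1))
    interpret pair_sigma_finite P M' ..
    have ins: "insert n (- {n}) = UNIV" by auto
    define u where "u = (\<lambda>(x :: 'a, \<omega> :: nat \<Rightarrow> 'a). fun_upd \<omega> n x)"
    have M_eq: "M = distr (P \<Otimes>\<^sub>M M') M u"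
      using distr_pair_PiM_eq_PiM[of "- {n}" "\<lambda>_. P" n] P(1) unfolding ins M_def M'_def u_def by simp
    have u_meas: "u \<in> P \<Otimes>\<^sub>M M' \<rightarrow>\<^sub>M M"
    proof -
      have "(\<lambda>(\<omega>, x). fun_upd \<omega> n x) \<in> M' \<Otimes>\<^sub>M P \<rightarrow>\<^sub>M M"
        using measurable_add_dim[of n "- {n}" "\<lambda>_. P"] unfolding ins M_def M'_def .
      from measurable_compose[OF measurable_pair_swap' this] show ?thesis
        by (simp add: u_def split_beta')
    qed
    have meas: "{\<omega> \<in> space M. g + Y \<omega> \<in> G n} \<in> sets M"
    proof -
      have "(\<lambda>z. g + z) -` G n \<inter> space borel \<in> sets borel"
        by (rule measurable_sets[OF _ G(1)]) (intro borel_measurable_continuous_onI continuous_intros)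
      then have "Y -` ((\<lambda>z. g + z) -` G n) \<inter> space M \<in> sets M" by (intro measurable_sets[OF Y_meas]) simp
      moreover have "Y -` ((\<lambda>z. g + z) -` G n) \<inter> space M = {\<omega> \<in> space M. g + Y \<omega> \<in> G n}" by auto
      ultimately show ?thesis by simp
    qed
    have Y_upd: "Y (fun_upd \<omega> n x) = Y (fun_upd \<omega> n x') - X n x' + X n x" for \<omega> x x'
    proof -
      have "Y (fun_upd \<omega> n x) - Y (fun_upd \<omega> n x') = (\<Sum>k. X k ((fun_upd \<omega> n x) k) - X k ((fun_upd \<omega> n x') k))"
        unfolding Y_def by (rule suminf_diff[OF summ summ])
      also have "\<dots> = (\<Sum>k\<in>{n}. X k ((fun_upd \<omega> n x) k) - X k ((fun_upd \<omega> n x') k))"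
        by (rule suminf_finite) auto
      finally show ?thesis by (simp add: algebra_simps)
    qed
    \<comment> \<open>With all other coordinates frozen, \<open>Y\<close> depends on the coordinate
      \<open>n\<close> only through the summand \<open>X n x\<close>; the rest is the translation
      \<open>c\<close>, computed from an arbitrary reference value \<open>x'\<close>. The hypothesis
      on \<open>G n\<close> holds for all translates, in particular for
      \<open>g + c\<close>.\<close>
    have "AE x in P. g + Y (fun_upd \<omega> n x) \<in> G n" for \<omega>
    proof -
      fix x' :: 'a
      define c where "c = Y (fun_upd \<omega> n x') - X n x'"
      have "g + Y (fun_upd \<omega> n x) = (g + c) + X n x" for x
        using Y_upd[of \<omega> x x'] by (simp add: c_def)
      then show ?thesis using G(2)[of "g + c" n] by (simp only:)
    qed
    then have "AE \<omega> in M'. AE x in P. g + Y (u (x, \<omega>)) \<in> G n" by (simp add: u_def)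
    moreover have pm: "{z \<in> space (P \<Otimes>\<^sub>M M'). g + Y (u z) \<in> G n} \<in> sets (P \<Otimes>\<^sub>M M')"
    proof -
      have "u -` {\<omega> \<in> space M. g + Y \<omega> \<in> G n} \<inter> space (P \<Otimes>\<^sub>M M') \<in> sets (P \<Otimes>\<^sub>M M')"
        by (rule measurable_sets[OF u_meas meas])
      moreover have "u -` {\<omega> \<in> space M. g + Y \<omega> \<in> G n} \<inter> space (P \<Otimes>\<^sub>M M') = {z \<in> space (P \<Otimes>\<^sub>M M'). g + Y (u z) \<in> G n}"
        by (auto simp: spM)
      ultimately show ?thesis by simp
    qed
    ultimately have "AE x in P. AE \<omega> in M'. g + Y (u (x, \<omega>)) \<in> G n"
      using AE_commute[of "\<lambda>x \<omega>. g + Y (u (x, \<omega>)) \<in> G n"] by (simp add: split_beta')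
    then have "AE z in P \<Otimes>\<^sub>M M'. g + Y (u z) \<in> G n"
      by (intro AE_pair_measure pm)
    then show ?thesis
      by (subst M_eq, subst AE_distr_iff[OF u_meas meas]) simp
  qed
  define \<nu> where "\<nu> = distr M borel Y"
  have "shy (- (\<Inter>n. G n))"
    unfolding shy_def
  proof (intro exI[of _ "- (\<Inter>n. G n)"] exI[of _ \<nu>] conjI allI)
    show B: "- (\<Inter>n. G n) \<in> sets borel" using G(1) by auto
    show "prob_space \<nu>" unfolding \<nu>_def using prob_M Y_meas by (rule prob_space.prob_space_distr)
    show "sets \<nu> = sets borel" by (simp add: \<nu>_def)
    fix x :: 'g
    define C where "C = (\<lambda>b. b + x) ` (- (\<Inter>n. G n))"
    have mem: "z \<in> C \<longleftrightarrow> - x + z \<in> - (\<Inter>n. G n)" for z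
    proof
      assume "- x + z \<in> - (\<Inter>n. G n)"
      then show "z \<in> C" unfolding C_def by (intro image_eqI[of _ _ "- x + z"]) simp
    qed (auto simp: C_def)
    have "(\<lambda>z. - x + z) -` (- (\<Inter>n. G n)) \<inter> space borel \<in> sets borel"
      by (rule measurable_sets[OF _ B]) (intro borel_measurable_continuous_onI continuous_intros)
    moreover have "(\<lambda>z. - x + z) -` (- (\<Inter>n. G n)) \<inter> space borel = C" using mem by auto
    ultimately have C: "C \<in> sets borel" by (simp only:)
    have N: "Y -` C \<inter> space M \<in> sets M" by (rule measurable_sets[OF Y_meas C])
    have "AE \<omega> in M. \<forall>n. - x + Y \<omega> \<in> G n" unfolding AE_all_countable using AE_n by blast
    then have "AE \<omega> in M. Y \<omega> \<notin> C" by (rule AE_mp) (simp add: mem)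
    moreover have "{\<omega> \<in> space M. \<not> Y \<omega> \<notin> C} = Y -` C \<inter> space M" by auto
    ultimately have "emeasure M (Y -` C \<inter> space M) = 0" using AE_iff_measurable[OF N, of "\<lambda>\<omega>. Y \<omega> \<notin> C"] by blast
    then show "emeasure \<nu> ((\<lambda>b. b + x) ` (- (\<Inter>n. G n))) = 0"
      unfolding \<nu>_def C_def[symmetric] by (subst emeasure_distr[OF Y_meas C])
  qed simp
  then show ?thesis by (simp add: prevalent_def)
qed

section \<open>Prevalence of large fibres\<close>

lemma hausdorff_dim_mono:
  assumes "A \<subseteq> B"
  shows "hausdorff_dim A \<le> hausdorff_dim B"
proof -
  have "hausdorff_measure t A \<le> hausdorff_measure t B" for t
    unfolding hausdorff_measure_def hausdorff_premeasure_def
    by (intro SUP_mono' INF_superset_mono) (use assms in \<open>auto simp: delta_covers_def\<close>)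
  then have *: "Inf {ereal s | s. 0 \<le> s \<and> hausdorff_measure s A = 0} \<le> Inf {ereal s | s. 0 \<le> s \<and> hausdorff_measure s B = 0}"
    by (intro Inf_superset_mono) (auto, metis le_zero_eq)
  \<comment> \<open>This settles an empty \<open>A\<close> inside a nonempty \<open>B\<close>, where
    the convention assigns dimension -1 to \<open>A\<close>.\<close>
  have "(-1 :: ereal) \<le> Inf {ereal s | s. 0 \<le> s \<and> hausdorff_measure s B = 0}"
    by (intro Inf_greatest) (auto simp: one_ereal_def)
  with * show ?thesis using assms by (auto simp: hausdorff_dim_def)
qed

lemma prevalent_large_fibres:
  assumes comp: "compact (UNIV :: 'k::metric_space set)" and unc: "uncountable (UNIV :: 'k set)"
  shows "prevalent {f :: 'k \<Rightarrow>\<^sub>C 'e::euclidean_space. \<forall>s. ereal s < hausdorff_dim (UNIV :: 'k set) \<longrightarrow>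
    (\<exists>U. open U \<and> U \<noteq> {} \<and> (\<forall>y\<in>U. ereal s \<le> hausdorff_dim (apply_bcontfun f -` {y})))}"
proof -
  \<comment> \<open>The exponent 0 is included even when \<open>K\<close> has dimension 0. It serves
    all negative \<open>s\<close>, where the fibres over an open set must at least be nonempty, and
    its measure comes from uncountability instead of Frostman's lemma.\<close>
  define S where "S = insert 0 {t \<in> \<rat>. 0 \<le> t \<and> ereal t < hausdorff_dim (UNIV :: 'k set)}"
  define \<sigma> where "\<sigma> = from_nat_into S"
  have "countable S" unfolding S_def by (intro countable_insert countable_subset[OF _ countable_rat]) auto
  moreover have "S \<noteq> {}" by (simp add: S_def)
  ultimately have range: "range \<sigma> = S" unfolding \<sigma>_def by simp
  have \<sigma>_nonneg: "0 \<le> \<sigma> n" for n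
  proof -
    have "\<sigma> n \<in> S" using range by blast
    then show ?thesis by (auto simp: S_def)
  qed
  have \<mu>: "\<exists>\<mu> :: 'k set \<Rightarrow> real. finitely_additive_prob \<mu> \<and> mass_decay \<mu> (\<sigma> n)" for n
  proof -
    have "\<sigma> n \<in> S" using range by blast
    then consider "\<sigma> n = 0" | "0 \<le> \<sigma> n" "ereal (\<sigma> n) < hausdorff_dim (UNIV :: 'k set)" by (auto simp: S_def)
    then show ?thesis
    proof cases
      case 1
      then show ?thesis using uncountable_imp_diffuse_fap[OF comp unc] by simp
    next
      case 2
      show ?thesis by (rule frostman[OF comp 2]) blast
    qed
  qed
  have "\<forall>n. \<exists>X :: (nat \<Rightarrow> 'e) \<Rightarrow> 'k \<Rightarrow>\<^sub>C 'e. continuous_on UNIV X \<and> (\<forall>\<omega>. norm (X \<omega>) \<le> (1 / 2) ^ n) \<and>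
    (\<forall>f. AE \<omega> in digits_measure. f + X \<omega> \<in> large_fibre_maps (\<sigma> n))"
  proof
    fix n
    obtain \<mu> :: "'k set \<Rightarrow> real" where \<mu>: "finitely_additive_prob \<mu>" "mass_decay \<mu> (\<sigma> n)" using \<mu> by blast
    have "{x. apply_bcontfun f x + apply_bcontfun g x = y} = apply_bcontfun (f + g) -` {y}" for f g :: "'k \<Rightarrow>\<^sub>C 'e" and y
      by (auto simp: plus_bcontfun.rep_eq)
    then show "\<exists>X :: (nat \<Rightarrow> 'e) \<Rightarrow> 'k \<Rightarrow>\<^sub>C 'e. continuous_on UNIV X \<and> (\<forall>\<omega>. norm (X \<omega>) \<le> (1 / 2) ^ n) \<and>
      (\<forall>f. AE \<omega> in digits_measure. f + X \<omega> \<in> large_fibre_maps (\<sigma> n))"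
      using random_perturbation[OF comp \<mu> \<sigma>_nonneg, of "(1 / 2) ^ n", where 'e = 'e] by (simp add: large_fibre_maps_def)
  qed
  then obtain X :: "nat \<Rightarrow> (nat \<Rightarrow> 'e) \<Rightarrow> 'k \<Rightarrow>\<^sub>C 'e" where X: "\<And>n. continuous_on UNIV (X n)"
    "\<And>n \<omega>. norm (X n \<omega>) \<le> (1 / 2) ^ n" "\<And>n f. AE \<omega> in digits_measure. f + X n \<omega> \<in> large_fibre_maps (\<sigma> n)"
    by metis
  have "prevalent (\<Inter>n. large_fibre_maps (\<sigma> n) :: ('k \<Rightarrow>\<^sub>C 'e) set)"
    by (rule prevalent_INT_perturbations[OF prob_space_digits_measure sets_digits_measure X(1,2) borel_large_fibre_maps[OF comp] X(3)])
  then show ?thesis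
  proof (rule prevalent_mono, safe)
    fix f :: "'k \<Rightarrow>\<^sub>C 'e" and s
    assume f: "f \<in> (\<Inter>n. large_fibre_maps (\<sigma> n))" and s: "ereal s < hausdorff_dim (UNIV :: 'k set)"
    have "\<exists>t\<in>S. s \<le> t"
    proof (cases "s < 0")
      case True
      then show ?thesis by (auto simp: S_def)
    next
      case False
      obtain t where t: "ereal s < ereal t" "ereal t < hausdorff_dim (UNIV :: 'k set)"
        using ereal_dense2[OF s] by blast
      obtain u where u: "u \<in> \<rat>" "s < u" "u < t" using Rats_dense_in_real[of s t] t(1) by auto
      have "ereal u < hausdorff_dim (UNIV :: 'k set)" using u(3) t(2) by (meson ereal_less_eq(3) le_less_trans less_imp_le)
      then show ?thesis using u False by (intro bexI[of _ u]) (auto simp: S_def)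
    qed
    then obtain n where n: "s \<le> \<sigma> n" using range by (metis imageE)
    have "f \<in> large_fibre_maps (\<sigma> n)" using f by blast
    then obtain U c where U: "open U" "U \<noteq> {}" "0 < c" "\<And>y. y \<in> U \<Longrightarrow> content_ge (\<sigma> n) c (apply_bcontfun f -` {y})"
      by (auto simp: large_fibre_maps_def)
    have "ereal s \<le> hausdorff_dim (apply_bcontfun f -` {y})" if "y \<in> U" for y
      using content_ge_imp_hausdorff_dim[OF U(4)[OF that] U(3) \<sigma>_nonneg] n by (meson ereal_less_eq(3) order_trans)
    then show "\<exists>U. open U \<and> U \<noteq> {} \<and> (\<forall>y\<in>U. ereal s \<le> hausdorff_dim (apply_bcontfun f -` {y}))"
      using U(1,2) by blast
  qed
qed

theorem theorem4p18:
  assumes "compact (UNIV :: 'k::metric_space set)"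
    and "uncountable (UNIV :: 'k set)"
  shows "prevalent {f :: 'k \<Rightarrow>\<^sub>C (real ^ 'd).
           \<forall>s::real. ereal s < hausdorff_dim (UNIV :: 'k set) \<longrightarrow>
             (\<exists>U :: (real ^ 'd) set. open U \<and> U \<noteq> {} \<and>
               (\<forall>y\<in>U. ereal s \<le> hausdorff_dim (apply_bcontfun f -` {y})))}
       \<and> prevalent {f :: 'k \<Rightarrow>\<^sub>C (real ^ 'd).
           (SUP y. hausdorff_dim (apply_bcontfun f -` {y})) = hausdorff_dim (UNIV :: 'k set)}"
proof
  show first: "prevalent {f :: 'k \<Rightarrow>\<^sub>C (real ^ 'd).
           \<forall>s::real. ereal s < hausdorff_dim (UNIV :: 'k set) \<longrightarrow>
             (\<exists>U :: (real ^ 'd) set. open U \<and> U \<noteq> {} \<and>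
               (\<forall>y\<in>U. ereal s \<le> hausdorff_dim (apply_bcontfun f -` {y})))}"
    by (rule prevalent_large_fibres[OF assms])
  show "prevalent {f :: 'k \<Rightarrow>\<^sub>C (real ^ 'd).
           (SUP y. hausdorff_dim (apply_bcontfun f -` {y})) = hausdorff_dim (UNIV :: 'k set)}"
  proof (rule prevalent_mono[OF first], rule subsetI, rule CollectI, rule antisym)
    fix f :: "'k \<Rightarrow>\<^sub>C (real ^ 'd)"
    assume f: "f \<in> {f. \<forall>s::real. ereal s < hausdorff_dim (UNIV :: 'k set) \<longrightarrow>
      (\<exists>U. open U \<and> U \<noteq> {} \<and> (\<forall>y\<in>U. ereal s \<le> hausdorff_dim (apply_bcontfun f -` {y})))}"
    show "(SUP y. hausdorff_dim (apply_bcontfun f -` {y})) \<le> hausdorff_dim (UNIV :: 'k set)"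
      by (intro SUP_least hausdorff_dim_mono) simp
    show "hausdorff_dim (UNIV :: 'k set) \<le> (SUP y. hausdorff_dim (apply_bcontfun f -` {y}))"
    proof (rule ccontr)
      assume "\<not> ?thesis"
      \<comment> \<open>The dimensions are extended reals, while the first part speaks of real
        exponents; a real number strictly in between also handles an infinite dimension of
        \<open>K\<close>.\<close>
      then obtain s where s: "(SUP y. hausdorff_dim (apply_bcontfun f -` {y})) < ereal s"
        "ereal s < hausdorff_dim (UNIV :: 'k set)"
        using ereal_dense2 by (metis not_le)
      then obtain y where "ereal s \<le> hausdorff_dim (apply_bcontfun f -` {y})" using f by blast
      also have "\<dots> \<le> (SUP y. hausdorff_dim (apply_bcontfun f -` {y}))" by (rule SUP_upper) simp
      finally show False using s(1) by simp
    qed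
  qed
qed

end
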